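(* Let $(T,d_T)$ be a complete separable metric space, let $K\colon T\times T\to\mathbb{R}$ be a continuous positive-semidefinite kernel whose reproducing kernel Hilbert space (RKHS) $H(K)$ is infinite-dimensional and separable, and let $(X(t))_{t\in T}\sim\mathcal{GP}(0,K)$ be a zero-mean Gaussian process with covariance $K$ and continuous paths. Let $\Phi=(\phi_n)_{n=1}^\infty$ be an orthonormal basis of $H(K)$ and suppose that there is a $\Phi$-scaling $A=(\alpha_n)_{n=1}^\infty$ of $H(K)$ such that $\sum_{n=1}^\infty\alpha_n^{-1}<\infty$ and $K_{A,\Phi}$ is continuous. Let $\Sigma_\Phi$ be the collection of $\Phi$-scalings of $H(K)$ such that the corresponding scaled kernels are continuous. Suppose that $d_K(t,t')=\|K(\cdot,t)-K(\cdot,t')\|_K$ is a metric on $T$ and let $\mathfrak{R}=\{K_{A,\Phi}:A\in\Sigma_\Phi\}$. Then the sample support set $S_{\mathfrak{R}}(K)$ is non-empty and consists precisely of the functions $f=\sum_{n=1}^\infty f_n\phi_n$ such that $$\liminf_{n\to\infty}f_n^2>0\quad\text{and}\quad\sup_{n\ge1}f_n^2<\infty.$$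
   Context: Kernels. $K$ is positive-semidefinite if $\sum_{i,j=1}^N a_ia_jK(t_i,t_j)\ge 0$ for all $N\ge1$, $a_i\in\mathbb{R}$, $t_i\in T$. $H(K)$ denotes the RKHS of $K$, with norm $\|\cdot\|_K$. $C(T)$ is the set of continuous real-valued functions on $T$. Scalings. For an orthonormal basis $\Phi=(\phi_n)_{n=1}^\infty$ of $H(K)$, a positive sequence $A=(\alpha_n)_{n=1}^\infty$ is a $\Phi$-scaling of $H(K)$ if $\sum_{n=1}^\infty\alpha_n\phi_n(t)^2<\infty$ for every $t\in T$. The scaled kernel is $K_{A,\Phi}(t,t')=\sum_{n=1}^\infty\alpha_n\phi_n(t)\phi_n(t')$, and $H(K_{A,\Phi})$ denotes its RKHS. Expansions $f=\sum_{n=1}^\infty f_n\phi_n$ have real coefficients and converge pointwise on $T$. Law of $X$. Let $\tilde{\mathcal{B}}$ be the $\sigma$-algebra on $\mathbb{R}^T$ generated by the cylinder sets $\{f\in\mathbb{R}^T:(f(t_1),\dots,f(t_n))\in B\}$, $n\in\mathbb{N}$, $t_1,\dots,t_n\in T$, $B\subset\mathbb{R}^n$ Borel; let $\tilde\mu_X$ be the law of $X$ on $(\mathbb{R}^T,\tilde{\mathcal{B}})$ and $(\mathbb{R}^T,\tilde{\mathcal{B}}_0,\tilde\mu_{X,0})$ its completion. By continuity of paths $C(T)$ has outer measure one. Set $\mathcal{B}=\{C(T)\cap H:H\in\tilde{\mathcal{B}}_0\}$ and $\mu_X(C(T)\cap H)=\tilde\mu_{X,0}(H)$ for $H\in\tilde{\mathcal{B}}_0$.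 It is known that the RKHS of any continuous positive-semidefinite kernel on $T\times T$ belongs to $\mathcal{B}$. Sample support set. For a collection $\mathfrak{R}$ of continuous kernels on $T$, let $\mathcal{S}(\mathfrak{R})$ be the $\sigma$-algebra on $C(T)$ generated by $\{H(R):R\in\mathfrak{R}\}$. The sample support set $S_{\mathfrak{R}}(K)$ of $X$ with respect to $\mathfrak{R}$ is the largest subset of $C(T)$ such that $S_{\mathfrak{R}}(K)\subset H$ for every $H\in\mathcal{S}(\mathfrak{R})$ with $\mu_X(H)=1$.
   Formalization: Added assumption: for every A in Σ_Φ the functions √α_n φ_n form an orthonormal basis of H(K_{A,Φ}); without it the coefficients f_n need not be determined by f and the support set can be empty (e.g. X(i)=ζ_i−ζ_{i+1} with ζ_i iid N(0,1), on discrete T={1,2,…}). *)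

theory Defs
  imports "HOL-Probability.Probability"
begin

type_synonym 't kernel = "'t \<Rightarrow> 't \<Rightarrow> real"

definition pos_semidef_kernel :: "'t kernel \<Rightarrow> bool" where
  "pos_semidef_kernel K \<longleftrightarrow>
     (\<forall>N\<ge>1. \<forall>(a :: nat \<Rightarrow> real) (t :: nat \<Rightarrow> 't).
        (\<Sum>i<N. \<Sum>j<N. a i * a j * K (t i) (t j)) \<ge> 0)"

definition continuous_kernel :: "'t::topological_space kernel \<Rightarrow> bool" where
  "continuous_kernel K \<longleftrightarrow> continuous_on UNIV (\<lambda>(t, t'). K t t')"

definition continuous_functions :: "('t::topological_space \<Rightarrow> real) set" where
  "continuous_functions = {f. continuous_on UNIV f}"


section \<open>Reproducing kernel Hilbert spaces\<close>

text \<open>The inner product is a total function on pairs of functions, but only its values on \<open>H\<close>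
  are constrained.\<close>

definition ip_norm :: "(('t \<Rightarrow> real) \<Rightarrow> ('t \<Rightarrow> real) \<Rightarrow> real) \<Rightarrow> ('t \<Rightarrow> real) \<Rightarrow> real" where
  "ip_norm ip f = sqrt (ip f f)"

definition function_hilbert_space ::
    "('t \<Rightarrow> real) set \<Rightarrow> (('t \<Rightarrow> real) \<Rightarrow> ('t \<Rightarrow> real) \<Rightarrow> real) \<Rightarrow> bool" where
  "function_hilbert_space H ip \<longleftrightarrow>
     (\<lambda>_. 0) \<in> H \<and>
     (\<forall>f\<in>H. \<forall>g\<in>H. \<forall>a b. (\<lambda>t. a * f t + b * g t) \<in> H) \<and>
     (\<forall>f\<in>H. \<forall>g\<in>H. ip f g = ip g f) \<and>
     (\<forall>f\<in>H. \<forall>g\<in>H. \<forall>h\<in>H. \<forall>a b. ip (\<lambda>t. a * f t + b * g t) h = a * ip f h + b * ip g h) \<and>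
     (\<forall>f\<in>H. ip f f \<ge> 0 \<and> (ip f f = 0 \<longrightarrow> f = (\<lambda>_. 0))) \<and>
     (\<forall>u :: nat \<Rightarrow> 't \<Rightarrow> real.
        (\<forall>n. u n \<in> H) \<longrightarrow>
        (\<forall>e>0. \<exists>N. \<forall>m\<ge>N. \<forall>n\<ge>N. ip_norm ip (\<lambda>t. u m t - u n t) < e) \<longrightarrow>
        (\<exists>f\<in>H. (\<lambda>n. ip_norm ip (\<lambda>t. u n t - f t)) \<longlonglongrightarrow> 0))"

definition is_rkhs ::
    "'t kernel \<Rightarrow> ('t \<Rightarrow> real) set \<Rightarrow> (('t \<Rightarrow> real) \<Rightarrow> ('t \<Rightarrow> real) \<Rightarrow> real) \<Rightarrow> bool" where
  "is_rkhs K H ip \<longleftrightarrow>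
     function_hilbert_space H ip \<and>
     (\<forall>t. (\<lambda>s. K s t) \<in> H) \<and>
     (\<forall>f\<in>H. \<forall>t. ip f (\<lambda>s. K s t) = f t)"

text \<open>For a symmetric positive-semidefinite kernel the Moore--Aronszajn theorem gives existence
  and uniqueness of the space, and uniqueness of the inner product on that space; the choice in
  \<open>rkhs_ip\<close> therefore only concerns irrelevant values outside the space.\<close>

definition rkhs :: "'t kernel \<Rightarrow> ('t \<Rightarrow> real) set" where
  "rkhs K = (THE H. \<exists>ip. is_rkhs K H ip)"

definition rkhs_ip :: "'t kernel \<Rightarrow> ('t \<Rightarrow> real) \<Rightarrow> ('t \<Rightarrow> real) \<Rightarrow> real" where
  "rkhs_ip K = (SOME ip. is_rkhs K (rkhs K) ip)"

definition rkhs_norm :: "'t kernel \<Rightarrow> ('t \<Rightarrow> real) \<Rightarrow> real" where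
  "rkhs_norm K = ip_norm (rkhs_ip K)"

definition infinite_dimensional :: "('t \<Rightarrow> real) set \<Rightarrow> bool" where
  "infinite_dimensional H \<longleftrightarrow>
     (\<nexists>B. finite B \<and> B \<subseteq> H \<and> (\<forall>f\<in>H. \<exists>c. f = (\<lambda>t. \<Sum>b\<in>B. c b * b t)))"

definition rkhs_separable :: "'t kernel \<Rightarrow> bool" where
  "rkhs_separable K \<longleftrightarrow>
     (\<exists>D. countable D \<and> D \<subseteq> rkhs K \<and>
        (\<forall>f\<in>rkhs K. \<forall>e>0. \<exists>g\<in>D. rkhs_norm K (\<lambda>t. f t - g t) < e))"

definition orthonormal_basis :: "'t kernel \<Rightarrow> (nat \<Rightarrow> 't \<Rightarrow> real) \<Rightarrow> bool" where
  "orthonormal_basis K \<phi> \<longleftrightarrow>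
     (\<forall>n. \<phi> n \<in> rkhs K) \<and>
     (\<forall>m n. rkhs_ip K (\<phi> m) (\<phi> n) = (if m = n then 1 else 0)) \<and>
     (\<forall>f\<in>rkhs K.
        (\<lambda>N. rkhs_norm K (\<lambda>t. f t - (\<Sum>n<N. rkhs_ip K f (\<phi> n) * \<phi> n t))) \<longlonglongrightarrow> 0)"

definition kernel_dist :: "'t kernel \<Rightarrow> 't \<Rightarrow> 't \<Rightarrow> real" where
  "kernel_dist K t t' = rkhs_norm K (\<lambda>s. K s t - K s t')"


section \<open>Scalings\<close>

definition is_scaling :: "(nat \<Rightarrow> 't \<Rightarrow> real) \<Rightarrow> (nat \<Rightarrow> real) \<Rightarrow> bool" where
  "is_scaling \<phi> \<alpha> \<longleftrightarrow> (\<forall>n. \<alpha> n > 0) \<and> (\<forall>t. summable (\<lambda>n. \<alpha> n * (\<phi> n t)\<^sup>2))"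

definition scaled_kernel :: "(nat \<Rightarrow> 't \<Rightarrow> real) \<Rightarrow> (nat \<Rightarrow> real) \<Rightarrow> 't kernel" where
  "scaled_kernel \<phi> \<alpha> t t' = (\<Sum>n. \<alpha> n * \<phi> n t * \<phi> n t')"

definition continuous_scalings :: "(nat \<Rightarrow> 't::topological_space \<Rightarrow> real) \<Rightarrow> (nat \<Rightarrow> real) set" where
  "continuous_scalings \<phi> = {\<alpha>. is_scaling \<phi> \<alpha> \<and> continuous_kernel (scaled_kernel \<phi> \<alpha>)}"

text \<open>The functions \<open>\<surd>(\<alpha> n) \<phi> n\<close> always span a dense subspace of the RKHS of the scaled kernel,
  but they need not be orthonormal there: this fails when some non-zero sequence \<open>c\<close> with
  \<open>(\<Sum>n. (c n)\<^sup>2 / \<alpha> n) < \<infinity>\<close> satisfies \<open>(\<Sum>n. c n * \<phi> n t) = 0\<close> for every \<open>t\<close>.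
  Orthonormality for all scalings in \<open>continuous_scalings \<phi>\<close> is what makes the coefficients
  of an expansion \<open>f = (\<Sum>n. f\<^sub>n * \<phi> n)\<close> of a function in a scaled RKHS a function of \<open>f\<close>.\<close>

definition scaled_bases_orthonormal :: "(nat \<Rightarrow> 't::topological_space \<Rightarrow> real) \<Rightarrow> bool" where
  "scaled_bases_orthonormal \<phi> \<longleftrightarrow>
     (\<forall>\<alpha>\<in>continuous_scalings \<phi>.
        orthonormal_basis (scaled_kernel \<phi> \<alpha>) (\<lambda>n t. sqrt (\<alpha> n) * \<phi> n t))"


section \<open>Gaussian processes with continuous paths\<close>

text \<open>Point masses count as (degenerate) normal distributions.\<close>

definition gaussian_rv :: "'w measure \<Rightarrow> ('w \<Rightarrow> real) \<Rightarrow> bool" where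
  "gaussian_rv M Y \<longleftrightarrow> Y \<in> borel_measurable M \<and>
     (\<exists>m. (AE \<omega> in M. Y \<omega> = m) \<or> (\<exists>\<sigma>>0. distributed M lborel Y (normal_density m \<sigma>)))"

text \<open>Joint Gaussianity of the finite-dimensional marginals is expressed by all linear
  combinations being Gaussian.\<close>

definition centred_gaussian_process ::
    "'w measure \<Rightarrow> ('t \<Rightarrow> 'w \<Rightarrow> real) \<Rightarrow> 't kernel \<Rightarrow> bool" where
  "centred_gaussian_process M X K \<longleftrightarrow>
     prob_space M \<and>
     (\<forall>t. X t \<in> borel_measurable M) \<and>
     (\<forall>N (a :: nat \<Rightarrow> real) (t :: nat \<Rightarrow> 't). gaussian_rv M (\<lambda>\<omega>. \<Sum>i<N. a i * X (t i) \<omega>)) \<and>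
     (\<forall>t. (\<integral>\<omega>. X t \<omega> \<partial>M) = 0) \<and>
     (\<forall>t t'. (\<integral>\<omega>. X t \<omega> * X t' \<omega> \<partial>M) = K t t')"

definition continuous_paths :: "'w measure \<Rightarrow> ('t::topological_space \<Rightarrow> 'w \<Rightarrow> real) \<Rightarrow> bool" where
  "continuous_paths M X \<longleftrightarrow> (\<forall>\<omega>\<in>space M. continuous_on UNIV (\<lambda>t. X t \<omega>))"

text \<open>The law on the product \<open>\<sigma>\<close>-algebra, which is the one generated by the cylinder sets.\<close>

definition process_law :: "'w measure \<Rightarrow> ('t \<Rightarrow> 'w \<Rightarrow> real) \<Rightarrow> ('t \<Rightarrow> real) measure" where
  "process_law M X = distr M (Pi\<^sub>M UNIV (\<lambda>_. borel)) (\<lambda>\<omega> t. X t \<omega>)"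

text \<open>The set \<open>C(T)\<close> is in general not measurable for the completed law, so \<open>restrict_space\<close>
  is of no use here. The value of the measure at \<open>C(T) \<inter> H\<close> does not depend on the representing
  set \<open>H\<close> since \<open>C(T)\<close> has outer measure one.\<close>

definition path_law :: "'w measure \<Rightarrow> ('t::topological_space \<Rightarrow> 'w \<Rightarrow> real) \<Rightarrow> ('t \<Rightarrow> real) measure" where
  "path_law M X =
     measure_of continuous_functions
       {continuous_functions \<inter> H | H. H \<in> sets (completion (process_law M X))}
       (\<lambda>B. THE p. \<exists>H\<in>sets (completion (process_law M X)).
              B = continuous_functions \<inter> H \<and> p = emeasure (completion (process_law M X)) H)"


section \<open>Sample support sets\<close>

definition rkhs_sigma_algebra :: "'t::topological_space kernel set \<Rightarrow> ('t \<Rightarrow> real) set set" where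
  "rkhs_sigma_algebra \<RR> = sigma_sets continuous_functions (rkhs ` \<RR>)"

definition sample_support ::
    "'w measure \<Rightarrow> ('t::topological_space \<Rightarrow> 'w \<Rightarrow> real) \<Rightarrow> 't kernel set \<Rightarrow> ('t \<Rightarrow> real) set" where
  "sample_support M X \<RR> =
     (GREATEST S. S \<subseteq> continuous_functions \<and>
        (\<forall>H\<in>rkhs_sigma_algebra \<RR>. emeasure (path_law M X) H = 1 \<longrightarrow> S \<subseteq> H))"

end

theory Submission
  imports Defs
begin

text \<open>On the canonical path space the coefficients \<open>Z\<^sub>n\<close> of \<open>X = (\<Sum>n. Z\<^sub>n \<phi>\<^sub>n)\<close> are square-integrable limits
  of finite combinations of the values \<open>X t\<close>, hence product-measurable, and for a continuous path
  outside a null set \<open>X \<in> H(K\<^bsub>A,\<Phi>\<^esub>)\<close> holds iff \<open>(\<Sum>n. Z\<^sub>n\<^sup>2 / \<alpha>\<^sub>n) < \<infinity>\<close>. The moments of the \<open>Z\<^sub>n\<close> make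
  this almost sure if \<open>(\<Sum>n. 1 / \<alpha>\<^sub>n) < \<infinity>\<close> and almost surely false otherwise. So the functions
  contained in exactly those \<open>H(K\<^bsub>A,\<Phi>\<^esub>)\<close> with \<open>(\<Sum>n. 1 / \<alpha>\<^sub>n) < \<infinity>\<close> form an atom of the generated
  \<open>\<sigma>\<close>-algebra, and this atom is the sample support set. Perturbing one scaling along a sparse
  subsequence shows that its elements are those whose squared coefficients are bounded and
  eventually bounded away from zero.\<close>

section \<open>Inner products on spaces of functions\<close>

text \<open>About the law of the \<open>Z\<^sub>n\<close> only second moments and upper bounds on
  mixed fourth moments are established. Fatou's lemma carries them over from finite combinations of
  the \<open>X t\<close>, and Chebyshev's inequality asks for exactly these.

  Continuity of paths enters twice. For a fixed \<open>t\<close> the expansion of \<open>X t\<close>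
  holds only outside a null set depending on \<open>t\<close>; it is collected over a countable
  dense set and extended to all \<open>t\<close> because both sides are continuous. Moreover
  \<open>C(T)\<close> need not be measurable, so almost sure statements are made on the whole
  product space in the form "if the path is continuous, then ...", and are moved to the path law
  through a conull representing set.

  The perturbed scalings satisfy 1/\<beta> = 1/\<alpha> + a with \<open>a\<close> non-negative and
  otherwise arbitrary. They lie below \<alpha>, hence stay continuous, and membership in the atom
  turns into a multiplier property: \<open>a\<close> is summable exactly when its product with the
  squared coefficients is. This property is equivalent to the two-sided bounds.\<close>

text \<open>Definiteness is left out so that the same calculus covers the finite functionals, on
  which the form given by \<open>K\<close> is only semidefinite.\<close>

locale fun_ip =
  fixes H :: "('x \<Rightarrow> real) set" and ip :: "('x \<Rightarrow> real) \<Rightarrow> ('x \<Rightarrow> real) \<Rightarrow> real"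
  assumes zero_mem: "(\<lambda>_. 0) \<in> H"
    and comb_mem: "\<And>f g a b. f \<in> H \<Longrightarrow> g \<in> H \<Longrightarrow> (\<lambda>t. a * f t + b * g t) \<in> H"
    and ip_sym: "\<And>f g. f \<in> H \<Longrightarrow> g \<in> H \<Longrightarrow> ip f g = ip g f"
    and ip_comb: "\<And>f g h a b. f \<in> H \<Longrightarrow> g \<in> H \<Longrightarrow> h \<in> H \<Longrightarrow>
       ip (\<lambda>t. a * f t + b * g t) h = a * ip f h + b * ip g h"
    and ip_nonneg: "\<And>f. f \<in> H \<Longrightarrow> 0 \<le> ip f f"
begin

lemma ip_comb_right:
  "f \<in> H \<Longrightarrow> g \<in> H \<Longrightarrow> h \<in> H \<Longrightarrow> ip h (\<lambda>t. a * f t + b * g t) = a * ip h f + b * ip h g"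
  using ip_comb[of f g h a b] ip_sym[of f h] ip_sym[of g h] ip_sym[OF _ comb_mem, of h f g a b] by simp

lemma add_mem: "f \<in> H \<Longrightarrow> g \<in> H \<Longrightarrow> (\<lambda>t. f t + g t) \<in> H"
  using comb_mem[of f g 1 1] by simp

lemma diff_mem: "f \<in> H \<Longrightarrow> g \<in> H \<Longrightarrow> (\<lambda>t. f t - g t) \<in> H"
  using comb_mem[of f g 1 "-1"] by simp

lemma scale_mem: "f \<in> H \<Longrightarrow> (\<lambda>t. a * f t) \<in> H"
  using comb_mem[of f f a 0] by simp

lemma ip_diff: "f \<in> H \<Longrightarrow> g \<in> H \<Longrightarrow> h \<in> H \<Longrightarrow> ip (\<lambda>t. f t - g t) h = ip f h - ip g h"
  using ip_comb[of f g h 1 "-1"] by simp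

lemma ip_diff_right: "f \<in> H \<Longrightarrow> g \<in> H \<Longrightarrow> h \<in> H \<Longrightarrow> ip h (\<lambda>t. f t - g t) = ip h f - ip h g"
  using ip_comb_right[of f g h 1 "-1"] by simp

lemma ip_scale: "f \<in> H \<Longrightarrow> h \<in> H \<Longrightarrow> ip (\<lambda>t. a * f t) h = a * ip f h"
  using ip_comb[of f f h a 0] by simp

lemma ip_zero: "h \<in> H \<Longrightarrow> ip (\<lambda>_. 0) h = 0"
  using ip_scale[of h h 0] by simp

lemma sum_mem:
  assumes "\<And>i. i \<in> I \<Longrightarrow> f i \<in> H"
  shows "(\<lambda>t. \<Sum>i\<in>I. a i * f i t) \<in> H"
  using assms
proof (induction I rule: infinite_finite_induct)
  case (insert i I)
  then have "f i \<in> H" "(\<lambda>t. \<Sum>i\<in>I. a i * f i t) \<in> H" by auto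
  from comb_mem[OF this, of "a i" 1] insert show ?case by simp
qed (simp_all add: zero_mem)

lemma ip_sum:
  assumes "\<And>i. i \<in> I \<Longrightarrow> f i \<in> H" "g \<in> H"
  shows "ip (\<lambda>t. \<Sum>i\<in>I. a i * f i t) g = (\<Sum>i\<in>I. a i * ip (f i) g)"
  using assms
proof (induction I rule: infinite_finite_induct)
  case (insert i I)
  have "f i \<in> H" using insert.prems by auto
  moreover have "(\<lambda>t. \<Sum>i\<in>I. a i * f i t) \<in> H" using insert.prems by (intro sum_mem) auto
  ultimately have this: "f i \<in> H" "(\<lambda>t. \<Sum>i\<in>I. a i * f i t) \<in> H" by auto
  from ip_comb[OF this assms(2), of "a i" 1] insert show ?case by simp
qed (simp_all add: ip_zero)

text \<open>The scalar \<open>x\<close> stays free: as a quadratic polynomial in \<open>x\<close>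
  the expansion gives Cauchy-Schwarz, at \<open>x = 1\<close> and \<open>x = -1\<close> it gives
  differences and sums.\<close>

lemma ip_square_diff:
  assumes f: "f \<in> H" and g: "g \<in> H"
  shows "ip (\<lambda>t. f t - x * g t) (\<lambda>t. f t - x * g t) = ip f f - 2 * x * ip f g + x\<^sup>2 * ip g g"
proof -
  let ?h = "\<lambda>t. f t - x * g t"
  have h: "?h \<in> H" using comb_mem[OF f g, of 1 "-x"] by simp
  have l: "ip ?h k = ip f k - x * ip g k" if "k \<in> H" for k
    using ip_comb[OF f g that, of 1 "-x"] by simp
  have r: "ip k ?h = ip k f - x * ip k g" if "k \<in> H" for k
    using ip_comb_right[OF f g that, of 1 "-x"] by simp
  have "ip ?h ?h = (ip f f - x * ip f g) - x * (ip g f - x * ip g g)"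
    by (simp only: l[OF h] r[OF f] r[OF g])
  then show ?thesis using ip_sym[OF f g] by (simp add: algebra_simps power2_eq_square)
qed

lemma cauchy_schwarz_square:
  assumes f: "f \<in> H" and g: "g \<in> H"
  shows "(ip f g)\<^sup>2 \<le> ip f f * ip g g"
proof -
  have q: "0 \<le> ip f f - 2 * x * ip f g + x\<^sup>2 * ip g g" for x
    using ip_nonneg[of "\<lambda>t. f t - x * g t"] ip_square_diff[OF f g, of x] comb_mem[OF f g, of 1 "-x"] by simp
  show ?thesis
  proof (cases "ip g g = 0")
    case True
    have "ip f g = 0"
    proof (rule ccontr)
      assume nz: "ip f g \<noteq> 0"
      \<comment> \<open>A vector of norm zero need not vanish here. The polynomial is then affine in
        \<open>x\<close>, and this \<open>x\<close> gives it the value -1.\<close>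
      from q[of "(ip f f + 1) / (2 * ip f g)"] True nz show False by (simp add: field_simps)
    qed
    then show ?thesis using ip_nonneg f g by simp
  next
    case False
    then have "ip g g > 0" using ip_nonneg[OF g] by simp
    \<comment> \<open>This is the minimiser of the quadratic polynomial.\<close>
    then show ?thesis using q[of "ip f g / ip g g"]
      by (simp add: field_simps power2_eq_square)
  qed
qed

lemma cauchy_schwarz:
  assumes "f \<in> H" "g \<in> H"
  shows "\<bar>ip f g\<bar> \<le> ip_norm ip f * ip_norm ip g"
  using real_sqrt_le_mono[OF cauchy_schwarz_square[OF assms]]
  by (simp add: ip_norm_def real_sqrt_mult)

lemma norm_nonneg: "f \<in> H \<Longrightarrow> 0 \<le> ip_norm ip f"
  using ip_nonneg by (simp add: ip_norm_def)

lemma norm_square: "f \<in> H \<Longrightarrow> (ip_norm ip f)\<^sup>2 = ip f f"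
  using ip_nonneg by (simp add: ip_norm_def)

lemma norm_triangle_add:
  assumes "f \<in> H" "g \<in> H"
  shows "ip_norm ip (\<lambda>t. f t + g t) \<le> ip_norm ip f + ip_norm ip g"
proof (rule power2_le_imp_le)
  have "(ip_norm ip (\<lambda>t. f t + g t))\<^sup>2 = ip f f + 2 * ip f g + ip g g"
    using ip_square_diff[OF assms, of "-1"] norm_square[OF add_mem[OF assms]] by simp
  also have "\<dots> \<le> (ip_norm ip f + ip_norm ip g)\<^sup>2"
    using cauchy_schwarz[OF assms] norm_square assms by (simp add: power2_sum)
  finally show "(ip_norm ip (\<lambda>t. f t + g t))\<^sup>2 \<le> (ip_norm ip f + ip_norm ip g)\<^sup>2" .
qed (simp add: norm_nonneg assms)

lemma norm_diff_commute:
  assumes "f \<in> H" "g \<in> H"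
  shows "ip_norm ip (\<lambda>t. f t - g t) = ip_norm ip (\<lambda>t. g t - f t)"
  using ip_square_diff[OF assms, of 1] ip_square_diff[OF assms(2,1), of 1] ip_sym[OF assms]
  by (simp add: ip_norm_def)

lemma norm_triangle:
  assumes "f \<in> H" "g \<in> H" "h \<in> H"
  shows "ip_norm ip (\<lambda>t. f t - h t) \<le> ip_norm ip (\<lambda>t. f t - g t) + ip_norm ip (\<lambda>t. g t - h t)"
  using norm_triangle_add[OF diff_mem diff_mem, of f g g h] assms by simp

lemma norm_reverse_triangle:
  assumes "f \<in> H" "g \<in> H"
  shows "\<bar>ip_norm ip f - ip_norm ip g\<bar> \<le> ip_norm ip (\<lambda>t. f t - g t)"
  using norm_triangle[OF assms(1,2) zero_mem] norm_triangle[OF assms(2,1) zero_mem]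
    norm_diff_commute[OF assms] by simp

definition cauchy_in :: "(nat \<Rightarrow> 'x \<Rightarrow> real) \<Rightarrow> bool" where
  "cauchy_in u \<longleftrightarrow> (\<forall>n. u n \<in> H) \<and>
     (\<forall>e>0. \<exists>N. \<forall>m\<ge>N. \<forall>n\<ge>N. ip_norm ip (\<lambda>t. u m t - u n t) < e)"

lemma cauchy_inD: "cauchy_in u \<Longrightarrow> u n \<in> H"
  by (simp add: cauchy_in_def)

lemma cauchy_in_bound:
  assumes "cauchy_in u" "0 < e"
  obtains N where "\<And>m n. m \<ge> N \<Longrightarrow> n \<ge> N \<Longrightarrow> ip_norm ip (\<lambda>t. u m t - u n t) < e"
  using assms unfolding cauchy_in_def by blast

lemma cauchy_in_const: "f \<in> H \<Longrightarrow> cauchy_in (\<lambda>_. f)"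
  using ip_zero[OF zero_mem] by (simp add: cauchy_in_def ip_norm_def)

lemma norm_scale:
  assumes "f \<in> H"
  shows "ip_norm ip (\<lambda>t. a * f t) = \<bar>a\<bar> * ip_norm ip f"
proof -
  have "ip (\<lambda>t. a * f t) (\<lambda>t. a * f t) = a * ip f (\<lambda>t. a * f t)"
    by (rule ip_scale[OF assms scale_mem[OF assms]])
  also have "ip f (\<lambda>t. a * f t) = a * ip f f"
    using ip_sym[OF assms scale_mem[OF assms]] ip_scale[OF assms assms] by simp
  finally have "ip (\<lambda>t. a * f t) (\<lambda>t. a * f t) = a\<^sup>2 * ip f f" by (simp add: power2_eq_square)
  then show ?thesis unfolding ip_norm_def by (simp only: real_sqrt_mult real_sqrt_abs)
qed

lemma cauchy_in_norm: 
  assumes "cauchy_in u"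
  shows "convergent (\<lambda>n. ip_norm ip (u n))"
proof -
  have "Cauchy (\<lambda>n. ip_norm ip (u n))"
  proof (rule metric_CauchyI)
    fix e :: real assume "e > 0"
    then obtain N where N: "\<And>m n. m \<ge> N \<Longrightarrow> n \<ge> N \<Longrightarrow> ip_norm ip (\<lambda>t. u m t - u n t) < e"
      using cauchy_in_bound[OF assms] by blast
    show "\<exists>N. \<forall>m\<ge>N. \<forall>n\<ge>N. dist (ip_norm ip (u m)) (ip_norm ip (u n)) < e"
    proof (intro exI allI impI)
      fix m n assume "m \<ge> N" "n \<ge> N"
      from N[OF this] norm_reverse_triangle[of "u m" "u n"] cauchy_inD[OF assms]
      show "dist (ip_norm ip (u m)) (ip_norm ip (u n)) < e" by (simp add: dist_real_def)
    qed
  qed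
  then show ?thesis by (simp add: Cauchy_convergent)
qed

lemma cauchy_in_add:
  assumes u: "cauchy_in u" and v: "cauchy_in v"
  shows "cauchy_in (\<lambda>n t. a * u n t + b * v n t)"
  unfolding cauchy_in_def
proof (intro conjI allI impI)
  show "(\<lambda>t. a * u n t + b * v n t) \<in> H" for n using comb_mem cauchy_inD u v by auto
  fix e :: real assume "e > 0"
  \<comment> \<open>The summand 1 keeps the denominator positive for \<open>a = b = 0\<close> and
    makes the final estimate strict.\<close>
  define d where "d = e / (\<bar>a\<bar> + \<bar>b\<bar> + 1)"
  have "d > 0" using \<open>e > 0\<close> by (simp add: d_def)
  obtain N where N: "\<And>m n. m \<ge> N \<Longrightarrow> n \<ge> N \<Longrightarrow> ip_norm ip (\<lambda>t. u m t - u n t) < d"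
    using cauchy_in_bound[OF u \<open>d > 0\<close>] by blast
  obtain N' where N': "\<And>m n. m \<ge> N' \<Longrightarrow> n \<ge> N' \<Longrightarrow> ip_norm ip (\<lambda>t. v m t - v n t) < d"
    using cauchy_in_bound[OF v \<open>d > 0\<close>] by blast
  show "\<exists>N. \<forall>m\<ge>N. \<forall>n\<ge>N. ip_norm ip (\<lambda>t. (a * u m t + b * v m t) - (a * u n t + b * v n t)) < e"
  proof (intro exI allI impI)
    fix m n assume mn: "max N N' \<le> m" "max N N' \<le> n"
    have mem: "(\<lambda>t. u m t - u n t) \<in> H" "(\<lambda>t. v m t - v n t) \<in> H"
      using diff_mem cauchy_inD u v by auto
    have "ip_norm ip (\<lambda>t. (a * u m t + b * v m t) - (a * u n t + b * v n t))
        = ip_norm ip (\<lambda>t. a * (u m t - u n t) + b * (v m t - v n t))" by (simp add: algebra_simps)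
    also have "\<dots> \<le> \<bar>a\<bar> * ip_norm ip (\<lambda>t. u m t - u n t) + \<bar>b\<bar> * ip_norm ip (\<lambda>t. v m t - v n t)"
      using norm_triangle_add[OF scale_mem[OF mem(1), of a] scale_mem[OF mem(2), of b]] norm_scale mem by simp
    also have "\<dots> \<le> \<bar>a\<bar> * d + \<bar>b\<bar> * d"
      using N[of m n] N'[of m n] mn by (intro add_mono mult_left_mono) auto
    also have "\<dots> = (\<bar>a\<bar> + \<bar>b\<bar>) * d" by (simp add: distrib_right)
    also have "\<dots> < (\<bar>a\<bar> + \<bar>b\<bar> + 1) * d" using \<open>d > 0\<close> by simp
    also have "\<dots> = e" by (simp add: d_def)
    finally show "ip_norm ip (\<lambda>t. (a * u m t + b * v m t) - (a * u n t + b * v n t)) < e" .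
  qed
qed

lemma cauchy_in_diff:
  "cauchy_in u \<Longrightarrow> cauchy_in v \<Longrightarrow> cauchy_in (\<lambda>n t. u n t - v n t)"
  using cauchy_in_add[of u v 1 "-1"] by simp

lemma polarization:
  assumes "f \<in> H" "g \<in> H"
  shows "ip f g = ((ip_norm ip (\<lambda>t. f t + g t))\<^sup>2 - (ip_norm ip (\<lambda>t. f t - g t))\<^sup>2) / 4"
  using ip_square_diff[OF assms, of "-1"] ip_square_diff[OF assms, of 1]
    norm_square[OF add_mem[OF assms]] norm_square[OF diff_mem[OF assms]] by simp

text \<open>Polarisation reduces the convergence of inner products to that of norms, which follows
  from the reverse triangle inequality.\<close>

lemma cauchy_in_ip:
  assumes u: "cauchy_in u" and v: "cauchy_in v"
  shows "convergent (\<lambda>n. ip (u n) (v n))"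
proof -
  obtain x where x: "(\<lambda>n. ip_norm ip (\<lambda>t. u n t + v n t)) \<longlonglongrightarrow> x"
    using cauchy_in_norm[OF cauchy_in_add[OF u v, of 1 1]] by (auto simp: convergent_def)
  obtain y where y: "(\<lambda>n. ip_norm ip (\<lambda>t. u n t - v n t)) \<longlonglongrightarrow> y"
    using cauchy_in_norm[OF cauchy_in_add[OF u v, of 1 "-1"]] by (auto simp: convergent_def)
  have "(\<lambda>n. ip (u n) (v n)) = (\<lambda>n. ((ip_norm ip (\<lambda>t. u n t + v n t))\<^sup>2 - (ip_norm ip (\<lambda>t. u n t - v n t))\<^sup>2) / 4)"
    using polarization cauchy_inD u v by auto
  moreover have "\<dots> \<longlonglongrightarrow> (x\<^sup>2 - y\<^sup>2) / 4"
    by (intro tendsto_divide tendsto_diff tendsto_power x y tendsto_const) simp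
  ultimately show ?thesis by (auto simp: convergent_def)
qed

lemma ip_tendsto_zero:
  assumes u: "\<And>n. u n \<in> H" and v: "cauchy_in v" and z: "(\<lambda>n. ip_norm ip (u n)) \<longlonglongrightarrow> 0"
  shows "(\<lambda>n. ip (u n) (v n)) \<longlonglongrightarrow> 0"
proof -
  obtain y where y: "(\<lambda>n. ip_norm ip (v n)) \<longlonglongrightarrow> y"
    using cauchy_in_norm[OF v] by (auto simp: convergent_def)
  have "(\<lambda>n. ip_norm ip (u n) * ip_norm ip (v n)) \<longlonglongrightarrow> 0"
    using tendsto_mult[OF z y] by simp
  then show ?thesis
    by (rule Lim_null_comparison[rotated]) (use cauchy_schwarz u cauchy_inD[OF v] in \<open>auto intro!: always_eventually\<close>)
qed

lemma cauchy_in_if_tendsto: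
  assumes u: "\<And>n. u n \<in> H" and f: "f \<in> H" and l: "(\<lambda>n. ip_norm ip (\<lambda>t. u n t - f t)) \<longlonglongrightarrow> 0"
  shows "cauchy_in u"
  unfolding cauchy_in_def
proof (intro conjI allI impI)
  fix e :: real assume "e > 0"
  then have "\<forall>\<^sub>F n in sequentially. ip_norm ip (\<lambda>t. u n t - f t) < e / 2"
    using l by (intro order_tendstoD(2)[OF l]) simp
  then obtain N where N: "\<And>n. n \<ge> N \<Longrightarrow> ip_norm ip (\<lambda>t. u n t - f t) < e / 2"
    by (auto simp: eventually_sequentially)
  show "\<exists>N. \<forall>m\<ge>N. \<forall>n\<ge>N. ip_norm ip (\<lambda>t. u m t - u n t) < e"
  proof (intro exI allI impI)
    fix m n assume "N \<le> m" "N \<le> n"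
    with N[of m] N[of n] norm_triangle[OF u f u, of m n] norm_diff_commute[OF u f, of n]
    show "ip_norm ip (\<lambda>t. u m t - u n t) < e" by simp
  qed
qed (use u in auto)

end

lemma function_hilbert_space_fun_ip:
  assumes "function_hilbert_space H ip"
  shows "fun_ip H ip"
  using assms unfolding function_hilbert_space_def by unfold_locales blast+

lemma function_hilbert_space_complete:
  assumes "function_hilbert_space H ip" "fun_ip.cauchy_in H ip u"
  shows "\<exists>f\<in>H. (\<lambda>n. ip_norm ip (\<lambda>t. u n t - f t)) \<longlonglongrightarrow> 0"
  using assms unfolding function_hilbert_space_def fun_ip.cauchy_in_def[OF function_hilbert_space_fun_ip[OF assms(1)]]
  by blast

section \<open>Finite combinations of point evaluations\<close>

text \<open>A functional acts on every function, so one and the same \<open>L\<close> yields a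
  kernel combination through \<open>K s\<close> and a random variable through a path.\<close>

definition finite_functionals :: "(('t \<Rightarrow> real) \<Rightarrow> real) set" where
  "finite_functionals = {L. \<exists>(N::nat) a t. L = (\<lambda>F. \<Sum>i<N. a i * F (t i))}"

text \<open>For coefficients \<open>a i\<close>, \<open>a' j\<close> at points \<open>t i\<close>,
  \<open>t' j\<close> this is the double sum of \<open>a i * a' j * K (t i) (t' j)\<close>, the
  covariance of the two associated Gaussian variables.\<close>

definition functional_ip ::
    "'t kernel \<Rightarrow> (('t \<Rightarrow> real) \<Rightarrow> real) \<Rightarrow> (('t \<Rightarrow> real) \<Rightarrow> real) \<Rightarrow> real" where
  "functional_ip K L L' = L (\<lambda>s. L' (K s))"

lemma finite_functional_zero: "(\<lambda>_. 0) \<in> finite_functionals"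
  unfolding finite_functionals_def by (auto intro!: exI[of _ "0::nat"])

lemma finite_functional_eval: "(\<lambda>F. F t) \<in> finite_functionals"
  unfolding finite_functionals_def by (auto intro!: exI[of _ "1::nat"] exI[of _ "\<lambda>_. 1"] exI[of _ "\<lambda>_. t"])

lemma sum_lessThan_add: "(\<Sum>i<m + n. f i) = (\<Sum>i<m. f i) + (\<Sum>i<n. f (m + i :: nat))"
  for f :: "nat \<Rightarrow> real"
  by (induction n) (simp_all add: add.assoc)

lemma finite_functional_comb:
  assumes "L \<in> finite_functionals" "L' \<in> finite_functionals"
  shows "(\<lambda>F. x * L F + y * L' F) \<in> finite_functionals"
proof -
  obtain N a t where L: "L = (\<lambda>F. \<Sum>i<N::nat. a i * F (t i))"
    using assms by (auto simp: finite_functionals_def)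
  obtain N' a' t' where L': "L' = (\<lambda>F. \<Sum>i<N'::nat. a' i * F (t' i))"
    using assms by (auto simp: finite_functionals_def)
  have "(\<lambda>F. x * L F + y * L' F) = (\<lambda>F. \<Sum>i<N+N'.
     (if i < N then x * a i else y * a' (i - N)) * F (if i < N then t i else t' (i - N)))"
    by (simp add: sum_lessThan_add L L' sum_distrib_left mult.assoc)
  then show ?thesis unfolding finite_functionals_def mem_Collect_eq
    by (intro exI) assumption
qed

lemma finite_functional_linear:
  assumes "L \<in> finite_functionals"
  shows "L (\<lambda>t. x * F t + y * G t) = x * L F + y * L G"
  using assms unfolding finite_functionals_def
  by (auto simp: sum.distrib sum_distrib_left algebra_simps)

lemma finite_functional_tendsto:
  assumes "L \<in> finite_functionals" "\<And>t. (\<lambda>n. F n t) \<longlonglongrightarrow> G t"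
  shows "(\<lambda>n. L (F n)) \<longlonglongrightarrow> L G"
  using assms unfolding finite_functionals_def by (auto intro!: tendsto_intros)

lemma fun_ip_functionals:
  assumes sym: "\<And>s t. K s t = K t s" and psd: "pos_semidef_kernel K"
  shows "fun_ip finite_functionals (functional_ip K)"
proof
  fix L L' L'' :: "('a \<Rightarrow> real) \<Rightarrow> real" and a b :: real
  assume L: "L \<in> finite_functionals"
  obtain N c t where Le: "L = (\<lambda>F. \<Sum>i<N::nat. c i * F (t i))"
    using L by (auto simp: finite_functionals_def)
  show "0 \<le> functional_ip K L L"
  proof (cases "N \<ge> 1")
    case True
    then show ?thesis using psd
      by (simp add: functional_ip_def Le pos_semidef_kernel_def sum_distrib_left mult.assoc)
  qed (simp add: functional_ip_def Le)
  show "functional_ip K L L' = functional_ip K L' L" if "L' \<in> finite_functionals"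
  proof -
    obtain N' c' t' where Le': "L' = (\<lambda>F. \<Sum>i<N'::nat. c' i * F (t' i))"
      using \<open>L' \<in> finite_functionals\<close> by (auto simp: finite_functionals_def)
    show ?thesis
      by (simp add: functional_ip_def Le Le' sum_distrib_left, subst sum.swap)
        (simp add: sym mult.left_commute)
  qed
  show "(\<lambda>F. a * L F + b * L' F) \<in> finite_functionals" if "L' \<in> finite_functionals"
    using finite_functional_comb L that by auto
qed (auto simp: finite_functional_zero functional_ip_def)

lemma is_rkhs_functional:
  assumes R: "is_rkhs K H ip" and L: "L \<in> finite_functionals"
  shows "(\<lambda>s. L (K s)) \<in> H" and "f \<in> H \<Longrightarrow> ip f (\<lambda>s. L (K s)) = L f"
proof -
  interpret fun_ip H ip using R function_hilbert_space_fun_ip by (auto simp: is_rkhs_def)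
  obtain N a t where Le: "L = (\<lambda>F. \<Sum>i<N::nat. a i * F (t i))"
    using L by (auto simp: finite_functionals_def)
  have k: "(\<lambda>s. K s t) \<in> H" for t using R by (auto simp: is_rkhs_def)
  show mem: "(\<lambda>s. L (K s)) \<in> H" unfolding Le using k by (intro sum_mem) auto
  show "ip f (\<lambda>s. L (K s)) = L f" if "f \<in> H"
  proof -
    have "ip f (\<lambda>s. L (K s)) = ip (\<lambda>s. L (K s)) f" using ip_sym mem that by auto
    also have "\<dots> = (\<Sum>i<N. a i * ip (\<lambda>s. K s (t i)) f)" unfolding Le
      using k that by (intro ip_sum) auto
    also have "\<dots> = L f" using R that ip_sym[OF k that] by (simp add: Le is_rkhs_def)
    finally show ?thesis .
  qed
qed

lemma is_rkhs_eval_bound: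
  assumes R: "is_rkhs K H ip" and f: "f \<in> H"
  shows "\<bar>f t\<bar> \<le> ip_norm ip f * sqrt (K t t)"
proof -
  interpret fun_ip H ip using R function_hilbert_space_fun_ip by (auto simp: is_rkhs_def)
  have k: "(\<lambda>s. K s t) \<in> H" for t using R by (auto simp: is_rkhs_def)
  have "ip_norm ip (\<lambda>s. K s t) = sqrt (K t t)" using R k by (simp add: ip_norm_def is_rkhs_def)
  moreover have "ip f (\<lambda>s. K s t) = f t" using R f by (simp add: is_rkhs_def)
  ultimately show ?thesis using cauchy_schwarz[OF f k, of t] by simp
qed

lemma is_rkhs_tendsto_pointwise:
  assumes R: "is_rkhs K H ip" and "\<And>n. u n \<in> H" "f \<in> H" "(\<lambda>n. ip_norm ip (\<lambda>t. u n t - f t)) \<longlonglongrightarrow> 0"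
  shows "(\<lambda>n. u n t) \<longlonglongrightarrow> f t"
proof -
  interpret fun_ip H ip using R function_hilbert_space_fun_ip by (auto simp: is_rkhs_def)
  have "(\<lambda>n. u n t - f t) \<longlonglongrightarrow> 0"
    by (rule Lim_null_comparison[of _ "\<lambda>n. ip_norm ip (\<lambda>t. u n t - f t) * sqrt (K t t)"])
      (use is_rkhs_eval_bound[OF R diff_mem] assms in \<open>auto intro!: always_eventually tendsto_mult_left_zero\<close>)
  then show ?thesis by (simp add: LIM_zero_iff)
qed

section \<open>Existence and uniqueness of the RKHS\<close>

lemma (in fun_ip) norm_tendsto:
  assumes "\<And>n. u n \<in> H" "f \<in> H" "(\<lambda>n. ip_norm ip (\<lambda>t. u n t - f t)) \<longlonglongrightarrow> 0"
  shows "(\<lambda>n. ip_norm ip (u n)) \<longlonglongrightarrow> ip_norm ip f"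
proof -
  have "(\<lambda>n. ip_norm ip (u n) - ip_norm ip f) \<longlonglongrightarrow> 0"
    by (rule Lim_null_comparison[OF _ assms(3)])
      (use norm_reverse_triangle assms in \<open>auto intro!: always_eventually\<close>)
  then show ?thesis by (simp add: LIM_zero_iff)
qed

text \<open>This makes minimising sequences Cauchy: two points at nearly minimal distance from
  \<open>f\<close> are close to each other if their midpoint is no nearer to \<open>f\<close> than
  the minimum.\<close>

lemma (in fun_ip) parallelogram:
  assumes f: "f \<in> H" and g: "g \<in> H" and h: "h \<in> H"
  shows "(ip_norm ip (\<lambda>t. g t - h t))\<^sup>2 =
    2 * (ip_norm ip (\<lambda>t. g t - f t))\<^sup>2 + 2 * (ip_norm ip (\<lambda>t. h t - f t))\<^sup>2
     - 4 * (ip_norm ip (\<lambda>t. (1/2 * g t + 1/2 * h t) - f t))\<^sup>2"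
proof -
  let ?p = "\<lambda>t. g t - f t" and ?q = "\<lambda>t. h t - f t"
  have p: "?p \<in> H" and q: "?q \<in> H" using diff_mem f g h by auto
  have "(\<lambda>t. (1/2 * g t + 1/2 * h t) - f t) = (\<lambda>t. 1/2 * (?p t + ?q t))" by (auto simp: field_simps)
  then have "ip_norm ip (\<lambda>t. (1/2 * g t + 1/2 * h t) - f t) = \<bar>1/2\<bar> * ip_norm ip (\<lambda>t. ?p t + ?q t)"
    by (simp only: norm_scale[OF add_mem[OF p q]])
  then have "4 * (ip_norm ip (\<lambda>t. (1/2 * g t + 1/2 * h t) - f t))\<^sup>2 = (ip_norm ip (\<lambda>t. ?p t + ?q t))\<^sup>2"
    by (simp only: power_mult_distrib) (simp add: power2_eq_square)
  moreover have "(\<lambda>t. g t - h t) = (\<lambda>t. ?p t - ?q t)" by auto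
  ultimately show ?thesis
    using ip_square_diff[OF p q, of 1] ip_square_diff[OF p q, of "-1"]
      norm_square[OF p] norm_square[OF q] norm_square[OF add_mem[OF p q]] norm_square[OF diff_mem[OF p q]]
    by simp
qed

text \<open>Minimise the distance from \<open>f\<close> to the kernel combinations: the limit of a minimising
  sequence differs from \<open>f\<close> by a function orthogonal to every \<open>K(\<cdot>, t)\<close>, that is, by zero.\<close>

lemma is_rkhs_functionals_dense:
  assumes R: "is_rkhs K H ip" and f: "f \<in> H"
  shows "\<exists>L. (\<forall>n. L n \<in> finite_functionals) \<and>
    (\<lambda>n. ip_norm ip (\<lambda>s. L n (K s) - f s)) \<longlonglongrightarrow> 0"
proof -
  interpret fun_ip H ip using R function_hilbert_space_fun_ip by (auto simp: is_rkhs_def)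
  define D where "D = (\<lambda>L. (ip_norm ip (\<lambda>s. L (K s) - f s))\<^sup>2) ` finite_functionals"
  define d where "d = Inf D"
  have D: "D \<noteq> {}" "bdd_below D"
    using finite_functional_zero by (auto simp: D_def intro: bdd_belowI[of _ 0])
  have d_le: "d \<le> (ip_norm ip (\<lambda>s. L (K s) - f s))\<^sup>2" if "L \<in> finite_functionals" for L
    unfolding d_def by (rule cInf_lower[OF _ D(2)]) (use that in \<open>auto simp: D_def\<close>)
  have "\<exists>L\<in>finite_functionals. (ip_norm ip (\<lambda>s. L (K s) - f s))\<^sup>2 < d + 1 / Suc n" for n
  proof -
    have "Inf D < d + 1 / Suc n" by (simp add: d_def)
    then obtain y where "y \<in> D" "y < d + 1 / Suc n" using cInf_less_iff[OF D] by blast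
    then show ?thesis by (auto simp: D_def)
  qed
  then obtain L where L: "\<And>n. L n \<in> finite_functionals"
    and Ld: "\<And>n. (ip_norm ip (\<lambda>s. L n (K s) - f s))\<^sup>2 < d + 1 / Suc n" by metis
  let ?h = "\<lambda>n s. L n (K s)"
  have h: "?h n \<in> H" for n using is_rkhs_functional(1)[OF R L] .
  have dist: "(ip_norm ip (\<lambda>s. ?h m s - ?h n s))\<^sup>2 \<le> 2 / Suc m + 2 / Suc n" for m n
  proof -
    \<comment> \<open>The midpoint of two kernel combinations is again one, so the infimum bounds
      its distance from below.\<close>
    have "d \<le> (ip_norm ip (\<lambda>s. (1/2 * ?h m s + 1/2 * ?h n s) - f s))\<^sup>2"
      using d_le[OF finite_functional_comb[OF L L, of "1/2" m "1/2" n]] .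
    then show ?thesis using parallelogram[OF f h[of m] h[of n]] Ld[of m] Ld[of n] by simp
  qed
  have C: "cauchy_in ?h" unfolding cauchy_in_def
  proof (intro conjI allI impI h)
    fix e :: real assume "e > 0"
    \<comment> \<open>By \<open>dist\<close>, the squared distance is below \<open>e\<^sup>2\<close>
      once both 2/(m+1) and 2/(n+1) are below half of it.\<close>
    obtain N :: nat where N: "4 / e\<^sup>2 < real N" using reals_Archimedean2 by blast
    show "\<exists>N. \<forall>m\<ge>N. \<forall>n\<ge>N. ip_norm ip (\<lambda>s. ?h m s - ?h n s) < e"
    proof (intro exI allI impI)
      fix m n assume mn: "N \<le> m" "N \<le> n"
      have "4 / e\<^sup>2 < real (Suc k)" if "N \<le> k" for k using that N by (simp add: less_le_trans)
      then have "2 / real (Suc k) < e\<^sup>2 / 2" if "N \<le> k" for k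
        using that \<open>e > 0\<close> by (simp add: field_simps)
      from this[OF mn(1)] this[OF mn(2)] dist[of m n]
      have "(ip_norm ip (\<lambda>s. ?h m s - ?h n s))\<^sup>2 < e\<^sup>2" by simp
      then show "ip_norm ip (\<lambda>s. ?h m s - ?h n s) < e" using \<open>e > 0\<close> by (simp add: power2_less_imp_less)
    qed
  qed
  obtain p where p: "p \<in> H" and lim: "(\<lambda>n. ip_norm ip (\<lambda>s. ?h n s - p s)) \<longlonglongrightarrow> 0"
    using function_hilbert_space_complete[OF _ C] R by (auto simp: is_rkhs_def)
  have "p t = f t" for t
  proof -
    let ?g = "\<lambda>s. p s - f s" and ?k = "\<lambda>s. K s t"
    have k: "?k \<in> H" and g: "?g \<in> H" using R diff_mem p f by (auto simp: is_rkhs_def)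
    \<comment> \<open>Subtracting a multiple of \<open>K(_, t)\<close> stays within the kernel
      combinations, so \<open>d\<close> bounds each approximant and hence the limit. The resulting
      polynomial in \<open>x\<close> is minimal at 0, which forces the inner product with
      \<open>K(_, t)\<close> to vanish.\<close>
    have hx: "d \<le> (ip_norm ip (\<lambda>s. ?g s - x * ?k s))\<^sup>2" for x
    proof (rule LIMSEQ_le_const)
      let ?w = "\<lambda>n s. (?h n s - f s) - x * ?k s"
      have "(\<lambda>s. (?h n s - f s) - x * ?k s) = (\<lambda>s. (1 * L n (K s) + (-x) * K s t) - f s)" for n by auto
      then have "d \<le> (ip_norm ip (?w n))\<^sup>2" for n
        using d_le[OF finite_functional_comb[OF L finite_functional_eval, of 1 n "-x" t]] by simp
      then show "\<exists>N. \<forall>n\<ge>N. d \<le> (ip_norm ip (?w n))\<^sup>2" by auto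
      have "(\<lambda>s. ?w n s - (?g s - x * ?k s)) = (\<lambda>s. ?h n s - p s)" for n by auto
      then have "(\<lambda>n. ip_norm ip (?w n)) \<longlonglongrightarrow> ip_norm ip (\<lambda>s. ?g s - x * ?k s)"
        by (intro norm_tendsto) (use lim in \<open>auto intro!: diff_mem scale_mem h f k p\<close>)
      then show "(\<lambda>n. (ip_norm ip (?w n))\<^sup>2) \<longlonglongrightarrow> (ip_norm ip (\<lambda>s. ?g s - x * ?k s))\<^sup>2"
        by (intro tendsto_power)
    qed
    have "(ip_norm ip ?g)\<^sup>2 \<le> d"
    proof (rule LIMSEQ_le)
      have "(\<lambda>s. (?h n s - f s) - ?g s) = (\<lambda>s. ?h n s - p s)" for n by auto
      then have "(\<lambda>n. ip_norm ip (\<lambda>s. ?h n s - f s)) \<longlonglongrightarrow> ip_norm ip ?g"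
        by (intro norm_tendsto) (use lim in \<open>auto intro!: diff_mem h f p\<close>)
      then show "(\<lambda>n. (ip_norm ip (\<lambda>s. ?h n s - f s))\<^sup>2) \<longlonglongrightarrow> (ip_norm ip ?g)\<^sup>2"
        by (intro tendsto_power)
      show "(\<lambda>n. d + 1 / Suc n) \<longlonglongrightarrow> d"
        using tendsto_add[OF tendsto_const[of d] LIMSEQ_inverse_real_of_nat] by (simp add: inverse_eq_divide)
      show "\<exists>N. \<forall>n\<ge>N. (ip_norm ip (\<lambda>s. ?h n s - f s))\<^sup>2 \<le> d + 1 / Suc n"
        using Ld by (auto intro!: less_imp_le)
    qed
    moreover have "(ip_norm ip (\<lambda>s. ?g s - x * ?k s))\<^sup>2 = (ip_norm ip ?g)\<^sup>2 - 2 * x * ?g t + x\<^sup>2 * K t t" for x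
      using ip_square_diff[OF g k, of x] norm_square[OF diff_mem[OF g scale_mem[OF k]]] norm_square[OF g] g k R
      by (simp add: is_rkhs_def)
    ultimately have le: "2 * x * ?g t \<le> x\<^sup>2 * K t t" for x using hx[of x] by simp
    have kt: "K t t \<ge> 0" using ip_nonneg[OF k] k R by (simp add: is_rkhs_def)
    have "y = 0" if "\<And>x. 2 * x * y \<le> x\<^sup>2 * K t t" for y
    proof (rule ccontr)
      assume nz: "y \<noteq> 0"
      \<comment> \<open>The optimal choice would be \<open>y / K t t\<close>; the summand 1 avoids
        division by zero and still gives a contradiction.\<close>
      have "2 * (y / (K t t + 1)) * y \<le> (y / (K t t + 1))\<^sup>2 * K t t" by (rule that)
      then have "2 * y\<^sup>2 * (K t t + 1) \<le> y\<^sup>2 * K t t"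
        using kt by (simp add: divide_simps power2_eq_square split: if_splits)
      then have "y\<^sup>2 * (K t t + 2) \<le> 0" by (simp add: algebra_simps)
      moreover have "y\<^sup>2 * (K t t + 2) > 0" using nz kt by (intro mult_pos_pos) auto
      ultimately show False by simp
    qed
    from this[OF le] have "?g t = 0" .
    then show ?thesis by simp
  qed
  then have "p = f" by auto
  with lim L show ?thesis by auto
qed

lemma is_rkhs_functional_ip:
  assumes R: "is_rkhs K H ip" and L: "L \<in> finite_functionals" "L' \<in> finite_functionals"
  shows "ip (\<lambda>s. L (K s)) (\<lambda>s. L' (K s)) = functional_ip K L' L"
  using is_rkhs_functional[OF R L(2)] is_rkhs_functional[OF R L(1)] by (simp add: functional_ip_def)

lemma is_rkhs_functional_norm:
  assumes R: "is_rkhs K H ip" and L: "L \<in> finite_functionals"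
  shows "ip_norm ip (\<lambda>s. L (K s)) = ip_norm (functional_ip K) L"
  using is_rkhs_functional_ip[OF R L L] by (simp add: ip_norm_def)

text \<open>The norm of a kernel combination is dictated by \<open>K\<close> alone. A sequence of
  combinations approximating \<open>f\<close> in one space is therefore Cauchy in the other, and
  since norm convergence implies pointwise convergence its limit there is \<open>f\<close>
  again.\<close>

lemma is_rkhs_subset:
  assumes R: "is_rkhs K H ip" and R': "is_rkhs K H' ip'"
  shows "H \<subseteq> H'"
proof
  fix f assume f: "f \<in> H"
  interpret A: fun_ip H ip using R function_hilbert_space_fun_ip by (auto simp: is_rkhs_def)
  interpret B: fun_ip H' ip' using R' function_hilbert_space_fun_ip by (auto simp: is_rkhs_def)
  obtain L where L: "\<And>n. L n \<in> finite_functionals" and lim: "(\<lambda>n. ip_norm ip (\<lambda>s. L n (K s) - f s)) \<longlonglongrightarrow> 0"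
    using is_rkhs_functionals_dense[OF R f] by blast
  have h: "(\<lambda>s. L n (K s)) \<in> H" "(\<lambda>s. L n (K s)) \<in> H'" for n
    using is_rkhs_functional(1)[OF R L] is_rkhs_functional(1)[OF R' L] by auto
  have "A.cauchy_in (\<lambda>n s. L n (K s))" using A.cauchy_in_if_tendsto[OF h(1) f lim] .
  moreover have "ip_norm ip (\<lambda>s. L m (K s) - L n (K s)) = ip_norm ip' (\<lambda>s. L m (K s) - L n (K s))" for m n
    using is_rkhs_functional_norm[OF R finite_functional_comb[OF L L, of 1 m "-1" n]]
      is_rkhs_functional_norm[OF R' finite_functional_comb[OF L L, of 1 m "-1" n]] by simp
  ultimately have "B.cauchy_in (\<lambda>n s. L n (K s))"
    using h by (simp add: A.cauchy_in_def B.cauchy_in_def)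
  then obtain g where g: "g \<in> H'" and lim': "(\<lambda>n. ip_norm ip' (\<lambda>s. L n (K s) - g s)) \<longlonglongrightarrow> 0"
    using function_hilbert_space_complete[of H' ip'] R' unfolding is_rkhs_def by blast
  have "f t = g t" for t
    using is_rkhs_tendsto_pointwise[OF R h(1) f lim, of t] is_rkhs_tendsto_pointwise[OF R' h(2) g lim', of t]
    by (rule LIMSEQ_unique)
  then have "f = g" by auto
  with g show "f \<in> H'" by simp
qed

text \<open>The semidefinite space of functionals is completed concretely: a Cauchy sequence
  \<open>u\<close> of functionals is represented by the function \<open>ev u\<close> of its limits
  at the kernel sections. The crux is \<open>null\<close>, which shows that this function determines
  the sequence up to seminorm zero.\<close>

theorem moore_aronszajn:
  fixes K :: "'t kernel"
  assumes sym: "\<And>s t. K s t = K t s" and psd: "pos_semidef_kernel K"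
  shows "\<exists>H ip. is_rkhs K H ip"
proof -
  interpret V: fun_ip "finite_functionals :: (('t \<Rightarrow> real) \<Rightarrow> real) set" "functional_ip K"
    using fun_ip_functionals[OF sym psd] .
  define B where "B = functional_ip K"
  define ev where "ev u s = lim (\<lambda>n. u n (K s))" for u :: "nat \<Rightarrow> ('t \<Rightarrow> real) \<Rightarrow> real" and s
  define \<delta> where "\<delta> t = (\<lambda>F :: 't \<Rightarrow> real. F t)" for t
  have \<delta>: "\<delta> t \<in> finite_functionals" for t by (simp add: \<delta>_def finite_functional_eval)
  have B\<delta>: "B L (\<delta> t) = L (K t)" if "L \<in> finite_functionals" for L t
  proof -
    have "K t = (\<lambda>s. K s t)" using sym by auto
    then show ?thesis by (simp add: B_def functional_ip_def \<delta>_def)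
  qed
  have ev_lim: "(\<lambda>n. u n (K s)) \<longlonglongrightarrow> ev u s" if u: "V.cauchy_in u" for u s
  proof -
    have "(\<lambda>n. functional_ip K (u n) (\<delta> s)) = (\<lambda>n. u n (K s))"
      using B\<delta> V.cauchy_inD[OF u] unfolding B_def by auto
    then show ?thesis
      using V.cauchy_in_ip[OF u V.cauchy_in_const[OF \<delta>, of s]] by (simp add: convergent_LIMSEQ_iff ev_def)
  qed
  have ev_L: "(\<lambda>n. B (u n) L) \<longlonglongrightarrow> L (ev u)" if u: "V.cauchy_in u" and L: "L \<in> finite_functionals" for u L
  proof -
    have "B (u n) L = L (\<lambda>s. u n (K s))" for n
      using V.ip_sym[OF V.cauchy_inD[OF u] L] by (simp add: B_def functional_ip_def)
    then show ?thesis using finite_functional_tendsto[OF L ev_lim[OF u]] by simp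
  qed
  \<comment> \<open>If the seminorms tended to some positive \<open>x\<close>, the form of a late
    \<open>u n\<close> with a fixed late \<open>u m\<close> would stay away from zero, whereas by
    \<open>ev_L\<close> it tends to \<open>u m (ev u) = 0\<close>. The constant \<open>M\<close>
    exceeds \<open>x\<close> so as to bound the seminorm of \<open>u m\<close>.\<close>
  have null: "(\<lambda>n. ip_norm B (u n)) \<longlonglongrightarrow> 0" if u: "V.cauchy_in u" and z: "\<And>s. ev u s = 0" for u
  proof -
    obtain x where x: "(\<lambda>n. ip_norm B (u n)) \<longlonglongrightarrow> x"
      using V.cauchy_in_norm[OF u] by (auto simp: convergent_def B_def)
    have mem: "u n \<in> finite_functionals" for n using V.cauchy_inD[OF u] .
    have "x = 0"
    proof (rule ccontr)
      assume "x \<noteq> 0"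
      moreover have "x \<ge> 0" using V.norm_nonneg[OF mem]
        by (intro LIMSEQ_le_const[OF x]) (auto simp: B_def)
      ultimately have xp: "x > 0" by simp
      define M where "M = x + 1"
      have "M > 0" using xp by (simp add: M_def)
      obtain N where N: "\<And>m n. m \<ge> N \<Longrightarrow> n \<ge> N \<Longrightarrow> ip_norm B (\<lambda>t. u m t - u n t) < x\<^sup>2 / (4 * M)"
        using V.cauchy_in_bound[OF u, of "x\<^sup>2 / (4 * M)"] xp by (auto simp: B_def M_def)
      have "\<forall>\<^sub>F n in sequentially. n \<ge> N \<and> ip_norm B (u n) < M \<and> x\<^sup>2 / 2 < (ip_norm B (u n))\<^sup>2"
        using order_tendstoD(2)[OF x, of M] order_tendstoD(1)[OF tendsto_power[OF x, of 2], of "x\<^sup>2/2"] xp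
        by (intro eventually_conj eventually_ge_at_top) (auto simp: M_def)
      then obtain m where m: "m \<ge> N" "ip_norm B (u m) < M" "x\<^sup>2 / 2 < (ip_norm B (u m))\<^sup>2"
        by (auto simp: eventually_sequentially)
      \<comment> \<open>The first term is a lower bound for the square of the seminorm of
        \<open>u m\<close>; the second is what replacing one \<open>u m\<close> by
        \<open>u n\<close> can cost, by Cauchy-Schwarz and the choice of \<open>N\<close>.\<close>
      have "x\<^sup>2 / 2 - x\<^sup>2 / 4 \<le> u m (ev u)"
      proof (rule LIMSEQ_le_const[OF ev_L[OF u mem]], intro exI allI impI)
        fix n assume "N \<le> n"
        have "\<bar>B (\<lambda>t. u m t - u n t) (u m)\<bar> \<le> ip_norm B (\<lambda>t. u m t - u n t) * ip_norm B (u m)"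
          using V.cauchy_schwarz[OF V.diff_mem[OF mem mem] mem] by (simp add: B_def)
        also have "\<dots> \<le> x\<^sup>2 / (4 * M) * M"
          using N[OF m(1) \<open>N \<le> n\<close>] m(2) V.norm_nonneg[OF mem, of m] xp 
          by (intro mult_mono) (auto simp: B_def M_def)
        also have "\<dots> = x\<^sup>2 / 4" using \<open>M > 0\<close> by simp
        finally have "\<bar>B (u m) (u m) - B (u n) (u m)\<bar> \<le> x\<^sup>2 / 4"
          using V.ip_diff[OF mem mem mem, of m n m] by (simp add: B_def)
        then show "x\<^sup>2 / 2 - x\<^sup>2 / 4 \<le> B (u n) (u m)"
          using m(3) V.norm_square[OF mem, of m] unfolding B_def by linarith
      qed
      moreover have "u m (ev u) = 0"
      proof -
        have "ev u = (\<lambda>t. 0 * 0 + 0 * 0)" using z by auto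
        then show ?thesis using finite_functional_linear[OF mem, of m 0 "\<lambda>_. 0" 0 "\<lambda>_. 0"] by simp
      qed
      ultimately show False using xp by simp
    qed
    then show ?thesis using x by simp
  qed
  define rep where "rep f = (SOME u. V.cauchy_in u \<and> ev u = f)" for f
  define ip where "ip f g = lim (\<lambda>n. B (rep f n) (rep g n))" for f g
  define H where "H = ev ` {u. V.cauchy_in u}"
  have rep: "V.cauchy_in (rep f) \<and> ev (rep f) = f" if "f \<in> H" for f
  proof -
    have "\<exists>u. V.cauchy_in u \<and> ev u = f" using that by (auto simp: H_def)
    from someI_ex[OF this] show ?thesis unfolding rep_def .
  qed
  have ev_comb: "ev (\<lambda>n F. a * u n F + b * v n F) = (\<lambda>t. a * ev u t + b * ev v t)"
    if "V.cauchy_in u" "V.cauchy_in v" for a b u v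
    by (rule ext, rule LIMSEQ_unique[OF ev_lim[OF V.cauchy_in_add[OF that]]])
      (intro tendsto_intros ev_lim that)
  have ev_diff: "ev (\<lambda>n F. u n F - v n F) = (\<lambda>t. ev u t - ev v t)"
    if "V.cauchy_in u" "V.cauchy_in v" for u v
    using ev_comb[OF that, of 1 "-1"] by simp
  \<comment> \<open>Independence of the representatives chosen by \<open>rep\<close>: sequences with
    the same \<open>ev\<close> differ by a null sequence, and exchanging one argument at a time
    changes the limit by zero.\<close>
  have ip_lim: "(\<lambda>n. B (u n) (v n)) \<longlonglongrightarrow> ip (ev u) (ev v)"
    if u: "V.cauchy_in u" and v: "V.cauchy_in v" for u v
  proof -
    define u' v' where "u' = rep (ev u)" "v' = rep (ev v)"
    have u': "V.cauchy_in u'" "ev u' = ev u" and v': "V.cauchy_in v'" "ev v' = ev v"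
      using rep[of "ev u"] rep[of "ev v"] u v by (auto simp: H_def u'_v'_def)
    have "(\<lambda>n. B (u' n) (v' n)) \<longlonglongrightarrow> ip (ev u) (ev v)"
      using V.cauchy_in_ip[OF u'(1) v'(1)] by (simp add: convergent_LIMSEQ_iff ip_def u'_v'_def B_def)
    moreover have "(\<lambda>n. B (\<lambda>F. u n F - u' n F) (v n)) \<longlonglongrightarrow> 0"
      unfolding B_def using null[OF V.cauchy_in_diff[OF u u'(1)]] u' ev_diff[OF u u'(1)]
      by (intro V.ip_tendsto_zero v V.diff_mem V.cauchy_inD[OF u] V.cauchy_inD[OF u'(1)]) (auto simp: B_def)
    moreover have "(\<lambda>n. B (\<lambda>F. v n F - v' n F) (u' n)) \<longlonglongrightarrow> 0"
      unfolding B_def using null[OF V.cauchy_in_diff[OF v v'(1)]] v' ev_diff[OF v v'(1)]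
      by (intro V.ip_tendsto_zero u'(1) V.diff_mem V.cauchy_inD[OF v] V.cauchy_inD[OF v'(1)]) (auto simp: B_def)
    ultimately have "(\<lambda>n. B (u' n) (v' n) + B (\<lambda>F. u n F - u' n F) (v n) + B (\<lambda>F. v n F - v' n F) (u' n))
       \<longlonglongrightarrow> ip (ev u) (ev v) + 0 + 0" by (intro tendsto_add)
    moreover have "B (u' n) (v' n) + B (\<lambda>F. u n F - u' n F) (v n) + B (\<lambda>F. v n F - v' n F) (u' n) = B (u n) (v n)" for n
    proof -
      have m: "u n \<in> finite_functionals" "v n \<in> finite_functionals" 
          "u' n \<in> finite_functionals" "v' n \<in> finite_functionals"
        using V.cauchy_inD u v u'(1) v'(1) by blast+
      show ?thesis using V.ip_diff[OF m(1,3,2)] V.ip_diff[OF m(2,4,3)] V.ip_sym[OF m(2,3)] V.ip_sym[OF m(3,4)]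
        by (simp add: B_def)
    qed
    ultimately show ?thesis by simp
  qed
  have norm_lim: "(\<lambda>n. ip_norm B (u n)) \<longlonglongrightarrow> ip_norm ip (ev u)" if "V.cauchy_in u" for u
    using tendsto_real_sqrt[OF ip_lim[OF that that]] by (simp add: ip_norm_def)
  have HE: "\<exists>u. V.cauchy_in u \<and> f = ev u" if "f \<in> H" for f using that by (auto simp: H_def)
  have HI: "ev u \<in> H" if "V.cauchy_in u" for u using that by (auto simp: H_def)
  have ev_const: "ev (\<lambda>_. L) = (\<lambda>s. L (K s))" for L by (rule ext) (simp add: ev_def lim_const)
  interpret F: fun_ip H ip
  proof
    show "(\<lambda>_. 0) \<in> H" using HI[OF V.cauchy_in_const[OF V.zero_mem]] by (simp add: ev_const)
    fix f g assume fg: "f \<in> H" "g \<in> H"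
    then obtain u v where uv: "V.cauchy_in u" "f = ev u" "V.cauchy_in v" "g = ev v" using HE by blast
    show "(\<lambda>t. a * f t + b * g t) \<in> H" for a b
      using HI[OF V.cauchy_in_add[OF uv(1,3)]] ev_comb[OF uv(1,3)] uv(2,4) by simp
    have "B (u n) (v n) = B (v n) (u n)" for n unfolding B_def
      using V.ip_sym V.cauchy_inD uv(1,3) by blast
    then show "ip f g = ip g f"
      using ip_lim[OF uv(1,3)] ip_lim[OF uv(3,1)] LIMSEQ_unique uv(2,4) by simp
    show "0 \<le> ip f f" unfolding uv(2)
      by (rule LIMSEQ_le_const[OF ip_lim[OF uv(1,1)]]) (use V.ip_nonneg V.cauchy_inD uv(1) in \<open>auto simp: B_def\<close>)
    fix h a b assume "h \<in> H"
    then obtain w where w: "V.cauchy_in w" "h = ev w" using HE by blast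
    have "B (\<lambda>F. a * u n F + b * v n F) (w n) = a * B (u n) (w n) + b * B (v n) (w n)" for n
      unfolding B_def using V.ip_comb V.cauchy_inD uv(1,3) w(1) by blast
    then have "(\<lambda>n. a * B (u n) (w n) + b * B (v n) (w n)) \<longlonglongrightarrow> ip (\<lambda>t. a * f t + b * g t) h"
      using ip_lim[OF V.cauchy_in_add[OF uv(1,3)] w(1), of a b] ev_comb[OF uv(1,3), of a b] uv(2,4) w(2) by simp
    moreover have "(\<lambda>n. a * B (u n) (w n) + b * B (v n) (w n)) \<longlonglongrightarrow> a * ip f h + b * ip g h"
      unfolding uv(2,4) w(2) by (intro tendsto_intros ip_lim uv w)
    ultimately show "ip (\<lambda>t. a * f t + b * g t) h = a * ip f h + b * ip g h" by (rule LIMSEQ_unique)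
  qed
  have repro: "(\<lambda>s. K s t) \<in> H \<and> (\<forall>f\<in>H. ip f (\<lambda>s. K s t) = f t)" for t
  proof -
    have k: "ev (\<lambda>_. \<delta> t) = (\<lambda>s. K s t)" by (simp add: ev_const \<delta>_def)
    have c: "V.cauchy_in (\<lambda>_. \<delta> t)" using V.cauchy_in_const[OF \<delta>] .
    have "ip (ev u) (ev (\<lambda>_. \<delta> t)) = ev u t" if u: "V.cauchy_in u" for u
    proof (rule LIMSEQ_unique[OF ip_lim[OF u c]])
      show "(\<lambda>n. B (u n) (\<delta> t)) \<longlonglongrightarrow> ev u t"
        using ev_lim[OF u, of t] by (simp only: B\<delta>[OF V.cauchy_inD[OF u]])
    qed
    then have "ip f (\<lambda>s. K s t) = f t" if "f \<in> H" for f using HE[OF that] by (auto simp: k)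
    then show ?thesis using HI[OF c] k by auto
  qed
  have def: "f = (\<lambda>_. 0)" if f: "f \<in> H" "ip f f = 0" for f
  proof
    fix t
    have "(f t)\<^sup>2 \<le> 0" using F.cauchy_schwarz_square[of f "\<lambda>s. K s t"] repro f by simp
    then show "f t = 0" by simp
  qed
  have approx: "\<exists>L\<in>finite_functionals. ip_norm ip (\<lambda>s. L (K s) - f s) < e" if f: "f \<in> H" and "e > 0" for f e
  proof -
    obtain u where u: "V.cauchy_in u" "f = ev u" using HE[OF f] by blast
    obtain N where N: "\<And>m n. m \<ge> N \<Longrightarrow> n \<ge> N \<Longrightarrow> ip_norm B (\<lambda>t. u m t - u n t) < e / 2"
      using V.cauchy_in_bound[OF u(1), of "e/2"] \<open>e > 0\<close> by (auto simp: B_def)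
    have m: "u N \<in> finite_functionals" using V.cauchy_inD[OF u(1)] .
    have c: "V.cauchy_in (\<lambda>n F. u N F - u n F)" using V.cauchy_in_diff[OF V.cauchy_in_const[OF m] u(1)] .
    have "ip_norm ip (ev (\<lambda>n F. u N F - u n F)) \<le> e / 2"
      by (rule LIMSEQ_le_const2[OF norm_lim[OF c]]) (use N in \<open>auto intro!: exI[of _ N] less_imp_le\<close>)
    moreover have "ev (\<lambda>n F. u N F - u n F) = (\<lambda>s. u N (K s) - f s)"
      using ev_diff[OF V.cauchy_in_const[OF m] u(1)] u(2) by (simp add: ev_const)
    ultimately show ?thesis using m \<open>e > 0\<close> by (intro bexI[of _ "u N"]) auto
  qed
  \<comment> \<open>Each \<open>u n\<close> is replaced by a kernel combination within 1/(n+1). The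
    functionals behind these combinations form a Cauchy sequence, because the norms agree, and its
    \<open>ev\<close> is the limit sought.\<close>
  have complete: "\<exists>f\<in>H. (\<lambda>n. ip_norm ip (\<lambda>t. u n t - f t)) \<longlonglongrightarrow> 0" if u: "F.cauchy_in u" for u
  proof -
    have "\<exists>L. L \<in> finite_functionals \<and> ip_norm ip (\<lambda>s. L (K s) - u n s) < inverse (Suc n)" for n
      using approx[OF F.cauchy_inD[OF u], of "inverse (Suc n)"] by auto
    then obtain L where L: "\<And>n. L n \<in> finite_functionals"
      and Lu: "\<And>n. ip_norm ip (\<lambda>s. L n (K s) - u n s) < inverse (Suc n)" by metis
    have h: "(\<lambda>s. L n (K s)) \<in> H" for n
      using HI[OF V.cauchy_in_const[OF L]] by (simp add: ev_const)
    have un: "u n \<in> H" for n using F.cauchy_inD[OF u] .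
    have Lun: "(\<lambda>n. ip_norm ip (\<lambda>s. L n (K s) - u n s)) \<longlonglongrightarrow> 0"
      by (rule Lim_null_comparison[OF _ LIMSEQ_inverse_real_of_nat])
        (use Lu F.norm_nonneg[OF F.diff_mem[OF h un]] in \<open>auto intro!: always_eventually less_imp_le\<close>)
    have nrm: "ip_norm B (\<lambda>F. L m F - L n F) = ip_norm ip (\<lambda>s. L m (K s) - L n (K s))" for m n
      using LIMSEQ_unique[OF tendsto_const norm_lim[OF V.cauchy_in_const[OF V.diff_mem[OF L L]]], of m n]
      by (simp add: ev_const)
    have "F.cauchy_in (\<lambda>n s. L n (K s) - u n s)"
      by (rule F.cauchy_in_if_tendsto[OF F.diff_mem[OF h un] F.zero_mem]) (simp add: Lun)
    from F.cauchy_in_add[OF this u, of 1 1]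
    have LF: "F.cauchy_in (\<lambda>n s. L n (K s))" by simp
    then have LC: "V.cauchy_in L"
      using L unfolding V.cauchy_in_def F.cauchy_in_def
      unfolding B_def[symmetric] nrm by blast
    have f: "ev L \<in> H" using HI[OF LC] .
    have Lf: "(\<lambda>n. ip_norm ip (\<lambda>s. L n (K s) - ev L s)) \<longlonglongrightarrow> 0"
    proof (rule LIMSEQ_I)
      fix e :: real assume "e > 0"
      obtain N where N: "\<And>m n. m \<ge> N \<Longrightarrow> n \<ge> N \<Longrightarrow> ip_norm B (\<lambda>t. L m t - L n t) < e / 2"
        using V.cauchy_in_bound[OF LC, of "e/2"] \<open>e > 0\<close> by (auto simp: B_def)
      show "\<exists>N. \<forall>n\<ge>N. norm (ip_norm ip (\<lambda>s. L n (K s) - ev L s) - 0) < e"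
      proof (intro exI allI impI)
        fix n assume n: "N \<le> n"
        have c: "V.cauchy_in (\<lambda>k F. L n F - L k F)" using V.cauchy_in_diff[OF V.cauchy_in_const[OF L] LC] .
        have "ip_norm ip (ev (\<lambda>k F. L n F - L k F)) \<le> e / 2"
          by (rule LIMSEQ_le_const2[OF norm_lim[OF c]]) (use N n in \<open>auto intro!: exI[of _ N] less_imp_le\<close>)
        moreover have "ev (\<lambda>k F. L n F - L k F) = (\<lambda>s. L n (K s) - ev L s)"
          using ev_diff[OF V.cauchy_in_const[OF L] LC] by (simp add: ev_const)
        ultimately show "norm (ip_norm ip (\<lambda>s. L n (K s) - ev L s) - 0) < e"
          using \<open>e > 0\<close> F.norm_nonneg[OF F.diff_mem[OF h f]] by simp
      qed
    qed
    have "(\<lambda>n. ip_norm ip (\<lambda>t. u n t - ev L t)) \<longlonglongrightarrow> 0"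
    proof (rule Lim_null_comparison[OF _ tendsto_add_zero[OF Lun Lf]], intro always_eventually allI)
      fix n
      show "norm (ip_norm ip (\<lambda>t. u n t - ev L t)) \<le>
          ip_norm ip (\<lambda>s. L n (K s) - u n s) + ip_norm ip (\<lambda>s. L n (K s) - ev L s)"
        using F.norm_triangle[OF un h f] F.norm_diff_commute[OF un h] F.norm_nonneg[OF F.diff_mem[OF un f]] by simp
    qed
    then show ?thesis using f by blast
  qed
  have "function_hilbert_space H ip"
    unfolding function_hilbert_space_def
  proof (intro conjI ballI allI impI)
    show "\<exists>f\<in>H. (\<lambda>n. ip_norm ip (\<lambda>t. u n t - f t)) \<longlonglongrightarrow> 0"
      if "\<forall>n. u n \<in> H" "\<forall>e>0. \<exists>N. \<forall>m\<ge>N. \<forall>n\<ge>N. ip_norm ip (\<lambda>t. u m t - u n t) < e" for u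
      using that by (intro complete) (simp add: F.cauchy_in_def)
  qed (rule F.zero_mem F.comb_mem F.ip_sym F.ip_comb F.ip_nonneg def; assumption)+
  then show ?thesis using repro unfolding is_rkhs_def by blast
qed

lemma rkhs_is_rkhs:
  assumes sym: "\<And>s t. K s t = K t s" and psd: "pos_semidef_kernel K"
  shows "is_rkhs K (rkhs K) (rkhs_ip K)"
proof -
  obtain H ip where R: "is_rkhs K H ip" using moore_aronszajn[OF assms] by blast
  \<comment> \<open>Uniqueness for \<open>THE\<close> is the inclusion \<open>is_rkhs_subset\<close>
    used in both directions.\<close>
  have "rkhs K = H" unfolding rkhs_def
    by (rule the_equality) (use R is_rkhs_subset in blast)+
  then have "\<exists>ip. is_rkhs K (rkhs K) ip" using R by auto
  then show ?thesis unfolding rkhs_ip_def by (rule someI_ex)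
qed

section \<open>Orthonormal expansions and scaled kernels\<close>

context
  fixes K :: "'t kernel" and e :: "nat \<Rightarrow> 't \<Rightarrow> real"
  assumes R: "is_rkhs K (rkhs K) (rkhs_ip K)" and onb: "orthonormal_basis K e"
begin

interpretation fun_ip "rkhs K" "rkhs_ip K"
  using R function_hilbert_space_fun_ip by (auto simp: is_rkhs_def)

lemma basis_mem: "e n \<in> rkhs K"
  using onb by (simp add: orthonormal_basis_def)

lemma basis_orthonormal: "rkhs_ip K (e m) (e n) = (if m = n then 1 else 0)"
  using onb unfolding orthonormal_basis_def by blast

lemma partial_sum_mem: "(\<lambda>t. \<Sum>n<N. c n * e n t) \<in> rkhs K"
  by (intro sum_mem basis_mem)

lemma ip_partial_sum: "rkhs_ip K (\<lambda>t. \<Sum>n\<in>I. c n * e n t) (e m) = (if m \<in> I then c m else 0)" if "finite I"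
  using that by (subst ip_sum[OF basis_mem basis_mem])
    (simp add: basis_orthonormal if_distrib cong: if_cong)

lemma norm_partial_sum: "(rkhs_norm K (\<lambda>t. \<Sum>n\<in>I. c n * e n t))\<^sup>2 = (\<Sum>n\<in>I. (c n)\<^sup>2)" if "finite I"
proof -
  have m: "(\<lambda>t. \<Sum>n\<in>I. c n * e n t) \<in> rkhs K" by (intro sum_mem basis_mem)
  have "rkhs_ip K (e n) (\<lambda>t. \<Sum>n\<in>I. c n * e n t) = c n" if "n \<in> I" for n
    using ip_sym[OF basis_mem m, of n] ip_partial_sum[OF \<open>finite I\<close>, of c n] that by simp
  then show ?thesis
    unfolding rkhs_norm_def norm_square[OF m]
    by (subst ip_sum[OF basis_mem m]) (simp add: power2_eq_square)
qed

lemma rkhs_expansion: "f \<in> rkhs K \<Longrightarrow> (\<lambda>n. rkhs_ip K f (e n) * e n t) sums f t"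
  unfolding sums_def
proof (rule is_rkhs_tendsto_pointwise[OF R partial_sum_mem])
  assume f: "f \<in> rkhs K"
  then show "(\<lambda>N. ip_norm (rkhs_ip K) (\<lambda>t. (\<Sum>n<N. rkhs_ip K f (e n) * e n t) - f t)) \<longlonglongrightarrow> 0"
    using onb norm_diff_commute[OF partial_sum_mem f] by (simp add: orthonormal_basis_def rkhs_norm_def)
qed

text \<open>Bessel's inequality: the squared distance from \<open>f\<close> to a partial sum of its
  expansion is non-negative.\<close>

lemma rkhs_coefficients_summable:
  assumes f: "f \<in> rkhs K"
  shows "summable (\<lambda>n. (rkhs_ip K f (e n))\<^sup>2)"
proof (rule bounded_imp_summable)
  let ?c = "\<lambda>n. rkhs_ip K f (e n)"
  fix N
  let ?p = "\<lambda>t. \<Sum>n\<in>{..N}. ?c n * e n t"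
  have p: "?p \<in> rkhs K" by (intro sum_mem basis_mem)
  have "0 \<le> rkhs_ip K (\<lambda>t. f t - 1 * ?p t) (\<lambda>t. f t - 1 * ?p t)"
    using ip_nonneg[OF diff_mem[OF f p]] by simp
  moreover have "rkhs_ip K f ?p = (\<Sum>n\<in>{..N}. (?c n)\<^sup>2)"
    using ip_sym[OF p f] ip_sum[of "{..N}" e f ?c, OF basis_mem f] ip_sym[OF basis_mem f]
    by (simp add: power2_eq_square)
  ultimately show "(\<Sum>n\<le>N. (?c n)\<^sup>2) \<le> rkhs_ip K f f"
    using ip_square_diff[OF f p, of 1] norm_partial_sum[of "{..N}" ?c] norm_square[OF p]
    by (simp add: rkhs_norm_def)
qed simp

text \<open>Riesz-Fischer: the partial sums are Cauchy in norm, and the assumed pointwise sum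
  identifies their limit. Continuity of the inner product then recovers the coefficients.\<close>

lemma rkhs_synthesis:
  assumes c: "summable (\<lambda>n. (c n)\<^sup>2)" and f: "\<And>t. (\<lambda>n. c n * e n t) sums f t"
  shows "f \<in> rkhs K" "rkhs_ip K f (e m) = c m"
proof -
  let ?p = "\<lambda>N t. \<Sum>n<N. c n * e n t"
  have p: "?p N \<in> rkhs K" for N by (rule partial_sum_mem)
  have "cauchy_in ?p" unfolding cauchy_in_def
  proof (intro conjI allI impI p)
    fix \<epsilon> :: real assume "\<epsilon> > 0"
    then obtain M where M: "\<And>m n. m \<ge> M \<Longrightarrow> norm (\<Sum>k\<in>{m..<n}. (c k)\<^sup>2) < \<epsilon>\<^sup>2"
      using c[unfolded summable_Cauchy, rule_format, of "\<epsilon>\<^sup>2"] by auto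
    have le: "ip_norm (rkhs_ip K) (\<lambda>t. ?p n t - ?p m t) < \<epsilon>" if "M \<le> m" "m \<le> n" for m n
    proof -
      have "(\<lambda>t. ?p n t - ?p m t) = (\<lambda>t. \<Sum>k\<in>{m..<n}. c k * e k t)"
        using that by (auto simp: sum_diff_nat_ivl atLeast0LessThan[symmetric])
      then have "(ip_norm (rkhs_ip K) (\<lambda>t. ?p n t - ?p m t))\<^sup>2 = (\<Sum>k\<in>{m..<n}. (c k)\<^sup>2)"
        using norm_partial_sum[of "{m..<n}" c] by (simp add: rkhs_norm_def)
      also have "\<dots> < \<epsilon>\<^sup>2" using M[OF that(1), of n] by (simp add: abs_less_iff)
      finally show ?thesis using \<open>\<epsilon> > 0\<close> by (simp add: power2_less_imp_less)
    qed
    show "\<exists>N. \<forall>m\<ge>N. \<forall>n\<ge>N. ip_norm (rkhs_ip K) (\<lambda>t. ?p m t - ?p n t) < \<epsilon>"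
    proof (intro exI allI impI)
      fix m n assume mn: "M \<le> m" "M \<le> n"
      show "ip_norm (rkhs_ip K) (\<lambda>t. ?p m t - ?p n t) < \<epsilon>"
        using le[OF mn(1), of n] le[OF mn(2), of m] norm_diff_commute[OF p p, of m n]
        by (cases "m \<le> n") simp_all
    qed
  qed
  then obtain g where g: "g \<in> rkhs K" and l: "(\<lambda>N. ip_norm (rkhs_ip K) (\<lambda>t. ?p N t - g t)) \<longlonglongrightarrow> 0"
    using function_hilbert_space_complete[of "rkhs K" "rkhs_ip K"] R unfolding is_rkhs_def by blast
  have "f t = g t" for t
    using is_rkhs_tendsto_pointwise[OF R p g l, of t] f[of t] LIMSEQ_unique by (auto simp: sums_def)
  then have fg: "f = g" by auto
  then show "f \<in> rkhs K" using g by simp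
  have "(\<lambda>N. rkhs_ip K (\<lambda>t. ?p N t - g t) (e m)) \<longlonglongrightarrow> 0"
    by (rule ip_tendsto_zero[OF diff_mem[OF p g] cauchy_in_const[OF basis_mem] l])
  moreover have "rkhs_ip K (\<lambda>t. ?p N t - g t) (e m) = (if m < N then c m else 0) - rkhs_ip K g (e m)" for N
    by (subst ip_diff[OF p g basis_mem]) (simp add: ip_partial_sum)
  ultimately have "(\<lambda>N. (if m < N then c m else 0) - rkhs_ip K g (e m)) \<longlonglongrightarrow> 0" by simp
  moreover have "(\<lambda>N. (if m < N then c m else 0) - rkhs_ip K g (e m)) \<longlonglongrightarrow> c m - rkhs_ip K g (e m)"
    by (rule tendsto_eventually) (auto simp: eventually_sequentially intro!: exI[of _ "Suc m"])
  ultimately have "c m - rkhs_ip K g (e m) = 0" using LIMSEQ_unique by blast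
  then show "rkhs_ip K f (e m) = c m" using fg by simp
qed

end

section \<open>Continuity in an RKHS and of dominated series\<close>

text \<open>By the reproducing property \<open>f y - f x\<close> is an inner product with the
  difference of two kernel sections, whose norm is expressed by \<open>K\<close> and vanishes as
  \<open>y\<close> tends to \<open>x\<close>.\<close>

lemma is_rkhs_continuous:
  assumes R: "is_rkhs K H ip" and f: "f \<in> H" and c: "continuous_kernel K"
  shows "continuous_on UNIV f"
proof -
  interpret fun_ip H ip using R function_hilbert_space_fun_ip by (auto simp: is_rkhs_def)
  have k: "(\<lambda>s. K s t) \<in> H" for t using R by (auto simp: is_rkhs_def)
  have bound: "\<bar>f y - f x\<bar> \<le> ip_norm ip f * sqrt (K y y - 2 * K x y + K x x)" for x y
  proof -
    have "ip f (\<lambda>s. K s y - K s x) = f y - f x"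
      using ip_diff_right[OF k k f] R f by (simp add: is_rkhs_def)
    moreover have "ip_norm ip (\<lambda>s. K s y - K s x) = sqrt (K y y - 2 * K x y + K x x)"
      using ip_square_diff[OF k k, of y 1 x] R k by (simp add: ip_norm_def is_rkhs_def)
    ultimately show ?thesis using cauchy_schwarz[OF f diff_mem[OF k k], of y x] by simp
  qed
  have K: "continuous_on UNIV (\<lambda>y. K (g y) (h y))"
    if "continuous_on UNIV g" "continuous_on UNIV h" for g h :: "'a \<Rightarrow> 'a"
  proof -
    have "continuous_on UNIV (\<lambda>y. (\<lambda>(t, t'). K t t') (g y, h y))"
      by (rule continuous_on_compose2[OF c[unfolded continuous_kernel_def]])
        (use that in \<open>auto intro: continuous_on_Pair\<close>)
    then show ?thesis by simp
  qed
  show ?thesis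
  unfolding continuous_on_def
proof (intro ballI)
    fix x
    let ?b = "\<lambda>y. ip_norm ip f * sqrt (K y y - 2 * K x y + K x x)"
    have "continuous_on UNIV ?b"
      by (intro continuous_intros K)
    then have "?b \<midarrow>x\<rightarrow> ?b x" unfolding continuous_on_def by blast
    moreover have "?b x = 0" by simp
    ultimately have "?b \<midarrow>x\<rightarrow> 0" by (simp only:)
    then have "(\<lambda>y. f y - f x) \<midarrow>x\<rightarrow> 0"
      by (rule Lim_null_comparison[rotated]) (use bound in \<open>auto intro!: always_eventually\<close>)
    then show "f \<midarrow>x\<rightarrow> f x" by (simp add: LIM_zero_iff)
  qed
qed

text \<open>A local form of Dini's argument: the tails of \<open>a\<close> are bounded by those of
  \<open>b\<close>, and a tail of \<open>b\<close> that is small at \<open>x\<close> is small near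
  \<open>x\<close>, being a continuous function.\<close>

lemma continuous_suminf_dominated:
  fixes a b :: "nat \<Rightarrow> 'a::topological_space \<Rightarrow> real"
  assumes a: "\<And>n. continuous_on UNIV (a n)" and b: "\<And>n. continuous_on UNIV (b n)"
    and ab: "\<And>n x. \<bar>a n x\<bar> \<le> b n x" and s: "\<And>x. summable (\<lambda>n. b n x)"
    and c: "continuous_on UNIV (\<lambda>x. \<Sum>n. b n x)"
  shows "continuous_on UNIV (\<lambda>x. \<Sum>n. a n x)"
unfolding continuous_on_def
proof (intro ballI)
  fix x
  let ?A = "\<lambda>x. \<Sum>n. a n x" and ?B = "\<lambda>x. \<Sum>n. b n x"
  have sa: "summable (\<lambda>n. a n y)" for y by (rule summable_comparison_test[OF _ s]) (use ab in auto)
  have tail: "\<bar>?A y - (\<Sum>n<N. a n y)\<bar> \<le> ?B y - (\<Sum>n<N. b n y)" for y N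
  proof -
    have "\<bar>\<Sum>n. a (n + N) y\<bar> \<le> (\<Sum>n. b (n + N) y)"
      using norm_suminf_le[of "\<lambda>n. a (n + N) y" "\<lambda>n. b (n + N) y"] ab summable_ignore_initial_segment[OF s]
      by simp
    then show ?thesis using suminf_minus_initial_segment[OF s] suminf_minus_initial_segment[OF sa] by simp
  qed
  show "?A \<midarrow>x\<rightarrow> ?A x"
  proof (rule tendstoI)
    fix e :: real assume "e > 0"
    have "(\<lambda>N. ?B x - (\<Sum>n<N. b n x)) \<longlonglongrightarrow> ?B x - ?B x"
      by (intro tendsto_intros summable_LIMSEQ s)
    then have "\<forall>\<^sub>F N in sequentially. ?B x - (\<Sum>n<N. b n x) < e / 3"
      using \<open>e > 0\<close> by (intro order_tendstoD(2)) auto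
    then obtain N where N: "?B x - (\<Sum>n<N. b n x) < e / 3" by (auto simp: eventually_sequentially)
    have "continuous_on UNIV (\<lambda>y. ?B y - (\<Sum>n<N. b n y))" "continuous_on UNIV (\<lambda>y. \<Sum>n<N. a n y)"
      by (intro continuous_intros a b c)+
    then have t: "(\<lambda>y. ?B y - (\<Sum>n<N. b n y)) \<midarrow>x\<rightarrow> ?B x - (\<Sum>n<N. b n x)"
      "(\<lambda>y. \<Sum>n<N. a n y) \<midarrow>x\<rightarrow> (\<Sum>n<N. a n x)" by (simp_all add: continuous_on_def)
    from order_tendstoD(2)[OF t(1) N] tendstoD[OF t(2), of "e/3"] \<open>e > 0\<close>
    have "\<forall>\<^sub>F y in at x. ?B y - (\<Sum>n<N. b n y) < e / 3 \<and> dist (\<Sum>n<N. a n y) (\<Sum>n<N. a n x) < e / 3"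
      by (intro eventually_conj) auto
    then show "\<forall>\<^sub>F y in at x. dist (?A y) (?A x) < e"
    proof eventually_elim
      case (elim y)
      then show ?case using tail[of y N] tail[of x N] N unfolding dist_real_def by linarith
    qed
  qed
qed

section \<open>Scalings and expansions in scaled spaces\<close>

text \<open>Off-diagonal terms are controlled by diagonal ones, of the same scaling when
  \<open>a = a0\<close> and of a larger one otherwise.\<close>

lemma scaled_kernel_term_bound:
  fixes a :: real
  assumes "0 < a" "a \<le> a0"
  shows "\<bar>a * x * y\<bar> \<le> (a0 * x\<^sup>2 + a0 * y\<^sup>2) / 2"
proof -
  have "2 * \<bar>x * y\<bar> \<le> x\<^sup>2 + y\<^sup>2"
    using zero_le_power2[of "\<bar>x\<bar> - \<bar>y\<bar>"] by (simp add: power2_diff abs_mult)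
  then have "a * (2 * \<bar>x * y\<bar>) \<le> a0 * (x\<^sup>2 + y\<^sup>2)" using assms by (intro mult_mono) auto
  then show ?thesis using assms by (simp add: abs_mult algebra_simps)
qed

lemma is_scaling_pos: "is_scaling \<phi> \<alpha> \<Longrightarrow> 0 < \<alpha> n"
  by (simp add: is_scaling_def)

lemma scaled_kernel_summable:
  assumes "is_scaling \<phi> \<alpha>"
  shows "summable (\<lambda>n. \<alpha> n * \<phi> n t * \<phi> n t')"
proof (rule summable_comparison_test)
  show "summable (\<lambda>n. (\<alpha> n * (\<phi> n t)\<^sup>2 + \<alpha> n * (\<phi> n t')\<^sup>2) / 2)"
    using assms by (intro summable_divide summable_add) (auto simp: is_scaling_def)
  show "\<exists>N. \<forall>n\<ge>N. norm (\<alpha> n * \<phi> n t * \<phi> n t') \<le> (\<alpha> n * (\<phi> n t)\<^sup>2 + \<alpha> n * (\<phi> n t')\<^sup>2) / 2"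
    using scaled_kernel_term_bound[OF is_scaling_pos[OF assms] order_refl] by auto
qed

lemma scaled_kernel_sym: "scaled_kernel \<phi> \<alpha> s t = scaled_kernel \<phi> \<alpha> t s"
  by (simp add: scaled_kernel_def mult.commute mult.left_commute)

lemma scaled_kernel_psd:
  assumes "is_scaling \<phi> \<alpha>"
  shows "pos_semidef_kernel (scaled_kernel \<phi> \<alpha>)"
  unfolding pos_semidef_kernel_def
proof (intro allI impI)
  fix N :: nat and a :: "nat \<Rightarrow> real" and t
  have "(\<lambda>n. \<Sum>i<N. \<Sum>j<N. a i * a j * (\<alpha> n * \<phi> n (t i) * \<phi> n (t j))) sums
     (\<Sum>i<N. \<Sum>j<N. a i * a j * scaled_kernel \<phi> \<alpha> (t i) (t j))"
    unfolding scaled_kernel_def by (intro sums_sum sums_mult summable_sums scaled_kernel_summable assms)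
  moreover have "(\<Sum>i<N. \<Sum>j<N. a i * a j * (\<alpha> n * \<phi> n (t i) * \<phi> n (t j))) = \<alpha> n * (\<Sum>i<N. a i * \<phi> n (t i))\<^sup>2" for n
    by (simp add: power2_eq_square sum_product sum_distrib_left mult_ac)
  ultimately have "(\<lambda>n. \<alpha> n * (\<Sum>i<N. a i * \<phi> n (t i))\<^sup>2) sums
     (\<Sum>i<N. \<Sum>j<N. a i * a j * scaled_kernel \<phi> \<alpha> (t i) (t j))" by (simp only:)
  then show "0 \<le> (\<Sum>i<N. \<Sum>j<N. a i * a j * scaled_kernel \<phi> \<alpha> (t i) (t j))"
    by (rule sums_le[OF _ sums_zero, rotated]) (simp add: is_scaling_pos[OF assms] less_imp_le)
qed

lemma scaled_kernel_is_rkhs: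
  "is_scaling \<phi> \<alpha> \<Longrightarrow> is_rkhs (scaled_kernel \<phi> \<alpha>) (rkhs (scaled_kernel \<phi> \<alpha>)) (rkhs_ip (scaled_kernel \<phi> \<alpha>))"
  by (intro rkhs_is_rkhs scaled_kernel_sym scaled_kernel_psd)

text \<open>The diagonal of the larger kernel, taken in each of the two variables, dominates the
  smaller kernel termwise and has a continuous sum.\<close>

lemma continuous_scalings_mono:
  fixes \<phi> :: "nat \<Rightarrow> 't::topological_space \<Rightarrow> real"
  assumes \<alpha>0: "\<alpha>0 \<in> continuous_scalings \<phi>" and pos: "\<And>n. 0 < \<alpha> n" and le: "\<And>n. \<alpha> n \<le> \<alpha>0 n"
    and \<phi>: "\<And>n. continuous_on UNIV (\<phi> n)"
  shows "\<alpha> \<in> continuous_scalings \<phi>"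
proof -
  have sc: "is_scaling \<phi> \<alpha>0" and ck: "continuous_kernel (scaled_kernel \<phi> \<alpha>0)"
    using \<alpha>0 by (auto simp: continuous_scalings_def)
  have sm0: "summable (\<lambda>n. \<alpha>0 n * (\<phi> n t)\<^sup>2)" for t using sc by (simp add: is_scaling_def)
  have "summable (\<lambda>n. \<alpha> n * (\<phi> n t)\<^sup>2)" for t
    by (rule summable_comparison_test[OF _ sm0[of t]])
      (use pos le in \<open>auto intro!: exI[of _ 0] mult_right_mono simp: less_imp_le abs_mult\<close>)
  then have sc': "is_scaling \<phi> \<alpha>" using pos by (simp add: is_scaling_def)
  have diag: "continuous_on UNIV (\<lambda>t. \<Sum>n. \<alpha>0 n * (\<phi> n t)\<^sup>2)"
  proof -
    have "continuous_on UNIV (\<lambda>t. (\<lambda>(t, t'). scaled_kernel \<phi> \<alpha>0 t t') (t, t))"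
      by (rule continuous_on_compose2[OF ck[unfolded continuous_kernel_def]]) (auto intro: continuous_intros)
    then show ?thesis by (simp add: scaled_kernel_def power2_eq_square mult.assoc)
  qed
  let ?b = "\<lambda>n p. (\<alpha>0 n * (\<phi> n (fst p))\<^sup>2 + \<alpha>0 n * (\<phi> n (snd p))\<^sup>2) / 2"
  have \<phi>': "continuous_on UNIV (\<lambda>p. \<phi> n (fst p))" "continuous_on UNIV (\<lambda>p. \<phi> n (snd p))" for n
    by (rule continuous_on_compose2[OF \<phi>]; auto intro: continuous_intros)+
  have "continuous_on UNIV (\<lambda>p. \<Sum>n. \<alpha> n * \<phi> n (fst p) * \<phi> n (snd p))"
  proof (rule continuous_suminf_dominated)
    show "\<bar>\<alpha> n * \<phi> n (fst p) * \<phi> n (snd p)\<bar> \<le> ?b n p" for n p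
      by (rule scaled_kernel_term_bound[OF pos le])
    show "summable (\<lambda>n. ?b n p)" for p
      by (intro summable_divide summable_add sm0)
    have "(\<Sum>n. ?b n p) = ((\<Sum>n. \<alpha>0 n * (\<phi> n (fst p))\<^sup>2) + (\<Sum>n. \<alpha>0 n * (\<phi> n (snd p))\<^sup>2)) / 2" for p
      by (subst suminf_divide[OF summable_add[OF sm0 sm0]], subst suminf_add[OF sm0 sm0]) simp
    moreover have "continuous_on UNIV (\<lambda>p. \<Sum>n. \<alpha>0 n * (\<phi> n (fst p))\<^sup>2)"
      by (rule continuous_on_compose2[OF diag]) (auto intro: continuous_intros)
    moreover have "continuous_on UNIV (\<lambda>p. \<Sum>n. \<alpha>0 n * (\<phi> n (snd p))\<^sup>2)"
      by (rule continuous_on_compose2[OF diag]) (auto intro: continuous_intros)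
    ultimately show "continuous_on UNIV (\<lambda>p. \<Sum>n. ?b n p)"
      by (simp only:) (intro continuous_intros; simp)
  qed (intro continuous_intros \<phi>'; simp)+
  then have "continuous_kernel (scaled_kernel \<phi> \<alpha>)"
    by (simp add: continuous_kernel_def scaled_kernel_def case_prod_beta)
  then show ?thesis using sc' by (simp add: continuous_scalings_def)
qed

lemma continuous_scalings_add:
  assumes "\<alpha> \<in> continuous_scalings \<phi>" "\<beta> \<in> continuous_scalings \<phi>"
  shows "(\<lambda>n. \<alpha> n + \<beta> n) \<in> continuous_scalings \<phi>"
proof -
  have a: "is_scaling \<phi> \<alpha>" "is_scaling \<phi> \<beta>" using assms by (auto simp: continuous_scalings_def)
  have "is_scaling \<phi> (\<lambda>n. \<alpha> n + \<beta> n)"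
    using a by (auto simp: is_scaling_def distrib_right intro!: add_pos_pos summable_add)
  moreover have "scaled_kernel \<phi> (\<lambda>n. \<alpha> n + \<beta> n) t t' = scaled_kernel \<phi> \<alpha> t t' + scaled_kernel \<phi> \<beta> t t'" for t t'
    unfolding scaled_kernel_def
    by (subst suminf_add[OF scaled_kernel_summable[OF a(1)] scaled_kernel_summable[OF a(2)]])
      (simp add: distrib_right)
  ultimately show ?thesis using assms
    by (auto simp: continuous_scalings_def continuous_kernel_def case_prod_beta intro!: continuous_on_add)
qed

text \<open>With respect to the basis \<open>sqrt (\<alpha> n) * \<phi> n\<close> the coefficients
  are \<open>c n / sqrt (\<alpha> n)\<close>, whence the weights. The second claim recovers
  \<open>c\<close> from \<open>f\<close> and is the source of uniqueness.\<close>

lemma scaled_rkhs_synthesis: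
  assumes onb: "scaled_bases_orthonormal \<phi>" and \<alpha>: "\<alpha> \<in> continuous_scalings \<phi>"
    and c: "summable (\<lambda>n. (c n)\<^sup>2 / \<alpha> n)" "\<And>t. (\<lambda>n. c n * \<phi> n t) sums f t"
  shows "f \<in> rkhs (scaled_kernel \<phi> \<alpha>)"
    and "c n = sqrt (\<alpha> n) * rkhs_ip (scaled_kernel \<phi> \<alpha>) f (\<lambda>t. sqrt (\<alpha> n) * \<phi> n t)"
proof -
  have sc: "is_scaling \<phi> \<alpha>" using \<alpha> by (simp add: continuous_scalings_def)
  have pos: "\<alpha> n > 0" for n using is_scaling_pos[OF sc] .
  have o: "orthonormal_basis (scaled_kernel \<phi> \<alpha>) (\<lambda>n t. sqrt (\<alpha> n) * \<phi> n t)"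
    using onb \<alpha> by (simp add: scaled_bases_orthonormal_def)
  have 1: "summable (\<lambda>n. (c n / sqrt (\<alpha> n))\<^sup>2)"
    using c(1) pos by (simp add: power_divide less_imp_le)
  have 2: "(\<lambda>n. c n / sqrt (\<alpha> n) * (sqrt (\<alpha> n) * \<phi> n t)) sums f t" for t
    using c(2)[of t] pos by (simp add: less_imp_neq[OF pos, symmetric])
  show "f \<in> rkhs (scaled_kernel \<phi> \<alpha>)"
    by (rule rkhs_synthesis(1)[OF scaled_kernel_is_rkhs[OF sc] o 1 2])
  show "c n = sqrt (\<alpha> n) * rkhs_ip (scaled_kernel \<phi> \<alpha>) f (\<lambda>t. sqrt (\<alpha> n) * \<phi> n t)"
    using rkhs_synthesis(2)[OF scaled_kernel_is_rkhs[OF sc] o 1 2, of n] pos[of n] by simp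
qed

lemma scaled_rkhs_expansion:
  assumes onb: "scaled_bases_orthonormal \<phi>" and \<alpha>: "\<alpha> \<in> continuous_scalings \<phi>"
    and f: "f \<in> rkhs (scaled_kernel \<phi> \<alpha>)"
  obtains c where "summable (\<lambda>n. (c n)\<^sup>2 / \<alpha> n)" "\<And>t. (\<lambda>n. c n * \<phi> n t) sums f t"
proof -
  have sc: "is_scaling \<phi> \<alpha>" using \<alpha> by (simp add: continuous_scalings_def)
  have pos: "\<alpha> n > 0" for n using is_scaling_pos[OF sc] .
  have o: "orthonormal_basis (scaled_kernel \<phi> \<alpha>) (\<lambda>n t. sqrt (\<alpha> n) * \<phi> n t)"
    using onb \<alpha> by (simp add: scaled_bases_orthonormal_def)
  let ?d = "\<lambda>n. rkhs_ip (scaled_kernel \<phi> \<alpha>) f (\<lambda>t. sqrt (\<alpha> n) * \<phi> n t)"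
  show thesis
  proof (rule that[of "\<lambda>n. ?d n * sqrt (\<alpha> n)"])
    show "summable (\<lambda>n. (?d n * sqrt (\<alpha> n))\<^sup>2 / \<alpha> n)"
      using rkhs_coefficients_summable[OF scaled_kernel_is_rkhs[OF sc] o f] pos
      by (simp add: power_mult_distrib less_imp_le less_imp_neq[OF pos, symmetric])
    show "(\<lambda>n. ?d n * sqrt (\<alpha> n) * \<phi> n t) sums f t" for t
      using rkhs_expansion[OF scaled_kernel_is_rkhs[OF sc] o f, of t] by (simp add: mult.assoc)
  qed
qed

text \<open>Both expansions live in the larger space scaled by \<open>\<alpha> + \<beta>\<close>, whose basis is orthonormal.\<close>

lemma scaled_coefficients_unique:
  assumes onb: "scaled_bases_orthonormal \<phi>"
    and \<alpha>: "\<alpha> \<in> continuous_scalings \<phi>" "summable (\<lambda>n. (c n)\<^sup>2 / \<alpha> n)" "\<And>t. (\<lambda>n. c n * \<phi> n t) sums f t"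
    and \<beta>: "\<beta> \<in> continuous_scalings \<phi>" "summable (\<lambda>n. (d n)\<^sup>2 / \<beta> n)" "\<And>t. (\<lambda>n. d n * \<phi> n t) sums f t"
  shows "c = d"
proof
  fix n
  have pos: "\<alpha> n > 0" "\<beta> n > 0" for n using \<alpha>(1) \<beta>(1) by (auto simp: continuous_scalings_def is_scaling_def)
  have le: "x\<^sup>2 / (\<alpha> n + \<beta> n) \<le> x\<^sup>2 / \<alpha> n" "x\<^sup>2 / (\<alpha> n + \<beta> n) \<le> x\<^sup>2 / \<beta> n" for n x
    using pos[of n] by (auto intro!: divide_left_mono mult_pos_pos add_pos_pos)
  have "0 \<le> x\<^sup>2 / (\<alpha> n + \<beta> n)" for n x using pos[of n] by (simp add: less_imp_le)
  then have le: "norm (x\<^sup>2 / (\<alpha> n + \<beta> n)) \<le> x\<^sup>2 / \<alpha> n" "norm (x\<^sup>2 / (\<alpha> n + \<beta> n)) \<le> x\<^sup>2 / \<beta> n" for n x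
    using le[of x n] by (simp_all only: real_norm_def abs_of_nonneg)
  have "summable (\<lambda>n. (c n)\<^sup>2 / (\<alpha> n + \<beta> n))"
    by (rule summable_comparison_test[OF _ \<alpha>(2)]) (use le in blast)
  moreover have "summable (\<lambda>n. (d n)\<^sup>2 / (\<alpha> n + \<beta> n))"
    by (rule summable_comparison_test[OF _ \<beta>(2)]) (use le in blast)
  ultimately show "c n = d n"
    using scaled_rkhs_synthesis(2)[OF onb continuous_scalings_add[OF \<alpha>(1) \<beta>(1)], of c f n, OF _ \<alpha>(3)]
      scaled_rkhs_synthesis(2)[OF onb continuous_scalings_add[OF \<alpha>(1) \<beta>(1)], of d f n, OF _ \<beta>(3)] by simp
qed

section \<open>Gaussian moments and random series\<close>

text \<open>The kurtosis 3 of the normal law is stated without a division by the variance, so that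
  the point mass at zero is covered.\<close>

lemma (in prob_space) centred_gaussian_moments:
  assumes g: "gaussian_rv M Y" and mean: "expectation Y = 0"
  shows "integrable M (\<lambda>\<omega>. Y \<omega> ^ k)" "expectation (\<lambda>\<omega>. Y \<omega> ^ 4) = 3 * (expectation (\<lambda>\<omega>. (Y \<omega>)\<^sup>2))\<^sup>2"
proof -
  have Y[measurable]: "Y \<in> borel_measurable M" using g by (simp add: gaussian_rv_def)
  from g consider m where "AE \<omega> in M. Y \<omega> = m"
    | m \<sigma> where "\<sigma> > 0" "distributed M lborel Y (normal_density m \<sigma>)" by (auto simp: gaussian_rv_def)
  then have "integrable M (\<lambda>\<omega>. Y \<omega> ^ k) \<and> expectation (\<lambda>\<omega>. Y \<omega> ^ 4) = 3 * (expectation (\<lambda>\<omega>. (Y \<omega>)\<^sup>2))\<^sup>2"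
  proof cases
    case 1
    have "expectation Y = expectation (\<lambda>_. m)" by (rule integral_cong_AE) (use 1 in auto)
    then have "m = 0" using mean by (simp add: prob_space)
    have c: "AE \<omega> in M. Y \<omega> ^ k = m ^ k" for k using 1 by eventually_elim simp
    have "integrable M (\<lambda>\<omega>. Y \<omega> ^ k)"
      by (subst integrable_cong_AE[OF _ _ c]) auto
    moreover have "expectation (\<lambda>\<omega>. Y \<omega> ^ k) = expectation (\<lambda>_. m ^ k)" for k
      by (rule integral_cong_AE[OF _ _ c]) auto
    ultimately show ?thesis using \<open>m = 0\<close> by simp
  next
    case 2
    have "m = 0" using normal_distributed_expectation[OF 2] mean by simp
    note D = 2(2)[unfolded \<open>m = 0\<close>]
    have i: "integrable M (\<lambda>\<omega>. Y \<omega> ^ k)"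
      using distributed_integrable[OF D, of "\<lambda>x. x ^ k"] integrable_normal_moment[OF 2(1), of 0 k] by simp
    have e: "expectation (\<lambda>\<omega>. Y \<omega> ^ (2 * k)) = fact (2 * k) / ((2 / \<sigma>\<^sup>2)^k * fact k)" for k
      using distributed_integral[OF D, of "\<lambda>x. x ^ (2 * k)"] integral_normal_moment_even[OF 2(1), of 0 k] by simp
    have "expectation (\<lambda>\<omega>. Y \<omega> ^ 4) = 3 * (\<sigma>\<^sup>2)\<^sup>2"
      using e[of 2] 2(1) by (simp add: fact_numeral power2_eq_square)
    moreover have "expectation (\<lambda>\<omega>. (Y \<omega>)\<^sup>2) = \<sigma>\<^sup>2" using e[of 1] by simp
    ultimately show ?thesis using i by simp
  qed
  then show "integrable M (\<lambda>\<omega>. Y \<omega> ^ k)" "expectation (\<lambda>\<omega>. Y \<omega> ^ 4) = 3 * (expectation (\<lambda>\<omega>. (Y \<omega>)\<^sup>2))\<^sup>2"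
    by auto
qed

text \<open>Fatou's lemma for convergent integrals. It transfers second and fourth moment bounds to
  limits and shows that the error of the expansion of \<open>X t\<close> vanishes.\<close>

lemma fatou_real:
  fixes F :: "nat \<Rightarrow> 'a \<Rightarrow> real"
  assumes i: "\<And>k. integrable M (F k)" and nn: "\<And>k \<omega>. 0 \<le> F k \<omega>"
    and l: "AE \<omega> in M. (\<lambda>k. F k \<omega>) \<longlonglongrightarrow> G \<omega>"
    and G[measurable]: "G \<in> borel_measurable M" and c: "(\<lambda>k. \<integral>\<omega>. F k \<omega> \<partial>M) \<longlonglongrightarrow> c"
  shows "integrable M G" "(\<integral>\<omega>. G \<omega> \<partial>M) \<le> c" "AE \<omega> in M. 0 \<le> G \<omega>"
proof -
  have [measurable]: "F k \<in> borel_measurable M" for k using i by auto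
  show pos: "AE \<omega> in M. 0 \<le> G \<omega>" using l
  proof eventually_elim
    case (elim \<omega>)
    then show ?case by (rule LIMSEQ_le_const) (simp add: nn)
  qed
  have "(\<integral>\<^sup>+ \<omega>. ennreal (G \<omega>) \<partial>M) = (\<integral>\<^sup>+ \<omega>. liminf (\<lambda>k. ennreal (F k \<omega>)) \<partial>M)"
  proof (rule nn_integral_cong_AE)
    show "AE \<omega> in M. ennreal (G \<omega>) = liminf (\<lambda>k. ennreal (F k \<omega>))" using l
    proof eventually_elim
      case (elim \<omega>)
      then have "(\<lambda>k. ennreal (F k \<omega>)) \<longlonglongrightarrow> ennreal (G \<omega>)" by (rule tendsto_ennrealI)
      then show ?case by (simp add: lim_imp_Liminf)
    qed
  qed
  also have "\<dots> \<le> liminf (\<lambda>k. \<integral>\<^sup>+ \<omega>. ennreal (F k \<omega>) \<partial>M)"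
    by (rule nn_integral_liminf) simp
  also have "(\<lambda>k. \<integral>\<^sup>+ \<omega>. ennreal (F k \<omega>) \<partial>M) = (\<lambda>k. ennreal (\<integral>\<omega>. F k \<omega> \<partial>M))"
    using nn_integral_eq_integral[OF i] nn by simp
  also have "liminf \<dots> = ennreal c"
    using tendsto_ennrealI[OF c] by (simp add: lim_imp_Liminf)
  finally have le: "(\<integral>\<^sup>+ \<omega>. ennreal (G \<omega>) \<partial>M) \<le> ennreal c" .
  then have fin: "(\<integral>\<^sup>+ \<omega>. ennreal (G \<omega>) \<partial>M) < \<infinity>" by (rule le_less_trans) simp
  show int: "integrable M G" by (rule integrableI_nonneg[OF G pos fin])
  have "0 \<le> c" by (rule LIMSEQ_le_const[OF c]) (simp add: nn)
  then show "(\<integral>\<omega>. G \<omega> \<partial>M) \<le> c"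
    using le nn_integral_eq_integral[OF int pos] by (simp add: ennreal_le_iff)
qed

lemma integrable_product_of_squares:
  fixes f g :: "'a \<Rightarrow> real"
  assumes "integrable M (\<lambda>x. (f x)\<^sup>2)" "integrable M (\<lambda>x. (g x)\<^sup>2)"
    and [measurable]: "f \<in> borel_measurable M" "g \<in> borel_measurable M"
  shows "integrable M (\<lambda>x. f x * g x)"
proof (rule Bochner_Integration.integrable_bound[of M "\<lambda>x. (f x)\<^sup>2 + (g x)\<^sup>2"])
  show "AE x in M. norm (f x * g x) \<le> norm ((f x)\<^sup>2 + (g x)\<^sup>2)"
  proof (intro AE_I2)
    fix x
    have "2 * \<bar>f x * g x\<bar> \<le> (f x)\<^sup>2 + (g x)\<^sup>2"
      using zero_le_power2[of "\<bar>f x\<bar> - \<bar>g x\<bar>"] by (simp add: power2_diff abs_mult)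
    then show "norm (f x * g x) \<le> norm ((f x)\<^sup>2 + (g x)\<^sup>2)" by simp
  qed
qed (use assms in auto)

lemma AE_summable_if_expectation_summable:
  fixes F :: "nat \<Rightarrow> 'a \<Rightarrow> real"
  assumes i: "\<And>k. integrable M (F k)" and nn: "\<And>k \<omega>. 0 \<le> F k \<omega>"
    and s: "summable (\<lambda>k. \<integral>\<omega>. F k \<omega> \<partial>M)"
  shows "AE \<omega> in M. summable (\<lambda>k. F k \<omega>)"
proof -
  have [measurable]: "F k \<in> borel_measurable M" for k using i by auto
  have "(\<integral>\<^sup>+ \<omega>. (\<Sum>k. ennreal (F k \<omega>)) \<partial>M) = (\<Sum>k. \<integral>\<^sup>+ \<omega>. ennreal (F k \<omega>) \<partial>M)"
    by (rule nn_integral_suminf) simp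
  also have "\<dots> = (\<Sum>k. ennreal (\<integral>\<omega>. F k \<omega> \<partial>M))"
    using nn_integral_eq_integral[OF i] nn by simp
  also have "\<dots> < \<infinity>" using s
    by (simp add: suminf_ennreal2 nn integral_nonneg less_top[symmetric])
  finally have "AE \<omega> in M. (\<Sum>k. ennreal (F k \<omega>)) \<noteq> \<infinity>"
    by (intro nn_integral_PInf_AE) auto
  then show ?thesis
    by eventually_elim (simp add: nn summable_suminf_not_top)
qed

context prob_space
begin

lemma AE_weighted_squares_summable:
  fixes Z :: "nat \<Rightarrow> 'a \<Rightarrow> real"
  assumes "\<And>n. integrable M (\<lambda>\<omega>. (Z n \<omega>)\<^sup>2)" "\<And>n. expectation (\<lambda>\<omega>. (Z n \<omega>)\<^sup>2) = 1"
    and b: "\<And>n. 0 \<le> b n" "summable b"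
  shows "AE \<omega> in M. summable (\<lambda>n. b n * (Z n \<omega>)\<^sup>2)"
  by (rule AE_summable_if_expectation_summable) (use assms in auto)

text \<open>With weights at most 1 the partial sums have variance at most twice their expectation,
  which tends to infinity, so Chebyshev's inequality excludes bounded partial sums.\<close>

lemma AE_weighted_squares_not_summable:
  fixes Z :: "nat \<Rightarrow> 'a \<Rightarrow> real"
  assumes [measurable]: "\<And>n. Z n \<in> borel_measurable M"
    and i2: "\<And>n. integrable M (\<lambda>\<omega>. (Z n \<omega>)\<^sup>2)" and e2: "\<And>n. expectation (\<lambda>\<omega>. (Z n \<omega>)\<^sup>2) = 1"
    and i4: "\<And>m n. integrable M (\<lambda>\<omega>. (Z m \<omega>)\<^sup>2 * (Z n \<omega>)\<^sup>2)"
    and e4: "\<And>m n. expectation (\<lambda>\<omega>. (Z m \<omega>)\<^sup>2 * (Z n \<omega>)\<^sup>2) \<le> (if m = n then 3 else 1)"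
    and b: "\<And>n. 0 \<le> b n" "\<not> summable b"
  shows "AE \<omega> in M. \<not> summable (\<lambda>n. b n * (Z n \<omega>)\<^sup>2)"
proof -
  \<comment> \<open>Truncation at 1 gives \<open>d n * d n \<le> d n\<close>, hence a variance
    linear in the mean. Divergence survives: a summable \<open>d\<close> is eventually below 1 and
    there equals \<open>b\<close>.\<close>
  define d where "d n = min (b n) 1" for n
  have d: "0 \<le> d n" "d n \<le> 1" "d n \<le> b n" for n using b(1) by (auto simp: d_def)
  have nd: "\<not> summable d"
  proof
    assume s: "summable d"
    have "\<forall>\<^sub>F n in sequentially. d n < 1" using order_tendstoD(2)[OF summable_LIMSEQ_zero[OF s], of 1] by simp
    then have "\<forall>\<^sub>F n in sequentially. d n = b n" by eventually_elim (auto simp: d_def min_def split: if_splits)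
    then have "summable b" using summable_cong[of d b] s by blast
    then show False using b(2) by simp
  qed
  define S where "S N \<omega> = (\<Sum>n<N. d n * (Z n \<omega>)\<^sup>2)" for N \<omega>
  define m where "m N = (\<Sum>n<N. d n)" for N
  have [measurable]: "S N \<in> borel_measurable M" for N unfolding S_def by measurable
  have ES: "expectation (S N) = m N" for N
    unfolding S_def m_def by (subst Bochner_Integration.integral_sum) (use i2 e2 in auto)
  have sq: "(S N \<omega>)\<^sup>2 = (\<Sum>i<N. \<Sum>j<N. d i * d j * ((Z i \<omega>)\<^sup>2 * (Z j \<omega>)\<^sup>2))" for N \<omega>
    unfolding S_def power2_eq_square[of "sum _ _"] sum_product by (simp add: mult_ac)
  have iS2: "integrable M (\<lambda>\<omega>. (S N \<omega>)\<^sup>2)" for N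
    unfolding sq by (intro Bochner_Integration.integrable_sum integrable_mult_right i4)
  have iS: "integrable M (S N)" for N
    unfolding S_def by (intro Bochner_Integration.integrable_sum integrable_mult_right i2)
  have ES2: "expectation (\<lambda>\<omega>. (S N \<omega>)\<^sup>2) \<le> (m N)\<^sup>2 + 2 * m N" for N
  proof -
    have "expectation (\<lambda>\<omega>. (S N \<omega>)\<^sup>2) = (\<Sum>i<N. \<Sum>j<N. d i * d j * expectation (\<lambda>\<omega>. (Z i \<omega>)\<^sup>2 * (Z j \<omega>)\<^sup>2))"
      unfolding sq by (simp add: Bochner_Integration.integral_sum i4)
    also have "\<dots> \<le> (\<Sum>i<N. \<Sum>j<N. d i * d j * (1 + (if i = j then 2 else 0)))"
    proof (intro sum_mono mult_left_mono)
      show "expectation (\<lambda>\<omega>. (Z i \<omega>)\<^sup>2 * (Z j \<omega>)\<^sup>2) \<le> 1 + (if i = j then 2 else 0)" for i j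
        using e4[of i j] by (cases "i = j") simp_all
    qed (simp add: d)
    also have "\<dots> = (\<Sum>i<N. \<Sum>j<N. d i * d j + (if i = j then 2 * (d i * d i) else 0))"
      by (intro sum.cong) auto
    also have "\<dots> = (m N)\<^sup>2 + (\<Sum>i<N. 2 * (d i * d i))"
      by (simp add: m_def power2_eq_square sum_product sum.distrib)
    also have "(\<Sum>i<N. 2 * (d i * d i)) \<le> (\<Sum>i<N. 2 * d i)"
      using d by (intro sum_mono mult_left_mono) (auto intro: mult_left_le)
    also have "\<dots> = 2 * m N" by (simp add: m_def sum_distrib_left)
    finally show ?thesis by simp
  qed
  have m_large: "\<exists>N. C < m N" for C
  proof (rule ccontr)
    assume "\<not> (\<exists>N. C < m N)"
    then have "summable d" unfolding m_def
      by (intro summableI_nonneg_bounded[of d C]) (auto simp: d not_less)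
    then show False using nd by simp
  qed
  define A where "A c = {\<omega>\<in>space M. \<forall>N. S N \<omega> \<le> c}" for c :: real
  have [measurable]: "A c \<in> sets M" for c unfolding A_def by measurable
  have "prob (A c) \<le> e" if "0 \<le> c" "0 < e" for c e
  proof -
    \<comment> \<open>The first bound puts \<open>c\<close> below half the mean, and keeps the mean
      positive when \<open>c = 0\<close>; the second makes Chebyshev's bound \<open>8 / m N\<close>
      at most \<open>e\<close>.\<close>
    obtain N where "max (2 * c + 1) (8 / e) < m N" using m_large by blast
    then have N: "2 * c < m N" "0 < m N" "8 / e < m N" using that by auto
    have "A c \<subseteq> {\<omega>\<in>space M. m N / 2 \<le> \<bar>S N \<omega> - expectation (S N)\<bar>}"
    proof
      fix \<omega> assume "\<omega> \<in> A c"
      then have "S N \<omega> \<le> c" "\<omega> \<in> space M" by (auto simp: A_def)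
      then show "\<omega> \<in> {\<omega>\<in>space M. m N / 2 \<le> \<bar>S N \<omega> - expectation (S N)\<bar>}"
        using N(1) abs_ge_minus_self[of "S N \<omega> - m N"] by (simp add: ES)
    qed
    then have "prob (A c) \<le> prob {\<omega>\<in>space M. m N / 2 \<le> \<bar>S N \<omega> - expectation (S N)\<bar>}"
      by (intro finite_measure_mono) measurable
    also have "\<dots> \<le> variance (S N) / (m N / 2)\<^sup>2"
      using N by (intro Chebyshev_inequality iS2) auto
    also have "variance (S N) = expectation (\<lambda>\<omega>. (S N \<omega>)\<^sup>2) - (m N)\<^sup>2"
      using variance_eq[OF iS iS2] by (simp add: ES)
    also have "\<dots> / (m N / 2)\<^sup>2 \<le> 2 * m N / (m N / 2)\<^sup>2"
      using ES2[of N] by (intro divide_right_mono) auto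
    also have "\<dots> = 8 / m N" using N by (simp add: power2_eq_square)
    also have "\<dots> \<le> e" using N that by (simp add: field_simps)
    finally show ?thesis .
  qed
  then have "prob (A c) \<le> 0" if "0 \<le> c" for c using that field_le_epsilon[of "prob (A c)" 0] by simp
  then have "prob (A (real k)) = 0" for k by (meson measure_nonneg of_nat_0_le_iff order_antisym)
  then have "AE \<omega> in M. \<omega> \<notin> A (real k)" for k
    by (intro AE_not_in) (auto simp: null_sets_def emeasure_eq_measure)
  then have "AE \<omega> in M. \<forall>k. \<omega> \<notin> A (real k)" by (simp add: AE_all_countable)
  moreover have "AE \<omega> in M. \<omega> \<in> space M" by simp
  ultimately show ?thesis
  proof eventually_elim
    case (elim \<omega>)
    show ?case
    proof
      assume s: "summable (\<lambda>n. b n * (Z n \<omega>)\<^sup>2)"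
      obtain k where k: "(\<Sum>n. b n * (Z n \<omega>)\<^sup>2) < real k" using reals_Archimedean2 by blast
      have "S N \<omega> \<le> real k" for N
      proof -
        have "S N \<omega> \<le> (\<Sum>n<N. b n * (Z n \<omega>)\<^sup>2)" unfolding S_def by (intro sum_mono mult_right_mono d) auto
        also have "\<dots> \<le> (\<Sum>n. b n * (Z n \<omega>)\<^sup>2)" by (rule sum_le_suminf[OF s]) (use b in auto)
        finally show ?thesis using k by simp
      qed
      then show False using elim by (auto simp: A_def)
    qed
  qed
qed

end

section \<open>The isonormal map of a Gaussian process\<close>

locale gaussian_rkhs = prob_space M for M :: "'w measure" +
  fixes X :: "'t \<Rightarrow> 'w \<Rightarrow> real" and K :: "'t kernel"
  assumes process: "centred_gaussian_process M X K" and psd: "pos_semidef_kernel K"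
begin

text \<open>Symmetry is not contained in \<open>pos_semidef_kernel\<close>; it comes from
  \<open>K\<close> being a covariance.\<close>

lemma kernel_sym: "K s t = K t s"
  using process unfolding centred_gaussian_process_def by (metis (no_types, lifting) Bochner_Integration.integral_cong mult.commute)

lemma rkhs: "is_rkhs K (rkhs K) (rkhs_ip K)"
  by (rule rkhs_is_rkhs[OF kernel_sym psd])

sublocale fun_ip "rkhs K" "rkhs_ip K"
  using rkhs function_hilbert_space_fun_ip by (auto simp: is_rkhs_def)

sublocale F: fun_ip "finite_functionals :: (('t \<Rightarrow> real) \<Rightarrow> real) set" "functional_ip K"
  by (rule fun_ip_functionals[OF kernel_sym psd])

lemma process_measurable [measurable]: "X t \<in> borel_measurable M"
  using process by (simp add: centred_gaussian_process_def)

definition G :: "(('t \<Rightarrow> real) \<Rightarrow> real) \<Rightarrow> 'w \<Rightarrow> real" where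
  "G L \<omega> = L (\<lambda>t. X t \<omega>)"

lemma functional_gaussian: "L \<in> finite_functionals \<Longrightarrow> gaussian_rv M (G L)"
  using process unfolding centred_gaussian_process_def finite_functionals_def G_def by fastforce

lemma functional_measurable: "L \<in> finite_functionals \<Longrightarrow> G L \<in> borel_measurable M"
  using functional_gaussian by (simp add: gaussian_rv_def)

lemma process_integrable: "integrable M (\<lambda>\<omega>. X t \<omega> ^ k)"
proof (rule centred_gaussian_moments(1))
  show "gaussian_rv M (X t)" using functional_gaussian[OF finite_functional_eval, of t] by (simp add: G_def[abs_def])
  show "expectation (X t) = 0" using process by (simp add: centred_gaussian_process_def)
qed

lemma functional_mean:
  assumes "L \<in> finite_functionals"
  shows "expectation (G L) = 0"
proof -
  obtain N a t where L: "L = (\<lambda>F. \<Sum>i<N::nat. a i * F (t i))"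
    using assms by (auto simp: finite_functionals_def)
  have "expectation (G L) = (\<Sum>i<N. a i * expectation (X (t i)))"
    unfolding G_def L using process_integrable[of _ 1] by simp
  then show ?thesis using process by (simp add: centred_gaussian_process_def)
qed

lemma functional_covariance:
  assumes "L \<in> finite_functionals" "L' \<in> finite_functionals"
  shows "expectation (\<lambda>\<omega>. G L \<omega> * G L' \<omega>) = functional_ip K L L'"
proof -
  obtain N a t where L: "L = (\<lambda>F. \<Sum>i<N::nat. a i * F (t i))"
    using assms by (auto simp: finite_functionals_def)
  obtain N' a' t' where L': "L' = (\<lambda>F. \<Sum>i<N'::nat. a' i * F (t' i))"
    using assms by (auto simp: finite_functionals_def)
  have i: "integrable M (\<lambda>\<omega>. X s \<omega> * X s' \<omega>)" for s s'
    by (rule integrable_product_of_squares) (use process_integrable in auto)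
  have "G L \<omega> * G L' \<omega> = (\<Sum>i<N. \<Sum>j<N'. a i * a' j * (X (t i) \<omega> * X (t' j) \<omega>))" for \<omega>
    unfolding G_def L L' sum_product by (simp add: mult_ac)
  then have "expectation (\<lambda>\<omega>. G L \<omega> * G L' \<omega>) = (\<Sum>i<N. \<Sum>j<N'. a i * a' j * K (t i) (t' j))"
    using process by (simp add: i centred_gaussian_process_def)
  also have "\<dots> = functional_ip K L L'"
    by (simp add: functional_ip_def L L' sum_distrib_left mult.assoc)
  finally show ?thesis .
qed

lemma functional_moments:
  assumes "L \<in> finite_functionals"
  shows "integrable M (\<lambda>\<omega>. G L \<omega> ^ k)" "expectation (\<lambda>\<omega>. (G L \<omega>)\<^sup>2) = functional_ip K L L"
    "expectation (\<lambda>\<omega>. G L \<omega> ^ 4) = 3 * (functional_ip K L L)\<^sup>2"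
  using centred_gaussian_moments[OF functional_gaussian[OF assms] functional_mean[OF assms]]
    functional_covariance[OF assms assms] by (simp_all add: power2_eq_square)

text \<open>Fourth moments of \<open>G L \<plusminus> G L'\<close> determine the mixed moment by polarisation.\<close>

lemma functional_mixed_moment:
  assumes L: "L \<in> finite_functionals" and L': "L' \<in> finite_functionals"
  shows "integrable M (\<lambda>\<omega>. (G L \<omega>)\<^sup>2 * (G L' \<omega>)\<^sup>2)"
    "expectation (\<lambda>\<omega>. (G L \<omega>)\<^sup>2 * (G L' \<omega>)\<^sup>2) =
      functional_ip K L L * functional_ip K L' L' + 2 * (functional_ip K L L')\<^sup>2"
proof -
  let ?s = "\<lambda>F. L F + L' F" and ?d = "\<lambda>F. L F - L' F"
  have m: "?s \<in> finite_functionals" "?d \<in> finite_functionals"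
    using F.add_mem F.diff_mem L L' by auto
  \<comment> \<open>The sum of the fourth powers of \<open>x + y\<close> and \<open>x - y\<close> is
    \<open>2 * x ^ 4 + 12 * x\<^sup>2 * y\<^sup>2 + 2 * y ^ 4\<close>.\<close>
  have e: "(G L \<omega>)\<^sup>2 * (G L' \<omega>)\<^sup>2 = (G ?s \<omega> ^ 4 + G ?d \<omega> ^ 4 - 2 * G L \<omega> ^ 4 - 2 * G L' \<omega> ^ 4) / 12" for \<omega>
    unfolding G_def by (simp add: algebra_simps power4_eq_xxxx power2_eq_square)
  have i: "integrable M (\<lambda>\<omega>. G ?s \<omega> ^ 4)" "integrable M (\<lambda>\<omega>. G ?d \<omega> ^ 4)"
     "integrable M (\<lambda>\<omega>. G L \<omega> ^ 4)" "integrable M (\<lambda>\<omega>. G L' \<omega> ^ 4)"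
    using functional_moments(1) m L L' by auto
  show "integrable M (\<lambda>\<omega>. (G L \<omega>)\<^sup>2 * (G L' \<omega>)\<^sup>2)" unfolding e using i by simp
  have "expectation (\<lambda>\<omega>. (G L \<omega>)\<^sup>2 * (G L' \<omega>)\<^sup>2) =
     (3 * (functional_ip K ?s ?s)\<^sup>2 + 3 * (functional_ip K ?d ?d)\<^sup>2
      - 2 * (3 * (functional_ip K L L)\<^sup>2) - 2 * (3 * (functional_ip K L' L')\<^sup>2)) / 12"
    unfolding e using i functional_moments(3) m L L' by simp
  moreover have "functional_ip K ?s ?s = functional_ip K L L + 2 * functional_ip K L L' + functional_ip K L' L'"
    using F.ip_square_diff[OF L L', of "-1"] by simp
  moreover have "functional_ip K ?d ?d = functional_ip K L L - 2 * functional_ip K L L' + functional_ip K L' L'"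
    using F.ip_square_diff[OF L L', of 1] by simp
  ultimately show "expectation (\<lambda>\<omega>. (G L \<omega>)\<^sup>2 * (G L' \<omega>)\<^sup>2) =
      functional_ip K L L * functional_ip K L' L' + 2 * (functional_ip K L L')\<^sup>2"
    by (simp add: algebra_simps power2_eq_square)
qed

section \<open>The Gaussian variable attached to an element of the RKHS\<close>

text \<open>One sequence of functionals converges to \<open>f\<close> in norm and, evaluated on the
  paths, to \<open>Z\<close> almost surely. Linking \<open>f\<close> and \<open>Z\<close> by a
  relation respects that \<open>Z\<close> is determined only up to null sets; almost sure
  convergence is the mode that Fatou's lemma takes.\<close>

definition approximates :: "(nat \<Rightarrow> ('t \<Rightarrow> real) \<Rightarrow> real) \<Rightarrow> ('t \<Rightarrow> real) \<Rightarrow> ('w \<Rightarrow> real) \<Rightarrow> bool" where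
  "approximates L f Z \<longleftrightarrow> (\<forall>k. L k \<in> finite_functionals) \<and>
     (\<lambda>k. ip_norm (rkhs_ip K) (\<lambda>s. L k (K s) - f s)) \<longlonglongrightarrow> 0 \<and>
     (AE \<omega> in M. (\<lambda>k. G (L k) \<omega>) \<longlonglongrightarrow> Z \<omega>)"

definition isonormal :: "('t \<Rightarrow> real) \<Rightarrow> ('w \<Rightarrow> real) \<Rightarrow> bool" where
  "isonormal f Z \<longleftrightarrow> f \<in> rkhs K \<and> Z \<in> borel_measurable M \<and> (\<exists>L. approximates L f Z)"

lemma functional_mem: "L \<in> finite_functionals \<Longrightarrow> (\<lambda>s. L (K s)) \<in> rkhs K"
  by (rule is_rkhs_functional(1)[OF rkhs])

lemma functional_norm:
  "L \<in> finite_functionals \<Longrightarrow> (ip_norm (rkhs_ip K) (\<lambda>s. L (K s)))\<^sup>2 = functional_ip K L L"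
  using is_rkhs_functional_norm[OF rkhs] F.norm_square by simp

lemma isonormal_functional:
  assumes "L \<in> finite_functionals"
  shows "isonormal (\<lambda>s. L (K s)) (G L)"
  unfolding isonormal_def approximates_def
  using assms functional_mem functional_measurable ip_zero[OF zero_mem]
  by (auto intro!: exI[of _ "\<lambda>_. L"] simp: ip_norm_def)

lemma isonormal_comb:
  assumes "isonormal f Z" "isonormal g W"
  shows "isonormal (\<lambda>t. a * f t + b * g t) (\<lambda>\<omega>. a * Z \<omega> + b * W \<omega>)"
proof -
  from assms obtain L L' where f: "f \<in> rkhs K" "g \<in> rkhs K"
    and [measurable]: "Z \<in> borel_measurable M" "W \<in> borel_measurable M"
    and A: "approximates L f Z" and B: "approximates L' g W" by (auto simp: isonormal_def)
  have L: "\<And>k. L k \<in> finite_functionals" "(\<lambda>k. ip_norm (rkhs_ip K) (\<lambda>s. L k (K s) - f s)) \<longlonglongrightarrow> 0"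
    "AE \<omega> in M. (\<lambda>k. G (L k) \<omega>) \<longlonglongrightarrow> Z \<omega>" using A by (auto simp: approximates_def)
  have L': "\<And>k. L' k \<in> finite_functionals" "(\<lambda>k. ip_norm (rkhs_ip K) (\<lambda>s. L' k (K s) - g s)) \<longlonglongrightarrow> 0"
    "AE \<omega> in M. (\<lambda>k. G (L' k) \<omega>) \<longlonglongrightarrow> W \<omega>" using B by (auto simp: approximates_def)
  let ?L = "\<lambda>k F. a * L k F + b * L' k F"
  have m: "(\<lambda>s. L k (K s) - f s) \<in> rkhs K" "(\<lambda>s. L' k (K s) - g s) \<in> rkhs K" for k
    using diff_mem functional_mem L L' f by auto
  have "approximates ?L (\<lambda>t. a * f t + b * g t) (\<lambda>\<omega>. a * Z \<omega> + b * W \<omega>)"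
    unfolding approximates_def
  proof (intro conjI allI)
    show "?L k \<in> finite_functionals" for k using F.comb_mem L L' by auto
    show "(\<lambda>k. ip_norm (rkhs_ip K) (\<lambda>s. ?L k (K s) - (a * f s + b * g s))) \<longlonglongrightarrow> 0"
    proof (rule Lim_null_comparison)
      show "\<forall>\<^sub>F k in sequentially. norm (ip_norm (rkhs_ip K) (\<lambda>s. ?L k (K s) - (a * f s + b * g s)))
         \<le> \<bar>a\<bar> * ip_norm (rkhs_ip K) (\<lambda>s. L k (K s) - f s) + \<bar>b\<bar> * ip_norm (rkhs_ip K) (\<lambda>s. L' k (K s) - g s)"
      proof (intro always_eventually allI)
        fix k
        have "(\<lambda>s. ?L k (K s) - (a * f s + b * g s)) = (\<lambda>s. a * (L k (K s) - f s) + b * (L' k (K s) - g s))"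
          by (simp add: algebra_simps)
        then show "norm (ip_norm (rkhs_ip K) (\<lambda>s. ?L k (K s) - (a * f s + b * g s)))
         \<le> \<bar>a\<bar> * ip_norm (rkhs_ip K) (\<lambda>s. L k (K s) - f s) + \<bar>b\<bar> * ip_norm (rkhs_ip K) (\<lambda>s. L' k (K s) - g s)"
          using norm_triangle_add[OF scale_mem[OF m(1)] scale_mem[OF m(2)], of a k b k] norm_scale[OF m(1), of a k] norm_scale[OF m(2), of b k]
            norm_nonneg[OF comb_mem[OF m, of a k b k]] by (simp del: right_diff_distrib right_diff_distrib')
      qed
      show "(\<lambda>k. \<bar>a\<bar> * ip_norm (rkhs_ip K) (\<lambda>s. L k (K s) - f s) + \<bar>b\<bar> * ip_norm (rkhs_ip K) (\<lambda>s. L' k (K s) - g s)) \<longlonglongrightarrow> 0"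
        by (intro tendsto_add_zero tendsto_mult_right_zero L L')
    qed
    show "AE \<omega> in M. (\<lambda>k. G (?L k) \<omega>) \<longlonglongrightarrow> a * Z \<omega> + b * W \<omega>"
      using L(3) L'(3) by eventually_elim (unfold G_def, intro tendsto_intros)
  qed
  then show ?thesis using f comb_mem by (auto simp: isonormal_def)
qed

lemma approximates_norm:
  assumes "approximates L f Z" "f \<in> rkhs K"
  shows "(\<lambda>k. functional_ip K (L k) (L k)) \<longlonglongrightarrow> rkhs_ip K f f"
proof -
  have L: "L k \<in> finite_functionals" for k using assms by (simp add: approximates_def)
  have "(\<lambda>k. (ip_norm (rkhs_ip K) (\<lambda>s. L k (K s)))\<^sup>2) \<longlonglongrightarrow> (ip_norm (rkhs_ip K) f)\<^sup>2"
    using assms by (intro tendsto_power norm_tendsto functional_mem L)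
      (auto simp: approximates_def)
  then show ?thesis using assms by (simp add: functional_norm L norm_square)
qed

lemma isonormal_bound:
  assumes "isonormal f Z"
  shows "integrable M (\<lambda>\<omega>. (Z \<omega>)\<^sup>2)" "expectation (\<lambda>\<omega>. (Z \<omega>)\<^sup>2) \<le> rkhs_ip K f f"
proof -
  from assms obtain L where f: "f \<in> rkhs K" and [measurable]: "Z \<in> borel_measurable M"
    and A: "approximates L f Z" by (auto simp: isonormal_def)
  have L: "L k \<in> finite_functionals" for k using A by (simp add: approximates_def)
  have "AE \<omega> in M. (\<lambda>k. G (L k) \<omega>) \<longlonglongrightarrow> Z \<omega>" using A by (simp add: approximates_def)
  then have l: "AE \<omega> in M. (\<lambda>k. (G (L k) \<omega>)\<^sup>2) \<longlonglongrightarrow> (Z \<omega>)\<^sup>2"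
    by eventually_elim (rule tendsto_power)
  have c: "(\<lambda>k. expectation (\<lambda>\<omega>. (G (L k) \<omega>)\<^sup>2)) \<longlonglongrightarrow> rkhs_ip K f f"
    using approximates_norm[OF A f] by (simp add: functional_moments(2) L)
  show "integrable M (\<lambda>\<omega>. (Z \<omega>)\<^sup>2)" "expectation (\<lambda>\<omega>. (Z \<omega>)\<^sup>2) \<le> rkhs_ip K f f"
    by (rule fatou_real[OF functional_moments(1)[OF L] _ l _ c]; simp)+
qed

text \<open>No mass is lost in the limit: the bound from Fatou's lemma also applies to
  \<open>Z - G (L k)\<close> and shows that its second moment tends to zero. The parameter
  \<open>d\<close> separates this error from \<open>Z\<close>; first \<open>k\<close> goes to
  infinity, then \<open>d\<close> to zero.\<close>

lemma isonormal_square: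
  assumes Z: "isonormal f Z"
  shows "expectation (\<lambda>\<omega>. (Z \<omega>)\<^sup>2) = rkhs_ip K f f"
proof (rule antisym[OF isonormal_bound(2)[OF Z]])
  from assms obtain L where f: "f \<in> rkhs K" and A: "approximates L f Z" by (auto simp: isonormal_def)
  have L: "L k \<in> finite_functionals" for k using A by (simp add: approximates_def)
  let ?q = "rkhs_ip K f f" and ?E = "expectation (\<lambda>\<omega>. (Z \<omega>)\<^sup>2)"
  have q: "0 \<le> ?q" by (rule ip_nonneg[OF f])
  have bound: "?q \<le> (1 + d) * ?E" if d: "d > 0" for d :: real
  proof (rule LIMSEQ_le[OF approximates_norm[OF A f]])
    let ?r = "\<lambda>k. rkhs_ip K (\<lambda>t. f t - L k (K t)) (\<lambda>t. f t - L k (K t))"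
    have m: "(\<lambda>t. f t - L k (K t)) \<in> rkhs K" for k by (intro diff_mem f functional_mem L)
    have "functional_ip K (L k) (L k) \<le> (1 + d) * ?E + (1 + 1 / d) * ?r k" for k
    proof -
      have D: "isonormal (\<lambda>t. f t - L k (K t)) (\<lambda>\<omega>. Z \<omega> - G (L k) \<omega>)"
        using isonormal_comb[OF Z isonormal_functional[OF L], of 1 "-1" k] by simp
      have "functional_ip K (L k) (L k) = expectation (\<lambda>\<omega>. (G (L k) \<omega>)\<^sup>2)" by (simp add: functional_moments(2) L)
      also have "\<dots> \<le> expectation (\<lambda>\<omega>. (1 + d) * (Z \<omega>)\<^sup>2 + (1 + 1 / d) * (Z \<omega> - G (L k) \<omega>)\<^sup>2)"
      proof (rule integral_mono)
        fix \<omega>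
        let ?a = "Z \<omega>" and ?b = "Z \<omega> - G (L k) \<omega>"
        \<comment> \<open>This square, divided by \<open>d\<close>, is exactly the gap in the
          inequality for \<open>(a - b)\<^sup>2\<close> below.\<close>
        have "(d * a + b)\<^sup>2 / d = d * a\<^sup>2 + 2 * a * b + b\<^sup>2 / d" for a b :: real
          using d by (simp add: field_simps power2_eq_square)
        then have sq: "0 \<le> d * a\<^sup>2 + 2 * a * b + b\<^sup>2 / d" for a b :: real
          using d by (metis divide_nonneg_pos zero_le_power2)
        have "(a - b)\<^sup>2 \<le> (1 + d) * a\<^sup>2 + (1 + 1 / d) * b\<^sup>2" for a b :: real
          using sq[of a b] by (simp add: power2_diff distrib_right)
        from this[of ?a ?b] show "(G (L k) \<omega>)\<^sup>2 \<le> (1 + d) * ?a\<^sup>2 + (1 + 1 / d) * ?b\<^sup>2" by simp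
      qed (use isonormal_bound(1)[OF Z] isonormal_bound(1)[OF D] functional_moments(1)[OF L] in auto)
      also have "\<dots> = (1 + d) * ?E + (1 + 1 / d) * expectation (\<lambda>\<omega>. (Z \<omega> - G (L k) \<omega>)\<^sup>2)"
        using isonormal_bound(1)[OF Z] isonormal_bound(1)[OF D] by simp
      also have "\<dots> \<le> (1 + d) * ?E + (1 + 1 / d) * ?r k"
        using isonormal_bound(2)[OF D] d by (intro add_left_mono mult_left_mono) auto
      finally show ?thesis .
    qed
    then show "\<exists>N. \<forall>k\<ge>N. functional_ip K (L k) (L k) \<le> (1 + d) * ?E + (1 + 1 / d) * ?r k" by blast
    have "?r k = (ip_norm (rkhs_ip K) (\<lambda>s. L k (K s) - f s))\<^sup>2" for k
      using norm_square[OF m] norm_diff_commute[OF f functional_mem[OF L]] by simp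
    moreover have "(\<lambda>k. (ip_norm (rkhs_ip K) (\<lambda>s. L k (K s) - f s))\<^sup>2) \<longlonglongrightarrow> 0\<^sup>2"
      using A by (intro tendsto_power) (simp add: approximates_def)
    ultimately have "?r \<longlonglongrightarrow> 0" by simp
    then have "(\<lambda>k. (1 + d) * ?E + (1 + 1 / d) * ?r k) \<longlonglongrightarrow> (1 + d) * ?E + (1 + 1 / d) * 0"
      by (intro tendsto_intros)
    then show "(\<lambda>k. (1 + d) * ?E + (1 + 1 / d) * ?r k) \<longlonglongrightarrow> (1 + d) * ?E" by simp
  qed
  show "?q \<le> ?E"
  proof (rule field_le_epsilon)
    fix e :: real assume e: "e > 0"
    \<comment> \<open>Since \<open>?E\<close> is at most \<open>?q\<close>, this choice of
      \<open>d\<close> costs at most \<open>e\<close>; the summand 1 covers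
      \<open>?q = 0\<close>.\<close>
    have "?q \<le> ?E + e / (?q + 1) * ?E" using bound[of "e / (?q + 1)"] e q by (simp add: distrib_right)
    also have "\<dots> \<le> ?E + e / (?q + 1) * (?q + 1)"
      using isonormal_bound(2)[OF Z] e q by (intro add_left_mono mult_left_mono) auto
    also have "\<dots> = ?E + e" using q by simp
    finally show "?q \<le> ?E + e" .
  qed
qed

text \<open>The mixed moments of the approximants converge to the right-hand side, and Fatou's lemma
  keeps an upper bound, which is the direction that the variance estimate for weighted squares
  requires.\<close>

lemma isonormal_mixed_moment:
  assumes "isonormal f Z" "isonormal g W"
  shows "integrable M (\<lambda>\<omega>. (Z \<omega>)\<^sup>2 * (W \<omega>)\<^sup>2)"
    "expectation (\<lambda>\<omega>. (Z \<omega>)\<^sup>2 * (W \<omega>)\<^sup>2) \<le> rkhs_ip K f f * rkhs_ip K g g + 2 * (rkhs_ip K f g)\<^sup>2"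
proof -
  from assms obtain L L' where f: "f \<in> rkhs K" "g \<in> rkhs K"
    and [measurable]: "Z \<in> borel_measurable M" "W \<in> borel_measurable M"
    and A: "approximates L f Z" and B: "approximates L' g W" by (auto simp: isonormal_def)
  have L: "L k \<in> finite_functionals" "L' k \<in> finite_functionals" for k
    using A B by (auto simp: approximates_def)
  have nl: "(\<lambda>k. ip_norm (rkhs_ip K) (\<lambda>s. L k (K s) - f s)) \<longlonglongrightarrow> 0"
    "(\<lambda>k. ip_norm (rkhs_ip K) (\<lambda>s. L' k (K s) - g s)) \<longlonglongrightarrow> 0"
    using A B by (auto simp: approximates_def)
  have "AE \<omega> in M. (\<lambda>k. G (L k) \<omega>) \<longlonglongrightarrow> Z \<omega>" "AE \<omega> in M. (\<lambda>k. G (L' k) \<omega>) \<longlonglongrightarrow> W \<omega>"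
    using A B by (auto simp: approximates_def)
  then have l: "AE \<omega> in M. (\<lambda>k. (G (L k) \<omega>)\<^sup>2 * (G (L' k) \<omega>)\<^sup>2) \<longlonglongrightarrow> (Z \<omega>)\<^sup>2 * (W \<omega>)\<^sup>2"
    by eventually_elim (intro tendsto_intros)
  have h: "(\<lambda>s. L k (K s)) \<in> rkhs K" "(\<lambda>s. L' k (K s)) \<in> rkhs K" for k
    by (intro functional_mem L)+
  have "(\<lambda>k. functional_ip K (L k) (L' k)) \<longlonglongrightarrow> rkhs_ip K f g"
  proof -
    have 1: "(\<lambda>k. rkhs_ip K (\<lambda>s. L k (K s) - f s) (\<lambda>s. L' k (K s))) \<longlonglongrightarrow> 0"
      by (rule ip_tendsto_zero[OF diff_mem[OF h(1) f(1)] cauchy_in_if_tendsto[OF h(2) f(2) nl(2)] nl(1)])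
    have 2: "(\<lambda>k. rkhs_ip K (\<lambda>s. L' k (K s) - g s) f) \<longlonglongrightarrow> 0"
      by (rule ip_tendsto_zero[OF diff_mem[OF h(2) f(2)] cauchy_in_const[OF f(1)] nl(2)])
    \<comment> \<open>The two arguments are exchanged for their limits one at a time, each at the
      cost of a null sequence.\<close>
    have "functional_ip K (L k) (L' k) = rkhs_ip K (\<lambda>s. L k (K s) - f s) (\<lambda>s. L' k (K s))
        + rkhs_ip K (\<lambda>s. L' k (K s) - g s) f + rkhs_ip K f g" for k
      using ip_diff[OF h(1) f(1) h(2), of k k] ip_diff[OF h(2) f(2) f(1), of k]
        is_rkhs_functional_ip[OF rkhs L(1) L(2), of k k] ip_sym[OF f] ip_sym[OF f(1) h(2), of k]
        F.ip_sym[OF L(1) L(2), of k k] by simp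
    then show ?thesis using tendsto_add[OF tendsto_add[OF 1 2] tendsto_const[of "rkhs_ip K f g"]] by simp
  qed
  then have c: "(\<lambda>k. expectation (\<lambda>\<omega>. (G (L k) \<omega>)\<^sup>2 * (G (L' k) \<omega>)\<^sup>2))
      \<longlonglongrightarrow> rkhs_ip K f f * rkhs_ip K g g + 2 * (rkhs_ip K f g)\<^sup>2"
    unfolding functional_mixed_moment(2)[OF L]
    by (intro tendsto_intros approximates_norm[OF A f(1)] approximates_norm[OF B f(2)])
  show "integrable M (\<lambda>\<omega>. (Z \<omega>)\<^sup>2 * (W \<omega>)\<^sup>2)"
    "expectation (\<lambda>\<omega>. (Z \<omega>)\<^sup>2 * (W \<omega>)\<^sup>2) \<le> rkhs_ip K f f * rkhs_ip K g g + 2 * (rkhs_ip K f g)\<^sup>2"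
    by (rule fatou_real[OF functional_mixed_moment(1)[OF L] _ l _ c]; simp)+
qed

text \<open>Norm convergence alone does not give almost sure convergence of the variables. The
  functionals are thinned out until they converge geometrically, so that the increments are almost
  surely summable.\<close>

lemma isonormal_exists:
  assumes f: "f \<in> rkhs K"
  shows "\<exists>Z. isonormal f Z"
proof -
  obtain L0 where L0: "\<And>n. L0 n \<in> finite_functionals"
    and lim: "(\<lambda>n. ip_norm (rkhs_ip K) (\<lambda>s. L0 n (K s) - f s)) \<longlonglongrightarrow> 0"
    using is_rkhs_functionals_dense[OF rkhs f] by blast
  have "\<exists>n. ip_norm (rkhs_ip K) (\<lambda>s. L0 n (K s) - f s) < (1/2)^k" for k :: nat
    using order_tendstoD(2)[OF lim, of "(1/2)^k"] by (auto simp: eventually_sequentially)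
  then obtain r where r: "\<And>k. ip_norm (rkhs_ip K) (\<lambda>s. L0 (r k) (K s) - f s) < (1/2)^k" by metis
  define L where "L k = L0 (r k)" for k
  have L: "L k \<in> finite_functionals" for k by (simp add: L_def L0)
  have Lr: "ip_norm (rkhs_ip K) (\<lambda>s. L k (K s) - f s) < (1/2)^k" for k by (simp add: L_def r)
  have h: "(\<lambda>s. L k (K s)) \<in> rkhs K" for k by (rule functional_mem[OF L])
  have nlim: "(\<lambda>k. ip_norm (rkhs_ip K) (\<lambda>s. L k (K s) - f s)) \<longlonglongrightarrow> 0"
    by (rule Lim_null_comparison[of _ "\<lambda>k. (1/2)^k"])
      (use Lr norm_nonneg[OF diff_mem[OF h f]] in \<open>auto intro!: always_eventually less_imp_le LIMSEQ_power_zero\<close>)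
  define D where "D k F = L (Suc k) F - L k F" for k F
  have D: "D k \<in> finite_functionals" for k using F.diff_mem[OF L L, of "Suc k" k] by (simp add: D_def[abs_def])
  have QD: "functional_ip K (D k) (D k) \<le> 4 * (1/4)^k" for k
  proof -
    have "ip_norm (rkhs_ip K) (\<lambda>s. L (Suc k) (K s) - L k (K s)) \<le> (1/2)^Suc k + (1/2)^k"
      using norm_triangle[OF h f h, of "Suc k" k] norm_diff_commute[OF h f, of k] Lr[of k] Lr[of "Suc k"] by simp
    also have "\<dots> \<le> 2 * (1/2)^k" by simp
    finally have "(ip_norm (rkhs_ip K) (\<lambda>s. D k (K s)))\<^sup>2 \<le> (2 * (1/2)^k)\<^sup>2"
      unfolding D_def by (intro power_mono norm_nonneg diff_mem h)
    also have "\<dots> = 4 * (1/4)^k" by (simp add: power_mult_distrib power2_eq_square flip: power_mult_distrib)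
    finally show ?thesis by (simp add: functional_norm D)
  qed
  \<comment> \<open>The weight \<open>2^k\<close> leaves expectations of order
    \<open>(1/2)^k\<close>, and \<open>\<bar>x\<bar> \<le> (1/2)^k + 2^k * x\<^sup>2\<close> then
    turns summable weighted squares into summable increments.\<close>
  have "AE \<omega> in M. summable (\<lambda>k. 2^k * (G (D k) \<omega>)\<^sup>2)"
  proof (rule AE_summable_if_expectation_summable)
    show "integrable M (\<lambda>\<omega>. 2^k * (G (D k) \<omega>)\<^sup>2)" for k using functional_moments(1)[OF D] by simp
    show "summable (\<lambda>k. expectation (\<lambda>\<omega>. 2^k * (G (D k) \<omega>)\<^sup>2))"
    proof (rule summable_comparison_test)
      show "summable (\<lambda>k. 4 * (1/2)^k :: real)" by (intro summable_mult summable_geometric) simp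
      have "2^k * functional_ip K (D k) (D k) \<le> 4 * (1/2)^k" for k
      proof -
        have "2^k * functional_ip K (D k) (D k) \<le> 2^k * (4 * (1/4)^k)" using QD by (intro mult_left_mono) auto
        also have "\<dots> = 4 * (2 * (1/4))^k" by (simp only: power_mult_distrib mult_ac)
        finally show ?thesis by simp
      qed
      then show "\<exists>N. \<forall>k\<ge>N. norm (expectation (\<lambda>\<omega>. 2^k * (G (D k) \<omega>)\<^sup>2)) \<le> 4 * (1/2)^k"
        using functional_moments(2)[OF D] F.ip_nonneg[OF D] by (auto simp: abs_mult)
    qed
  qed simp
  then have conv: "AE \<omega> in M. convergent (\<lambda>k. G (L k) \<omega>)"
  proof eventually_elim
    case (elim \<omega>)
    have "summable (\<lambda>k. G (D k) \<omega>)"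
    proof (rule summable_comparison_test)
      show "summable (\<lambda>k. (1/2)^k + 2^k * (G (D k) \<omega>)\<^sup>2)"
        by (intro summable_add elim summable_geometric) simp
      have "\<bar>x\<bar> \<le> (1/2)^k + 2^k * x\<^sup>2" for k :: nat and x :: real
      proof -
        have "\<bar>y\<bar> \<le> 1 + y\<^sup>2" for y :: real
        proof -
          have "0 \<le> (\<bar>y\<bar> - 1)\<^sup>2" by simp
          then have "2 * \<bar>y\<bar> \<le> y\<^sup>2 + 1" by (simp add: power2_diff)
          then show ?thesis using zero_le_power2[of y] by linarith
        qed
        then have "(1/2)^k * \<bar>2^k * x\<bar> \<le> (1/2)^k * (1 + (2^k * x)\<^sup>2)" by (intro mult_left_mono) auto
        moreover have "(1/2)^k * \<bar>2^k * x\<bar> = \<bar>x\<bar>" by (simp add: abs_mult power_divide)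
        moreover have "(1/2)^k * (1 + (2^k * x)\<^sup>2) = (1/2)^k + 2^k * x\<^sup>2"
          by (simp add: power_divide power_mult_distrib distrib_left add_divide_distrib power2_eq_square)
        ultimately show ?thesis by simp
      qed
      then show "\<exists>N. \<forall>k\<ge>N. norm (G (D k) \<omega>) \<le> (1/2)^k + 2^k * (G (D k) \<omega>)\<^sup>2" by auto
    qed
    then have "(\<lambda>n. G (L 0) \<omega> + (\<Sum>k<n. G (D k) \<omega>)) \<longlonglongrightarrow> G (L 0) \<omega> + (\<Sum>k. G (D k) \<omega>)"
      by (intro tendsto_intros summable_LIMSEQ)
    moreover have "G (L 0) \<omega> + (\<Sum>k<n. G (D k) \<omega>) = G (L n) \<omega>" for n
      using sum_lessThan_telescope[of "\<lambda>k. G (L k) \<omega>" n] by (simp add: G_def D_def)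
    ultimately show ?case by (auto simp: convergent_def)
  qed
  \<comment> \<open>The value of \<open>lim\<close> matters only where the sequence converges, that
    is, almost everywhere.\<close>
  define Z where "Z \<omega> = lim (\<lambda>k. G (L k) \<omega>)" for \<omega>
  have [measurable]: "G (L k) \<in> borel_measurable M" for k by (rule functional_measurable[OF L])
  have "Z \<in> borel_measurable M" unfolding Z_def by measurable
  moreover have "AE \<omega> in M. (\<lambda>k. G (L k) \<omega>) \<longlonglongrightarrow> Z \<omega>"
    using conv by eventually_elim (simp add: Z_def convergent_LIMSEQ_iff)
  ultimately show ?thesis using f L nlim unfolding isonormal_def approximates_def by blast
qed

text \<open>Orthogonality removes the cross term of the mixed moments when \<open>m\<close> and
  \<open>n\<close> differ; equal indices give 1 + 2 = 3. The error in the last two clauses is the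
  variable attached to \<open>K(_, t)\<close> minus its partial expansion, whose norm tends to
  zero.\<close>

lemma isonormal_coefficients:
  assumes onb: "orthonormal_basis K \<phi>"
  obtains Z where "\<And>n. Z n \<in> borel_measurable M"
    "\<And>n. integrable M (\<lambda>\<omega>. (Z n \<omega>)\<^sup>2)" "\<And>n. expectation (\<lambda>\<omega>. (Z n \<omega>)\<^sup>2) = 1"
    "\<And>m n. integrable M (\<lambda>\<omega>. (Z m \<omega>)\<^sup>2 * (Z n \<omega>)\<^sup>2)"
    "\<And>m n. expectation (\<lambda>\<omega>. (Z m \<omega>)\<^sup>2 * (Z n \<omega>)\<^sup>2) \<le> (if m = n then 3 else 1)"
    "\<And>N t. integrable M (\<lambda>\<omega>. (X t \<omega> - (\<Sum>n<N. Z n \<omega> * \<phi> n t))\<^sup>2)"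
    "\<And>t. (\<lambda>N. expectation (\<lambda>\<omega>. (X t \<omega> - (\<Sum>n<N. Z n \<omega> * \<phi> n t))\<^sup>2)) \<longlonglongrightarrow> 0"
proof -
  have mem: "\<phi> n \<in> rkhs K" for n by (rule basis_mem[OF rkhs onb])
  have o: "rkhs_ip K (\<phi> m) (\<phi> n) = (if m = n then 1 else 0)" for m n
    by (rule basis_orthonormal[OF rkhs onb])
  obtain Z where Z: "\<And>n. isonormal (\<phi> n) (Z n)" using isonormal_exists[OF mem] by metis
  have k: "(\<lambda>s. K s t) \<in> rkhs K" for t using rkhs by (simp add: is_rkhs_def)
  have kn: "rkhs_ip K (\<lambda>s. K s t) (\<phi> n) = \<phi> n t" for n t
    using ip_sym[OF k mem] rkhs mem by (simp add: is_rkhs_def)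
  have iso: "isonormal (\<lambda>s. K s t - (\<Sum>n<N. \<phi> n t * \<phi> n s)) (\<lambda>\<omega>. X t \<omega> - (\<Sum>n<N. Z n \<omega> * \<phi> n t))" for N t
  proof (induction N)
    case 0
    then show ?case using isonormal_functional[OF finite_functional_eval, of t] by (simp add: G_def[abs_def])
  next
    case (Suc N)
    from isonormal_comb[OF this Z, of 1 "- \<phi> N t" N] show ?case by (simp add: algebra_simps)
  qed
  have "(\<lambda>N. expectation (\<lambda>\<omega>. (X t \<omega> - (\<Sum>n<N. Z n \<omega> * \<phi> n t))\<^sup>2)) \<longlonglongrightarrow> 0" for t
  proof -
    have m: "(\<lambda>s. K s t - (\<Sum>n<N. \<phi> n t * \<phi> n s)) \<in> rkhs K" for N
      by (intro diff_mem k sum_mem mem)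
    have "(\<lambda>N. rkhs_norm K (\<lambda>s. K s t - (\<Sum>n<N. \<phi> n t * \<phi> n s))) \<longlonglongrightarrow> 0"
      using onb k[of t] unfolding orthonormal_basis_def by (auto simp: kn)
    then have "(\<lambda>N. (rkhs_norm K (\<lambda>s. K s t - (\<Sum>n<N. \<phi> n t * \<phi> n s)))\<^sup>2) \<longlonglongrightarrow> 0\<^sup>2"
      by (rule tendsto_power)
    then show ?thesis by (simp add: isonormal_square[OF iso] rkhs_norm_def norm_square[OF m])
  qed
  moreover have "expectation (\<lambda>\<omega>. (Z m \<omega>)\<^sup>2 * (Z n \<omega>)\<^sup>2) \<le> (if m = n then 3 else 1)" for m n
    using isonormal_mixed_moment(2)[OF Z Z, of m n] by (cases "m = n") (simp_all add: o)
  moreover have "Z n \<in> borel_measurable M" for n using Z by (simp add: isonormal_def)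
  moreover have "expectation (\<lambda>\<omega>. (Z n \<omega>)\<^sup>2) = 1" for n using isonormal_square[OF Z] by (simp add: o)
  ultimately show thesis
    using that isonormal_bound(1)[OF Z] isonormal_bound(1)[OF iso] isonormal_mixed_moment(1)[OF Z Z] by blast
qed

text \<open>The partial sums converge to \<open>X t\<close> in mean square and, by assumption,
  almost surely to the sum of the series. Fatou's lemma shows that the two limits agree.\<close>

lemma AE_expansion:
  assumes [measurable]: "\<And>n. Z n \<in> borel_measurable M"
    and i: "\<And>N. integrable M (\<lambda>\<omega>. (X t \<omega> - (\<Sum>n<N. Z n \<omega> * \<phi> n t))\<^sup>2)"
    and l: "(\<lambda>N. expectation (\<lambda>\<omega>. (X t \<omega> - (\<Sum>n<N. Z n \<omega> * \<phi> n t))\<^sup>2)) \<longlonglongrightarrow> 0"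
    and s: "AE \<omega> in M. summable (\<lambda>n. Z n \<omega> * \<phi> n t)"
  shows "AE \<omega> in M. (\<lambda>n. Z n \<omega> * \<phi> n t) sums X t \<omega>"
proof -
  let ?G = "\<lambda>\<omega>. (X t \<omega> - (\<Sum>n. Z n \<omega> * \<phi> n t))\<^sup>2"
  have L: "AE \<omega> in M. (\<lambda>N. (X t \<omega> - (\<Sum>n<N. Z n \<omega> * \<phi> n t))\<^sup>2) \<longlonglongrightarrow> ?G \<omega>"
    using s by eventually_elim (intro tendsto_intros summable_LIMSEQ)
  have G: "?G \<in> borel_measurable M" by measurable
  note f = fatou_real[OF i _ L G l]
  have iG: "integrable M ?G" by (rule f(1)) simp
  have "expectation ?G \<le> 0" by (rule f(2)) simp
  then have "expectation ?G = 0" by (intro antisym) simp_all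
  then have "AE \<omega> in M. ?G \<omega> = 0" using integral_nonneg_eq_0_iff_AE[OF iG] by simp
  with s show ?thesis by eventually_elim (simp add: sums_iff)
qed

end

section \<open>The path law\<close>

lemma space_product_borel: "space (Pi\<^sub>M UNIV (\<lambda>_. borel :: real measure)) = UNIV"
  by (simp add: space_PiM PiE_def)

lemma space_process_law [simp]: "space (process_law M X) = UNIV"
  by (simp add: process_law_def space_product_borel)

lemma sets_process_law [measurable_cong]: "sets (process_law M X) = sets (Pi\<^sub>M UNIV (\<lambda>_. borel))"
  by (simp add: process_law_def)

lemma path_measurable:
  assumes "\<And>t. X t \<in> borel_measurable M"
  shows "(\<lambda>\<omega> t. X t \<omega>) \<in> M \<rightarrow>\<^sub>M Pi\<^sub>M UNIV (\<lambda>_. borel)"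
  using assms by (intro measurable_PiM_single') auto

lemma eval_measurable_product: "(\<lambda>f. f t) \<in> borel_measurable (Pi\<^sub>M UNIV (\<lambda>_. borel))"
  by (rule measurable_component_singleton) simp

lemma gaussian_rv_distr:
  assumes T: "T \<in> M \<rightarrow>\<^sub>M N" and Y: "Y \<in> borel_measurable N" and g: "gaussian_rv M (\<lambda>\<omega>. Y (T \<omega>))"
  shows "gaussian_rv (distr M N T) Y"
proof -
  have Y': "Y \<in> borel_measurable (distr M N T)" using Y by simp
  from g consider m where "AE \<omega> in M. Y (T \<omega>) = m"
    | m \<sigma> where "\<sigma> > 0" "distributed M lborel (\<lambda>\<omega>. Y (T \<omega>)) (normal_density m \<sigma>)" by (auto simp: gaussian_rv_def)
  then show ?thesis
  proof cases
    case 1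
    have "AE f in distr M N T. Y f = m"
      using 1 Y by (subst AE_distr_iff[OF T]) measurable
    then show ?thesis using Y' by (auto simp: gaussian_rv_def)
  next
    case 2
    have "distr (distr M N T) lborel Y = distr M lborel (\<lambda>\<omega>. Y (T \<omega>))"
      using Y T by (subst distr_distr) (auto simp: comp_def)
    then have "distributed (distr M N T) lborel Y (normal_density m \<sigma>)"
      using 2(2) Y by (simp add: distributed_def)
    then show ?thesis using Y' 2(1) by (auto simp: gaussian_rv_def)
  qed
qed

text \<open>On the product space the coefficients become functions of the path itself, so events
  about them can be compared with membership of the path in an RKHS.\<close>

lemma canonical_process:
  fixes X :: "'t \<Rightarrow> 'w \<Rightarrow> real"
  assumes "centred_gaussian_process M X K"
  shows "centred_gaussian_process (process_law M X) (\<lambda>t f. f t) K"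
proof -
  have X: "X t \<in> borel_measurable M" for t using assms by (simp add: centred_gaussian_process_def)
  note T = path_measurable[OF X]
  interpret prob_space M using assms by (simp add: centred_gaussian_process_def)
  note e [measurable] = eval_measurable_product
  show ?thesis
    unfolding centred_gaussian_process_def
  proof (intro conjI allI)
    show "prob_space (process_law M X)" unfolding process_law_def by (rule prob_space_distr[OF T])
    show "(\<lambda>f. f t) \<in> borel_measurable (process_law M X)" for t :: 't unfolding process_law_def by simp
    show "gaussian_rv (process_law M X) (\<lambda>f. \<Sum>i<N. a i * f (t i))" for N :: nat and a and t :: "nat \<Rightarrow> 't"
      unfolding process_law_def
      by (rule gaussian_rv_distr[OF T]) (use assms in \<open>auto simp: centred_gaussian_process_def\<close>)
    show "(\<integral>f. f t \<partial>process_law M X) = 0" for t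
      unfolding process_law_def using assms by (subst integral_distr[OF T]) (auto simp: centred_gaussian_process_def)
    show "(\<integral>f. f t * f t' \<partial>process_law M X) = K t t'" for t t'
      unfolding process_law_def using assms by (subst integral_distr[OF T]) (auto simp: centred_gaussian_process_def)
  qed
qed

context
  fixes M :: "'w measure" and X :: "'t::topological_space \<Rightarrow> 'w \<Rightarrow> real"
  assumes X: "\<And>t. X t \<in> borel_measurable M" and paths: "continuous_paths M X"
begin

text \<open>The preimage of a set from the completed law is in general measurable only for the
  completion of \<open>M\<close>, hence the completion on both sides.\<close>

lemma completion_process_law:
  "completion (process_law M X) = distr (completion M) (completion (process_law M X)) (\<lambda>\<omega> t. X t \<omega>)"
proof -
  have T: "(\<lambda>\<omega> t. X t \<omega>) \<in> M \<rightarrow>\<^sub>M process_law M X"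
    using path_measurable[OF X] by (simp add: process_law_def)
  have "distr (completion M) (process_law M X) (\<lambda>\<omega> t. X t \<omega>) = process_law M X"
    by (subst distr_completion[OF T], subst (2) process_law_def, rule distr_cong) (auto simp: process_law_def)
  then show ?thesis
    using completion.completion_distr_eq[OF measurable_completion[OF T]] by simp
qed

lemma path_measurable_completion:
  "(\<lambda>\<omega> t. X t \<omega>) \<in> completion M \<rightarrow>\<^sub>M completion (process_law M X)"
proof -
  have T: "(\<lambda>\<omega> t. X t \<omega>) \<in> M \<rightarrow>\<^sub>M process_law M X"
    using path_measurable[OF X] by (simp add: process_law_def)
  have "distr (completion M) (process_law M X) (\<lambda>\<omega> t. X t \<omega>) = process_law M X"
    by (subst distr_completion[OF T], subst (2) process_law_def, rule distr_cong) (auto simp: process_law_def)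
  then show ?thesis
    using completion.measurable_completion2[OF measurable_completion[OF T]] by simp
qed

text \<open>All paths lie in \<open>C(T)\<close>, so the measure of \<open>C(T) \<inter> H\<close> can be read off as the probability
  that the path lies in that set.\<close>

lemma emeasure_completion_process_law:
  assumes "H \<in> sets (completion (process_law M X))"
  shows "emeasure (completion (process_law M X)) H =
    emeasure (completion M) ((\<lambda>\<omega> t. X t \<omega>) -` (continuous_functions \<inter> H) \<inter> space M)"
proof -
  have "(\<lambda>\<omega> t. X t \<omega>) -` (continuous_functions \<inter> H) \<inter> space M = (\<lambda>\<omega> t. X t \<omega>) -` H \<inter> space M"
    using paths by (auto simp: continuous_paths_def continuous_functions_def)
  then show ?thesis
    by (subst completion_process_law) (simp add: emeasure_distr[OF path_measurable_completion assms])
qed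

text \<open>The sets and the space of \<open>restrict_space\<close> form the trace on
  \<open>C(T)\<close>, and are taken from there as a sigma-algebra.\<close>

lemma sigma_algebra_paths:
  "sigma_algebra continuous_functions {continuous_functions \<inter> H | H. H \<in> sets (completion (process_law M X))}"
proof -
  have "sets (restrict_space (completion (process_law M X)) continuous_functions) =
     {continuous_functions \<inter> H | H. H \<in> sets (completion (process_law M X))}"
    by (auto simp: sets_restrict_space)
  moreover have "space (restrict_space (completion (process_law M X)) continuous_functions) = continuous_functions"
    by (simp add: space_restrict_space)
  ultimately show ?thesis
    using sets.sigma_algebra_axioms[of "restrict_space (completion (process_law M X)) continuous_functions"] by simp
qed

lemma sets_path_law:
  "sets (path_law M X) = {continuous_functions \<inter> H | H. H \<in> sets (completion (process_law M X))}"
  unfolding path_law_def by (rule sigma_algebra.sets_measure_of_eq[OF sigma_algebra_paths])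

lemma space_path_law: "space (path_law M X) = continuous_functions"
  unfolding path_law_def by (rule sigma_algebra.space_measure_of_eq[OF sigma_algebra_paths])

text \<open>\<open>measure_of\<close> returns the prescribed values only if these are countably
  additive. The value chosen by \<open>THE\<close> equals the completed probability of the preimage,
  whichever representing set is taken, and additivity is inherited from there.\<close>

lemma emeasure_path_law:
  assumes H: "H \<in> sets (completion (process_law M X))"
  shows "emeasure (path_law M X) (continuous_functions \<inter> H) = emeasure (completion (process_law M X)) H"
proof -
  let ?N = "completion (process_law M X)" and ?T = "\<lambda>\<omega> t. X t \<omega>"
  let ?A = "{continuous_functions \<inter> H | H. H \<in> sets ?N}"
  let ?p = "\<lambda>B. THE p. \<exists>H\<in>sets ?N. B = continuous_functions \<inter> H \<and> p = emeasure ?N H"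
  have p: "?p B = emeasure (completion M) (?T -` B \<inter> space M)" if B: "B \<in> ?A" for B
  proof -
    obtain H where H: "H \<in> sets ?N" "B = continuous_functions \<inter> H" using B by blast
    show ?thesis
    proof (rule the_equality)
      show "\<exists>H\<in>sets ?N. B = continuous_functions \<inter> H \<and> emeasure (completion M) (?T -` B \<inter> space M) = emeasure ?N H"
        by (rule bexI[OF _ H(1)]) (simp add: H(2) emeasure_completion_process_law[OF H(1)])
      fix p assume "\<exists>H\<in>sets ?N. B = continuous_functions \<inter> H \<and> p = emeasure ?N H"
      then obtain H' where H': "H' \<in> sets ?N" "B = continuous_functions \<inter> H'" "p = emeasure ?N H'" by blast
      then show "p = emeasure (completion M) (?T -` B \<inter> space M)"
        by (simp only: emeasure_completion_process_law[OF H'(1)])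
    qed
  qed
  have m: "?T -` B \<inter> space M \<in> sets (completion M)" if B: "B \<in> ?A" for B
  proof -
    obtain H where H: "H \<in> sets ?N" "B = continuous_functions \<inter> H" using B by blast
    have "?T -` B \<inter> space M = ?T -` H \<inter> space M"
      using paths H(2) by (auto simp: continuous_paths_def continuous_functions_def)
    then show ?thesis using measurable_sets[OF path_measurable_completion H(1)] by simp
  qed
  have "emeasure (path_law M X) (continuous_functions \<inter> H) = ?p (continuous_functions \<inter> H)"
    unfolding path_law_def
  proof (rule emeasure_measure_of_sigma[OF sigma_algebra_paths])
    have "{} \<in> ?A" by (auto intro!: exI[of _ "{}"])
    from p[OF this] show "positive ?A ?p" unfolding positive_def by (simp only:) simp
    show "countably_additive ?A ?p"
    proof (rule countably_additiveI)
      fix B :: "nat \<Rightarrow> _" assume B: "range B \<subseteq> ?A" "disjoint_family B" "(\<Union>i. B i) \<in> ?A"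
      have Bi: "B i \<in> ?A" for i using B(1) by blast
      have "(\<Sum>i. emeasure (completion M) (?T -` B i \<inter> space M))
         = emeasure (completion M) (\<Union>i. ?T -` B i \<inter> space M)"
        by (rule suminf_emeasure) (use B(2) in \<open>auto simp: disjoint_family_on_def image_subset_iff intro!: m[OF Bi]\<close>)
      also have "(\<Union>i. ?T -` B i \<inter> space M) = ?T -` (\<Union>i. B i) \<inter> space M" by auto
      finally show "(\<Sum>i. ?p (B i)) = ?p (\<Union>i. B i)" by (simp only: p[OF Bi] p[OF B(3)])
    qed
  qed (use H in blast)
  also have "\<dots> = emeasure ?N H"
    unfolding emeasure_completion_process_law[OF H] by (rule p) (use H in blast)
  finally show ?thesis .
qed

text \<open>The set \<open>S\<close> itself may be non-measurable for the completed law. It is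
  represented by \<open>?H\<close>, its union with the discontinuous functions, which is conull and
  therefore belongs to the completion.\<close>

lemma path_law_almost_all:
  assumes M: "prob_space M" and S: "S \<subseteq> continuous_functions"
    and ae: "AE f in process_law M X. f \<in> continuous_functions \<longrightarrow> f \<in> S"
  shows "S \<in> sets (path_law M X)" "emeasure (path_law M X) S = 1"
proof -
  let ?N = "process_law M X" and ?H = "{f. f \<in> continuous_functions \<longrightarrow> f \<in> S}"
  have e: "continuous_functions \<inter> ?H = S" using S by auto
  interpret prob_space ?N unfolding process_law_def
    by (rule prob_space.prob_space_distr[OF M path_measurable[OF X]])
  have ae': "AE f in completion ?N. f \<in> ?H" using AE_completion[OF ae] by simp
  have "AE f in ?N. \<not> (f \<notin> ?H)" using ae by simp
  from sets_completion_AE[OF this] have "- ?H \<in> sets (completion ?N)"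
    by (simp add: pred_def Compl_eq)
  from sets.compl_sets[OF this] have H: "?H \<in> sets (completion ?N)" by (simp add: double_diff Diff_eq)
  show "S \<in> sets (path_law M X)" unfolding sets_path_law using H e by blast
  have "emeasure (completion ?N) ?H = emeasure (completion ?N) UNIV"
    by (rule emeasure_eq_AE) (use ae' H sets.top[of "completion ?N"] in auto)
  also have "\<dots> = 1" using emeasure_space_1 sets.top[of ?N] by simp
  finally show "emeasure (path_law M X) S = 1" using emeasure_path_law[OF H] e by simp
qed

end

section \<open>The zero-one law for scaled spaces\<close>

text \<open>The scaling \<alpha> with summable reciprocals makes the random series converge at every
  point to a continuous function, which can then be identified with the path; \<beta> is the scaling
  under test.\<close>

lemma AE_path_in_scaled_rkhs_iff:
  fixes M :: "'w measure" and X :: "'t::second_countable_topology \<Rightarrow> 'w \<Rightarrow> real"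
  assumes K: "continuous_kernel K" "pos_semidef_kernel K" and process: "centred_gaussian_process M X K"
    and basis: "orthonormal_basis K \<phi>" and onb: "scaled_bases_orthonormal \<phi>"
    and \<alpha>: "\<alpha> \<in> continuous_scalings \<phi>" "summable (\<lambda>n. inverse (\<alpha> n))"
    and \<beta>: "\<beta> \<in> continuous_scalings \<phi>"
  shows "AE f in process_law M X. f \<in> continuous_functions \<longrightarrow>
    (f \<in> rkhs (scaled_kernel \<phi> \<beta>) \<longleftrightarrow> summable (\<lambda>n. inverse (\<beta> n)))"
proof -
  let ?N = "process_law M X"
  have canon: "centred_gaussian_process ?N (\<lambda>t f. f t) K" by (rule canonical_process[OF process])
  interpret gaussian_rkhs ?N "\<lambda>t f. f t" K
    using canon K(2) by (auto simp: gaussian_rkhs_def gaussian_rkhs_axioms_def centred_gaussian_process_def)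
  obtain Z where Z: "\<And>n. Z n \<in> borel_measurable ?N"
    and Z2: "\<And>n. integrable ?N (\<lambda>f. (Z n f)\<^sup>2)" "\<And>n. expectation (\<lambda>f. (Z n f)\<^sup>2) = 1"
    and Z4: "\<And>m n. integrable ?N (\<lambda>f. (Z m f)\<^sup>2 * (Z n f)\<^sup>2)"
      "\<And>m n. expectation (\<lambda>f. (Z m f)\<^sup>2 * (Z n f)\<^sup>2) \<le> (if m = n then 3 else 1)"
    and ZX: "\<And>N t. integrable ?N (\<lambda>f. (f t - (\<Sum>n<N. Z n f * \<phi> n t))\<^sup>2)"
      "\<And>t. (\<lambda>N. expectation (\<lambda>f. (f t - (\<Sum>n<N. Z n f * \<phi> n t))\<^sup>2)) \<longlonglongrightarrow> 0"
    using isonormal_coefficients[OF basis] by blast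
  have pos: "\<alpha> n > 0" "\<beta> n > 0" for n using \<alpha>(1) \<beta> by (auto simp: continuous_scalings_def is_scaling_def)
  have s\<alpha>: "summable (\<lambda>n. \<alpha> n * (\<phi> n t)\<^sup>2)" for t using \<alpha>(1) by (simp add: continuous_scalings_def is_scaling_def)
  have sum: "AE f in ?N. summable (\<lambda>n. inverse (\<alpha> n) * (Z n f)\<^sup>2)"
    by (rule AE_weighted_squares_summable[OF Z2 _ \<alpha>(2)]) (simp add: pos less_imp_le)
  have dich: "AE f in ?N. summable (\<lambda>n. inverse (\<beta> n) * (Z n f)\<^sup>2) \<longleftrightarrow> summable (\<lambda>n. inverse (\<beta> n))"
  proof (cases "summable (\<lambda>n. inverse (\<beta> n))")
    case True
    then have "AE f in ?N. summable (\<lambda>n. inverse (\<beta> n) * (Z n f)\<^sup>2)"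
      by (intro AE_weighted_squares_summable[OF Z2]) (simp_all add: pos less_imp_le)
    then show ?thesis by (simp add: True)
  next
    case False
    then have "AE f in ?N. \<not> summable (\<lambda>n. inverse (\<beta> n) * (Z n f)\<^sup>2)"
      by (intro AE_weighted_squares_not_summable[OF Z Z2 Z4]) (simp_all add: pos less_imp_le)
    then show ?thesis by (simp add: False)
  qed
  \<comment> \<open>The arithmetic-geometric mean inequality, weighted by \<alpha>, gives
    convergence at all \<open>t\<close> outside a single null set.\<close>
  have conv: "summable (\<lambda>n. z n * \<phi> n t)" if z: "summable (\<lambda>n. inverse (\<alpha> n) * (z n)\<^sup>2)" for z t
  proof (rule summable_comparison_test)
    show "summable (\<lambda>n. (inverse (\<alpha> n) * (z n)\<^sup>2 + \<alpha> n * (\<phi> n t)\<^sup>2) / 2)"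
      by (intro summable_divide summable_add z s\<alpha>)
    have "\<bar>x * y\<bar> \<le> (inverse a * x\<^sup>2 + a * y\<^sup>2) / 2" if a: "a > 0" for a x y :: real
    proof -
      have "0 \<le> inverse a * (\<bar>x\<bar> - a * \<bar>y\<bar>)\<^sup>2" using a by simp
      also have "\<dots> = inverse a * x\<^sup>2 + a * y\<^sup>2 - 2 * \<bar>x * y\<bar>"
        using a by (simp add: power2_diff abs_mult field_simps power2_eq_square)
      finally show ?thesis by simp
    qed
    then show "\<exists>N. \<forall>n\<ge>N. norm (z n * \<phi> n t) \<le> (inverse (\<alpha> n) * (z n)\<^sup>2 + \<alpha> n * (\<phi> n t)\<^sup>2) / 2"
      using pos(1) by auto
  qed
  \<comment> \<open>The exceptional null set of the expansion depends on \<open>t\<close>, so it can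
    be removed simultaneously only for countably many points.\<close>
  obtain D :: "'t set" where D: "countable D" and dense: "\<And>U. open U \<Longrightarrow> U \<noteq> {} \<Longrightarrow> \<exists>d\<in>D. d \<in> U"
    using countable_dense_setE by blast
  have "AE f in ?N. (\<lambda>n. Z n f * \<phi> n t) sums f t" for t
  proof (rule AE_expansion[OF Z ZX])
    show "AE f in ?N. summable (\<lambda>n. Z n f * \<phi> n t)" using sum by eventually_elim (rule conv)
  qed
  then have "AE f in ?N. \<forall>t\<in>D. (\<lambda>n. Z n f * \<phi> n t) sums f t"
    using D by (simp add: AE_ball_countable)
  with sum dich show ?thesis
  proof eventually_elim
    case (elim f)
    show ?case
    proof
      assume f: "f \<in> continuous_functions"
      have sz: "summable (\<lambda>n. (Z n f)\<^sup>2 / \<alpha> n)" using elim(1) by (simp add: divide_inverse mult.commute)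
      let ?g = "\<lambda>t. \<Sum>n. Z n f * \<phi> n t"
      have g: "(\<lambda>n. Z n f * \<phi> n t) sums ?g t" for t
        by (rule summable_sums[OF conv[OF elim(1)]])
      have "?g \<in> rkhs (scaled_kernel \<phi> \<alpha>)" by (rule scaled_rkhs_synthesis(1)[OF onb \<alpha>(1) sz g])
      then have gc: "continuous_on UNIV ?g"
        using \<alpha>(1) is_rkhs_continuous[OF scaled_kernel_is_rkhs] by (auto simp: continuous_scalings_def)
      have "f = ?g"
      proof (rule ccontr)
        assume "f \<noteq> ?g"
        then have "{t. f t \<noteq> ?g t} \<noteq> {}" by auto
        moreover have "open {t. f t \<noteq> ?g t}"
          using f gc by (intro open_Collect_neq) (auto simp: continuous_functions_def)
        ultimately obtain d where "d \<in> D" "f d \<noteq> ?g d" using dense by blast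
        then show False using elim(3) g sums_unique2 by blast
      qed
      then have fs: "(\<lambda>n. Z n f * \<phi> n t) sums f t" for t using g by metis
      have "f \<in> rkhs (scaled_kernel \<phi> \<beta>) \<longleftrightarrow> summable (\<lambda>n. (Z n f)\<^sup>2 / \<beta> n)"
      proof
        assume "f \<in> rkhs (scaled_kernel \<phi> \<beta>)"
        then obtain d where d: "summable (\<lambda>n. (d n)\<^sup>2 / \<beta> n)" "\<And>t. (\<lambda>n. d n * \<phi> n t) sums f t"
          using scaled_rkhs_expansion[OF onb \<beta>] by blast
        have "(\<lambda>n. Z n f) = d" by (rule scaled_coefficients_unique[OF onb \<alpha>(1) sz fs \<beta> d])
        then show "summable (\<lambda>n. (Z n f)\<^sup>2 / \<beta> n)" using d(1) by auto
      next
        assume "summable (\<lambda>n. (Z n f)\<^sup>2 / \<beta> n)"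
        then show "f \<in> rkhs (scaled_kernel \<phi> \<beta>)" by (rule scaled_rkhs_synthesis(1)[OF onb \<beta> _ fs])
      qed
      then show "f \<in> rkhs (scaled_kernel \<phi> \<beta>) \<longleftrightarrow> summable (\<lambda>n. inverse (\<beta> n))"
        using elim(2) by (simp add: divide_inverse mult.commute)
    qed
  qed
qed

section \<open>Sequences concentrated on a subsequence and extended-real bounds\<close>

lemma strict_mono_subsequence:
  assumes "\<And>k m :: nat. \<exists>n>m. P k n"
  obtains r :: "nat \<Rightarrow> nat" where "strict_mono r" "\<And>k. P k (r k)"
proof -
  have "\<exists>r. \<forall>k. P k (r k) \<and> r k < r (Suc k)"
  proof (rule dependent_nat_choice)
    show "\<exists>n. P 0 n" using assms by blast
    show "\<exists>y. P (Suc k) y \<and> x < y" for x k using assms by blast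
  qed
  then show thesis using that by (auto simp: strict_mono_Suc_iff)
qed

text \<open>For test sequences supported on a subsequence: \<open>inv r n\<close> is the position of
  \<open>n\<close> in it, and the zeros in between do not affect summability.\<close>

lemma summable_spread:
  fixes b :: "nat \<Rightarrow> real"
  assumes r: "strict_mono r"
  shows "summable (\<lambda>n. if n \<in> range r then b (inv r n) * c n else 0) \<longleftrightarrow> summable (\<lambda>k. b k * c (r k))"
proof -
  have "inj r" using r strict_mono_imp_inj_on by blast
  then show ?thesis
    using summable_mono_reindex[OF r, of "\<lambda>n. if n \<in> range r then b (inv r n) * c n else 0"]
    by (simp add: inv_f_f)
qed

lemma liminf_sup_iff:
  fixes c :: "nat \<Rightarrow> real"
  shows "liminf (\<lambda>n. ereal (c n)) > 0 \<longleftrightarrow> (\<exists>\<delta>>0. \<forall>\<^sub>F n in sequentially. \<delta> \<le> c n)"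
    and "(SUP n. ereal (c n)) < \<infinity> \<longleftrightarrow> (\<exists>B. \<forall>n. c n \<le> B)"
proof
  assume "liminf (\<lambda>n. ereal (c n)) > 0"
  then obtain d where d: "0 < d" "d < liminf (\<lambda>n. ereal (c n))" using dense by blast
  then obtain x where x: "d = ereal x" by (cases d) auto
  have "\<forall>\<^sub>F n in sequentially. d < ereal (c n)" by (rule less_LiminfD[OF d(2)])
  then have "\<forall>\<^sub>F n in sequentially. x \<le> c n" by eventually_elim (simp add: x)
  then show "\<exists>\<delta>>0. \<forall>\<^sub>F n in sequentially. \<delta> \<le> c n" using d(1) x by auto
next
  assume "\<exists>\<delta>>0. \<forall>\<^sub>F n in sequentially. \<delta> \<le> c n"
  then obtain \<delta> where \<delta>: "\<delta> > 0" "\<forall>\<^sub>F n in sequentially. \<delta> \<le> c n" by auto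
  have "ereal \<delta> \<le> liminf (\<lambda>n. ereal (c n))"
    by (rule Liminf_bounded) (use \<delta>(2) in simp)
  then show "liminf (\<lambda>n. ereal (c n)) > 0" using \<delta>(1) by (meson ereal_less(2) less_le_trans)
next
  show "(SUP n. ereal (c n)) < \<infinity> \<longleftrightarrow> (\<exists>B. \<forall>n. c n \<le> B)"
  proof
    assume l: "(SUP n. ereal (c n)) < \<infinity>"
    then obtain B where B: "(SUP n. ereal (c n)) < ereal B" using less_PInf_Ex_of_nat by auto
    have "c n \<le> B" for n
      using B SUP_upper[of n UNIV "\<lambda>n. ereal (c n)"] by (meson UNIV_I ereal_less_eq(3) le_less_trans less_imp_le)
    then show "\<exists>B. \<forall>n. c n \<le> B" by blast
  next
    assume "\<exists>B. \<forall>n. c n \<le> B"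
    then obtain B where "\<And>n. c n \<le> B" by auto
    then have "(SUP n. ereal (c n)) \<le> ereal B" by (intro SUP_least) simp
    then show "(SUP n. ereal (c n)) < \<infinity>" by (rule le_less_trans) simp
  qed
qed

section \<open>The sample support set\<close>

text \<open>For an unbounded \<open>d\<close>, weights \<open>(1/2)^k\<close> at places where
  \<open>d\<close> is at least \<open>2^k\<close> are summable, while the products stay at least 1
  there.\<close>

lemma bounded_if_summable_products:
  fixes d :: "nat \<Rightarrow> real"
  assumes "\<And>a :: nat \<Rightarrow> real. (\<And>n. 0 \<le> a n) \<Longrightarrow> summable a \<Longrightarrow> summable (\<lambda>n. a n * d n)"
  shows "\<exists>B. \<forall>n. d n \<le> B"
proof (rule ccontr)
  assume unb: "\<nexists>B. \<forall>n. d n \<le> B"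
  have "\<exists>n>m. 2^k \<le> d n" for k m :: nat
  proof (rule ccontr)
    assume "\<not> (\<exists>n>m. 2^k \<le> d n)"
    then have "d n \<le> max (2^k) (Max (d ` {..m}))" for n
      by (cases "n \<le> m") (auto simp: not_le le_max_iff_disj intro: less_imp_le)
    then show False using unb by blast
  qed
  then obtain r where r: "strict_mono r" "\<And>k. 2^k \<le> d (r k)"
    using strict_mono_subsequence[of "\<lambda>k n. 2^k \<le> d n"] by blast
  define a where "a n = (if n \<in> range r then (1/2)^(inv r n) else 0 :: real)" for n
  have a: "a = (\<lambda>n. if n \<in> range r then (1/2)^(inv r n) * 1 else 0)" by (auto simp: a_def)
  have "summable a"
    unfolding a summable_spread[OF r(1), of "\<lambda>k. (1/2)^k" "\<lambda>_. 1"]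
    using summable_geometric[of "1/2 :: real"] by simp
  have "0 \<le> a n" for n by (simp add: a_def)
  from assms[OF this \<open>summable a\<close>] have "summable (\<lambda>n. a n * d n)" .
  moreover have "(\<lambda>n. a n * d n) = (\<lambda>n. if n \<in> range r then (1/2)^(inv r n) * d n else 0)"
    by (auto simp: a_def)
  ultimately have "summable (\<lambda>k. (1/2)^k * d (r k))"
    using summable_spread[OF r(1), of "\<lambda>k. (1/2)^k" d] by simp
  then have "(\<lambda>k. (1/2)^k * d (r k)) \<longlonglongrightarrow> 0" by (rule summable_LIMSEQ_zero)
  moreover have "1 \<le> (1/2)^k * d (r k)" for k
    using r(2)[of k] by (simp add: power_divide)
  ultimately show False using LIMSEQ_le_const[of _ "0::real" 1] by fastforce
qed

text \<open>Dually, if \<open>d\<close> comes close to zero infinitely often, weights 1 at places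
  where \<open>d\<close> is below \<open>(1/2)^k\<close> have summable products but are not
  summable.\<close>

lemma eventually_bounded_below_if_summable_products:
  fixes d :: "nat \<Rightarrow> real"
  assumes d: "\<And>n. 0 \<le> d n"
    and s: "\<And>a :: nat \<Rightarrow> real. (\<And>n. 0 \<le> a n) \<Longrightarrow> summable (\<lambda>n. a n * d n) \<Longrightarrow> summable a"
  shows "\<exists>\<delta>>0. \<forall>\<^sub>F n in sequentially. \<delta> \<le> d n"
proof (rule ccontr)
  assume *: "\<not> (\<exists>\<delta>>0. \<forall>\<^sub>F n in sequentially. \<delta> \<le> d n)"
  have "\<exists>n>m. d n < (1/2)^k" for k m :: nat
  proof (rule ccontr)
    assume "\<not> (\<exists>n>m. d n < (1/2)^k)"
    then have "(1/2)^k \<le> d n" if n: "m < n" for n using n not_less by blast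
    then have "\<forall>\<^sub>F n in sequentially. (1/2)^k \<le> d n"
      by (rule eventually_mono[OF eventually_gt_at_top])
    moreover have "(0::real) < (1/2)^k" by simp
    ultimately show False using * by blast
  qed
  then obtain r where r: "strict_mono r" "\<And>k. d (r k) < (1/2)^k"
    using strict_mono_subsequence[of "\<lambda>k n. d n < (1/2)^k"] by blast
  define a where "a n = (if n \<in> range r then 1 else 0 :: real)" for n
  have "summable (\<lambda>k. d (r k))"
    by (rule summable_comparison_test[of _ "\<lambda>k. (1/2)^k"])
      (use r(2) d in \<open>auto intro!: exI[of _ 0] less_imp_le summable_geometric\<close>)
  then have "summable (\<lambda>n. if n \<in> range r then 1 * d n else 0)"
    using summable_spread[OF r(1), of "\<lambda>_. 1" d] by simp
  moreover have "(\<lambda>n. if n \<in> range r then 1 * d n else 0) = (\<lambda>n. a n * d n)" by (auto simp: a_def)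
  ultimately have ad: "summable (\<lambda>n. a n * d n)" by simp
  have "0 \<le> a n" for n by (simp add: a_def)
  from s[OF this ad] have "summable a" .
  then have "summable (\<lambda>k::nat. 1::real)"
    using summable_spread[OF r(1), of "\<lambda>_. 1" "\<lambda>_. 1"] by (simp add: a_def[abs_def] cong: if_cong)
  from summable_LIMSEQ_zero[OF this] show False by (simp add: LIMSEQ_const_iff)
qed

text \<open>Perturbing the reciprocal makes the new scaling smaller, hence continuous, for every
  non-negative \<open>a\<close>. If 1/\<alpha> is summable, summability of the new reciprocal is
  that of \<open>a\<close>.\<close>

lemma continuous_scalings_perturb:
  fixes \<phi> :: "nat \<Rightarrow> 't::topological_space \<Rightarrow> real"
  assumes \<alpha>: "\<alpha> \<in> continuous_scalings \<phi>" and a: "\<And>n. 0 \<le> a n" and \<phi>: "\<And>n. continuous_on UNIV (\<phi> n)"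
  shows "(\<lambda>n. inverse (inverse (\<alpha> n) + a n)) \<in> continuous_scalings \<phi>"
proof (rule continuous_scalings_mono[OF \<alpha> _ _ \<phi>])
  fix n
  have pos: "0 < \<alpha> n" using \<alpha> by (auto simp: continuous_scalings_def is_scaling_def)
  then show "0 < inverse (inverse (\<alpha> n) + a n)" using a[of n] by (simp add: add_pos_nonneg)
  show "inverse (inverse (\<alpha> n) + a n) \<le> \<alpha> n"
    using le_imp_inverse_le[of "inverse (\<alpha> n)" "inverse (\<alpha> n) + a n"] pos a[of n] by simp
qed

section \<open>Membership in the atom in terms of coefficients\<close>

context
  fixes \<phi> :: "nat \<Rightarrow> 't::topological_space \<Rightarrow> real" and \<alpha> :: "nat \<Rightarrow> real"
  assumes onb: "scaled_bases_orthonormal \<phi>" and \<alpha>: "\<alpha> \<in> continuous_scalings \<phi>"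
    and s\<alpha>: "summable (\<lambda>n. inverse (\<alpha> n))" and \<phi>: "\<And>n. continuous_on UNIV (\<phi> n)"
begin

lemma scaled_rkhs_iff_coefficients:
  assumes \<beta>: "\<beta> \<in> continuous_scalings \<phi>"
    and c: "summable (\<lambda>n. inverse (\<alpha> n) * (c n)\<^sup>2)" "\<And>t. (\<lambda>n. c n * \<phi> n t) sums f t"
  shows "f \<in> rkhs (scaled_kernel \<phi> \<beta>) \<longleftrightarrow> summable (\<lambda>n. inverse (\<beta> n) * (c n)\<^sup>2)"
proof -
  have c': "summable (\<lambda>n. (c n)\<^sup>2 / \<alpha> n)" using c(1) by (simp add: divide_inverse mult.commute)
  have "f \<in> rkhs (scaled_kernel \<phi> \<beta>) \<longleftrightarrow> summable (\<lambda>n. (c n)\<^sup>2 / \<beta> n)"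
  proof
    assume "f \<in> rkhs (scaled_kernel \<phi> \<beta>)"
    then obtain d where d: "summable (\<lambda>n. (d n)\<^sup>2 / \<beta> n)" "\<And>t. (\<lambda>n. d n * \<phi> n t) sums f t"
      using scaled_rkhs_expansion[OF onb \<beta>] by blast
    have "c = d" by (rule scaled_coefficients_unique[OF onb \<alpha> c' c(2) \<beta> d])
    then show "summable (\<lambda>n. (c n)\<^sup>2 / \<beta> n)" using d(1) by simp
  next
    assume "summable (\<lambda>n. (c n)\<^sup>2 / \<beta> n)"
    then show "f \<in> rkhs (scaled_kernel \<phi> \<beta>)" by (rule scaled_rkhs_synthesis(1)[OF onb \<beta> _ c(2)])
  qed
  then show ?thesis by (simp add: divide_inverse mult.commute)
qed

lemma bounded_coefficients_iff:
  "(\<forall>\<beta>\<in>continuous_scalings \<phi>. f \<in> rkhs (scaled_kernel \<phi> \<beta>) \<longleftrightarrow> summable (\<lambda>n. inverse (\<beta> n))) \<longleftrightarrow>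
   (\<exists>c. (\<forall>t. (\<lambda>n. c n * \<phi> n t) sums f t) \<and>
     (\<exists>\<delta>>0. \<forall>\<^sub>F n in sequentially. \<delta> \<le> (c n)\<^sup>2) \<and> (\<exists>B. \<forall>n. (c n)\<^sup>2 \<le> B))"
proof
  assume *: "\<forall>\<beta>\<in>continuous_scalings \<phi>. f \<in> rkhs (scaled_kernel \<phi> \<beta>) \<longleftrightarrow> summable (\<lambda>n. inverse (\<beta> n))"
  then have "f \<in> rkhs (scaled_kernel \<phi> \<alpha>)" using \<alpha> s\<alpha> by blast
  then obtain c where "summable (\<lambda>n. (c n)\<^sup>2 / \<alpha> n)" and cf: "\<And>t. (\<lambda>n. c n * \<phi> n t) sums f t"
    using scaled_rkhs_expansion[OF onb \<alpha>] by blast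
  then have c\<alpha>: "summable (\<lambda>n. inverse (\<alpha> n) * (c n)\<^sup>2)" by (simp add: divide_inverse mult.commute)
  \<comment> \<open>The same summable part 1/\<alpha> occurs on both sides of the condition for the
    perturbed scaling and can be cancelled, with and without the factor
    \<open>(c n)\<^sup>2\<close>. What remains is the hypothesis of both multiplier lemmas.\<close>
  have eq: "summable a \<longleftrightarrow> summable (\<lambda>n. a n * (c n)\<^sup>2)" if a: "\<And>n. 0 \<le> a n" for a :: "nat \<Rightarrow> real"
  proof -
    let ?\<beta> = "\<lambda>n. inverse (inverse (\<alpha> n) + a n)"
    have \<beta>: "?\<beta> \<in> continuous_scalings \<phi>" by (rule continuous_scalings_perturb[OF \<alpha> a \<phi>])
    have iff: "summable (\<lambda>n. x n + y n) \<longleftrightarrow> summable y" if "summable x" for x y :: "nat \<Rightarrow> real"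
      using summable_add[OF that, of y] summable_diff[OF _ that, of "\<lambda>n. x n + y n"] by auto
    have "summable a \<longleftrightarrow> summable (\<lambda>n. inverse (?\<beta> n))" using iff[OF s\<alpha>, of a] by simp
    also have "\<dots> \<longleftrightarrow> f \<in> rkhs (scaled_kernel \<phi> ?\<beta>)" using bspec[OF * \<beta>] by (rule sym)
    also have "\<dots> \<longleftrightarrow> summable (\<lambda>n. inverse (?\<beta> n) * (c n)\<^sup>2)"
      by (rule scaled_rkhs_iff_coefficients[OF \<beta> c\<alpha> cf])
    also have "\<dots> \<longleftrightarrow> summable (\<lambda>n. a n * (c n)\<^sup>2)"
      using iff[OF c\<alpha>, of "\<lambda>n. a n * (c n)\<^sup>2"] by (simp add: distrib_right)
    finally show ?thesis .
  qed
  have "\<exists>B. \<forall>n. (c n)\<^sup>2 \<le> B" by (rule bounded_if_summable_products) (simp add: eq)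
  moreover have "\<exists>\<delta>>0. \<forall>\<^sub>F n in sequentially. \<delta> \<le> (c n)\<^sup>2"
    by (rule eventually_bounded_below_if_summable_products) (simp_all add: eq)
  ultimately show "\<exists>c. (\<forall>t. (\<lambda>n. c n * \<phi> n t) sums f t) \<and>
     (\<exists>\<delta>>0. \<forall>\<^sub>F n in sequentially. \<delta> \<le> (c n)\<^sup>2) \<and> (\<exists>B. \<forall>n. (c n)\<^sup>2 \<le> B)"
    using cf by blast
next
  assume "\<exists>c. (\<forall>t. (\<lambda>n. c n * \<phi> n t) sums f t) \<and>
     (\<exists>\<delta>>0. \<forall>\<^sub>F n in sequentially. \<delta> \<le> (c n)\<^sup>2) \<and> (\<exists>B. \<forall>n. (c n)\<^sup>2 \<le> B)"
  then obtain c \<delta> B where cf: "\<And>t. (\<lambda>n. c n * \<phi> n t) sums f t"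
    and \<delta>: "\<delta> > 0" "\<forall>\<^sub>F n in sequentially. \<delta> \<le> (c n)\<^sup>2" and B: "\<And>n. (c n)\<^sup>2 \<le> B" by blast
  have eq: "summable (\<lambda>n. inverse (\<beta> n) * (c n)\<^sup>2) \<longleftrightarrow> summable (\<lambda>n. inverse (\<beta> n))"
    if \<beta>: "\<beta> \<in> continuous_scalings \<phi>" for \<beta>
  proof
    have pos: "0 < inverse (\<beta> n)" for n using \<beta> by (auto simp: continuous_scalings_def is_scaling_def)
    show "summable (\<lambda>n. inverse (\<beta> n) * (c n)\<^sup>2)" if "summable (\<lambda>n. inverse (\<beta> n))"
    proof (rule summable_comparison_test[OF _ summable_mult2[OF that, of B]], intro exI allI impI)
      show "norm (inverse (\<beta> n) * (c n)\<^sup>2) \<le> inverse (\<beta> n) * B" for n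
        using mult_left_mono[OF B less_imp_le[OF pos], of n n] pos[of n] by (simp add: abs_mult)
    qed
    show "summable (\<lambda>n. inverse (\<beta> n))" if s: "summable (\<lambda>n. inverse (\<beta> n) * (c n)\<^sup>2)"
    proof (rule summable_comparison_test_ev[OF _ summable_divide[OF s, of \<delta>]])
      show "\<forall>\<^sub>F n in sequentially. norm (inverse (\<beta> n)) \<le> inverse (\<beta> n) * (c n)\<^sup>2 / \<delta>"
        using \<delta>(2)
      proof eventually_elim
        case (elim n)
        have "inverse (\<beta> n) * \<delta> \<le> inverse (\<beta> n) * (c n)\<^sup>2"
          using elim pos[of n] by (intro mult_left_mono) simp_all
        moreover have "norm (inverse (\<beta> n)) = inverse (\<beta> n)" using pos[of n] by simp
        ultimately show ?case using \<delta>(1) by (simp only: pos_le_divide_eq)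
      qed
    qed
  qed
  have "summable (\<lambda>n. inverse (\<alpha> n) * (c n)\<^sup>2)" using eq[OF \<alpha>] s\<alpha> by simp
  then show "\<forall>\<beta>\<in>continuous_scalings \<phi>. f \<in> rkhs (scaled_kernel \<phi> \<beta>) \<longleftrightarrow> summable (\<lambda>n. inverse (\<beta> n))"
    using scaled_rkhs_iff_coefficients[OF _ _ cf] eq by blast
qed

text \<open>The constant coefficients 1 satisfy both bounds, so the sum of the basis functions
  witnesses non-emptiness. Its convergence is the arithmetic-geometric mean inequality with weight
  \<alpha>.\<close>

lemma unit_coefficients_sums:
  "\<exists>f. \<forall>t. (\<lambda>n. 1 * \<phi> n t) sums f t"
proof -
  have pos: "\<alpha> n > 0" for n using \<alpha> by (auto simp: continuous_scalings_def is_scaling_def)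
  have "summable (\<lambda>n. 1 * \<phi> n t)" for t
  proof (rule summable_comparison_test)
    show "summable (\<lambda>n. inverse (\<alpha> n) + \<alpha> n * (\<phi> n t)\<^sup>2)"
      using \<alpha> by (intro summable_add s\<alpha>) (auto simp: continuous_scalings_def is_scaling_def)
    have "\<bar>y\<bar> \<le> inverse a + a * y\<^sup>2" if a: "a > 0" for a y :: real
    proof -
      have "0 \<le> inverse a * (1 - a * \<bar>y\<bar>)\<^sup>2" using a by simp
      also have "\<dots> = inverse a + a * y\<^sup>2 - 2 * \<bar>y\<bar>"
        using a by (simp add: power2_diff field_simps power2_eq_square)
      finally show ?thesis by simp
    qed
    then show "\<exists>N. \<forall>n\<ge>N. norm (1 * \<phi> n t) \<le> inverse (\<alpha> n) + \<alpha> n * (\<phi> n t)\<^sup>2"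
      using pos by auto
  qed
  then show ?thesis by (intro exI[of _ "\<lambda>t. \<Sum>n. 1 * \<phi> n t"]) (blast intro: summable_sums)
qed

end

section \<open>Atoms of the generated sigma-algebra and the conclusion\<close>

text \<open>Tying containment of \<open>A\<close> to measure one, and disjointness to measure zero,
  makes the claim inductive: complements exchange the two cases, and a union falls into the first as
  soon as one member does.\<close>

lemma sigma_sets_atom:
  assumes P: "prob_space P" and meas: "\<H> \<subseteq> sets P"
    and zero_one: "\<And>H. H \<in> \<H> \<Longrightarrow> emeasure P H = 0 \<or> emeasure P H = 1"
    and A: "A \<subseteq> space P" "\<And>f H. f \<in> A \<Longrightarrow> H \<in> \<H> \<Longrightarrow> f \<in> H \<longleftrightarrow> emeasure P H = 1"
    and H: "H \<in> sigma_sets (space P) \<H>"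
  shows "A \<subseteq> H \<and> emeasure P H = 1 \<or> A \<inter> H = {} \<and> emeasure P H = 0"
  using H
proof induction
  case (Basic H)
  then show ?case using zero_one A(2) by fastforce
next
  case Empty
  then show ?case by simp
next
  case (Compl H)
  have H: "H \<in> sets P" using Compl(1) sets.sigma_sets_subset[OF meas] by blast
  have "emeasure P (space P - H) = 1 - emeasure P H"
    using emeasure_compl[OF H] prob_space.emeasure_space_1[OF P] Compl.IH by auto
  then show ?case using Compl.IH A(1) by auto
next
  case (Union H)
  have H: "H i \<in> sets P" for i using Union(1) sets.sigma_sets_subset[OF meas] by blast
  show ?case
  proof (cases "\<exists>i. A \<subseteq> H i \<and> emeasure P (H i) = 1")
    case True
    then obtain i where i: "A \<subseteq> H i" "emeasure P (H i) = 1" by auto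
    have "emeasure P (H i) \<le> emeasure P (\<Union>i. H i)" by (rule emeasure_mono) (use H in auto)
    then have "emeasure P (\<Union>i. H i) = 1"
      using i(2) prob_space.emeasure_le_1[OF P, of "\<Union>i. H i"] by simp
    then show ?thesis using i(1) by auto
  next
    case False
    then have z: "A \<inter> H i = {} \<and> emeasure P (H i) = 0" for i using Union.IH[of i] by blast
    then have "emeasure P (\<Union>i. H i) = 0" using H by (intro emeasure_UN_eq_0) auto
    then show ?thesis using z by auto
  qed
qed

theorem theorem4p8:
  fixes M :: "'w measure"
    and X :: "'t::polish_space \<Rightarrow> 'w \<Rightarrow> real"
    and K :: "'t \<Rightarrow> 't \<Rightarrow> real"
    and \<phi> :: "nat \<Rightarrow> 't \<Rightarrow> real"
  assumes "continuous_kernel K"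
    and "pos_semidef_kernel K"
    and "infinite_dimensional (rkhs K)"
    and "rkhs_separable K"
    and "centred_gaussian_process M X K"
    and "continuous_paths M X"
    and "orthonormal_basis K \<phi>"
    and "\<exists>\<alpha>. is_scaling \<phi> \<alpha> \<and> summable (\<lambda>n. inverse (\<alpha> n)) \<and>
             continuous_kernel (scaled_kernel \<phi> \<alpha>)"
    and "scaled_bases_orthonormal \<phi>"
    and "Metric_space UNIV (kernel_dist K)"
  shows "sample_support M X (scaled_kernel \<phi> ` continuous_scalings \<phi>) \<noteq> {} \<and>
         sample_support M X (scaled_kernel \<phi> ` continuous_scalings \<phi>) =
           {f. \<exists>c :: nat \<Rightarrow> real.
                 (\<forall>t. (\<lambda>n. c n * \<phi> n t) sums f t) \<and>
                 liminf (\<lambda>n. ereal ((c n)\<^sup>2)) > 0 \<and>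
                 (SUP n. ereal ((c n)\<^sup>2)) < \<infinity>}"
proof -
  have K: "continuous_kernel K" "pos_semidef_kernel K" and process: "centred_gaussian_process M X K"
    and basis: "orthonormal_basis K \<phi>" and onb: "scaled_bases_orthonormal \<phi>" by fact+
  obtain \<alpha> where \<alpha>: "\<alpha> \<in> continuous_scalings \<phi>" and s\<alpha>: "summable (\<lambda>n. inverse (\<alpha> n))"
    using assms(8) by (auto simp: continuous_scalings_def)
  interpret prob_space M using process by (simp add: centred_gaussian_process_def)
  interpret gaussian_rkhs M X K using process K(2) by unfold_locales
  have X: "X t \<in> borel_measurable M" for t by (rule process_measurable)
  have \<phi>: "continuous_on UNIV (\<phi> n)" for n
    by (rule is_rkhs_continuous[OF rkhs basis_mem[OF rkhs basis] K(1)])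
  have rc: "rkhs (scaled_kernel \<phi> \<beta>) \<subseteq> continuous_functions" if "\<beta> \<in> continuous_scalings \<phi>" for \<beta>
    using that is_rkhs_continuous[OF scaled_kernel_is_rkhs] by (auto simp: continuous_scalings_def continuous_functions_def)
  let ?P = "path_law M X" and ?\<RR> = "scaled_kernel \<phi> ` continuous_scalings \<phi>"
  \<comment> \<open>This form matches the generators of measure one directly; the description by
    coefficients is derived from it.\<close>
  define A where "A = {f. \<forall>\<beta>\<in>continuous_scalings \<phi>.
    f \<in> rkhs (scaled_kernel \<phi> \<beta>) \<longleftrightarrow> summable (\<lambda>n. inverse (\<beta> n))}"
  have A: "A = {f. \<exists>c :: nat \<Rightarrow> real. (\<forall>t. (\<lambda>n. c n * \<phi> n t) sums f t) \<and>
      liminf (\<lambda>n. ereal ((c n)\<^sup>2)) > 0 \<and> (SUP n. ereal ((c n)\<^sup>2)) < \<infinity>}"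
    unfolding A_def bounded_coefficients_iff[OF onb \<alpha> s\<alpha> \<phi>] liminf_sup_iff by simp
  have "A \<noteq> {}"
  proof -
    obtain f where "\<forall>t. (\<lambda>n. 1 * \<phi> n t) sums f t"
      using unit_coefficients_sums[OF onb \<alpha> s\<alpha> \<phi>] by blast
    then have "f \<in> A" unfolding A_def bounded_coefficients_iff[OF onb \<alpha> s\<alpha> \<phi>] mem_Collect_eq
      by (intro exI[of _ "\<lambda>_. 1"]) (auto intro!: exI[of _ 1])
    then show ?thesis by auto
  qed
  have AC: "A \<subseteq> continuous_functions" using rc[OF \<alpha>] \<alpha> s\<alpha> by (auto simp: A_def)
  have "emeasure ?P (continuous_functions) = 1"
    by (rule path_law_almost_all(2)[OF X assms(6) prob_space_axioms]) auto
  then have P: "prob_space ?P" by (intro prob_spaceI) (simp add: space_path_law[OF X assms(6)])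
  have full: "rkhs (scaled_kernel \<phi> \<beta>) \<in> sets ?P \<and> emeasure ?P (rkhs (scaled_kernel \<phi> \<beta>)) = 1"
    if \<beta>: "\<beta> \<in> continuous_scalings \<phi>" and s: "summable (\<lambda>n. inverse (\<beta> n))" for \<beta>
  proof -
    have "AE f in process_law M X. f \<in> continuous_functions \<longrightarrow> f \<in> rkhs (scaled_kernel \<phi> \<beta>)"
      using AE_path_in_scaled_rkhs_iff[OF K process basis onb \<alpha> s\<alpha> \<beta>] by (simp add: s)
    from path_law_almost_all[OF X assms(6) prob_space_axioms rc[OF \<beta>] this] show ?thesis by blast
  qed
  \<comment> \<open>The complements are recorded for maximality: a null space keeps points out of a
    candidate only through its complement, which is a member of the sigma-algebra with measure
    one.\<close>
  have null: "rkhs (scaled_kernel \<phi> \<beta>) \<in> sets ?P \<and> emeasure ?P (rkhs (scaled_kernel \<phi> \<beta>)) = 0 \<and>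
      continuous_functions - rkhs (scaled_kernel \<phi> \<beta>) \<in> sigma_sets continuous_functions (rkhs ` ?\<RR>) \<and>
      emeasure ?P (continuous_functions - rkhs (scaled_kernel \<phi> \<beta>)) = 1"
    if \<beta>: "\<beta> \<in> continuous_scalings \<phi>" and s: "\<not> summable (\<lambda>n. inverse (\<beta> n))" for \<beta>
  proof -
    let ?H = "rkhs (scaled_kernel \<phi> \<beta>)"
    have "AE f in process_law M X. f \<in> continuous_functions \<longrightarrow> f \<in> continuous_functions - ?H"
      using AE_path_in_scaled_rkhs_iff[OF K process basis onb \<alpha> s\<alpha> \<beta>] by (simp add: s)
    note c = path_law_almost_all[OF X assms(6) prob_space_axioms Diff_subset this]
    have e: "space ?P - (continuous_functions - ?H) = ?H"
      using rc[OF \<beta>] by (auto simp: space_path_law[OF X assms(6)])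
    have "?H \<in> sets ?P" using sets.compl_sets[OF c(1)] e by simp
    moreover have "emeasure ?P ?H = 0"
      using emeasure_compl[OF c(1)] c(2) prob_space.emeasure_space_1[OF P] e by simp
    ultimately show ?thesis using c(2) \<beta> by (auto intro: sigma_sets.Compl)
  qed
  let ?Q = "\<lambda>S. S \<subseteq> continuous_functions \<and> (\<forall>H\<in>rkhs_sigma_algebra ?\<RR>. emeasure ?P H = 1 \<longrightarrow> S \<subseteq> H)"
  have "(GREATEST S. ?Q S) = A"
  proof (rule Greatest_equality)
    have "A \<subseteq> H" if "H \<in> rkhs_sigma_algebra ?\<RR>" "emeasure ?P H = 1" for H
    proof -
      have "A \<subseteq> H \<and> emeasure ?P H = 1 \<or> A \<inter> H = {} \<and> emeasure ?P H = 0"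
      proof (rule sigma_sets_atom[OF P, of "rkhs ` ?\<RR>"])
        show "H \<in> sigma_sets (space ?P) (rkhs ` ?\<RR>)"
          using that(1) by (simp add: rkhs_sigma_algebra_def space_path_law[OF X assms(6)])
        show "A \<subseteq> space ?P" using AC by (simp add: space_path_law[OF X assms(6)])
        show "rkhs ` ?\<RR> \<subseteq> sets ?P" using full null by blast
        show "emeasure ?P H = 0 \<or> emeasure ?P H = 1" if "H \<in> rkhs ` ?\<RR>" for H
          using that full null by blast
        show "f \<in> H \<longleftrightarrow> emeasure ?P H = 1" if f: "f \<in> A" and H: "H \<in> rkhs ` ?\<RR>" for f H
        proof -
          obtain \<beta> where \<beta>: "\<beta> \<in> continuous_scalings \<phi>" "H = rkhs (scaled_kernel \<phi> \<beta>)" using H by blast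
          then have "f \<in> H \<longleftrightarrow> summable (\<lambda>n. inverse (\<beta> n))" using f by (simp add: A_def)
          then show ?thesis using full[OF \<beta>(1)] null[OF \<beta>(1)] \<beta>(2)
            by (cases "summable (\<lambda>n. inverse (\<beta> n))") auto
        qed
      qed
      then show ?thesis using that(2) by simp
    qed
    then show "?Q A" using AC by blast
  next
    fix S assume S: "?Q S"
    show "S \<subseteq> A"
    proof
      fix f assume f: "f \<in> S"
      \<comment> \<open>Generators of measure one force membership, complements of null generators
        forbid it, and together they place \<open>f\<close> in the atom.\<close>
      have "f \<in> rkhs (scaled_kernel \<phi> \<beta>) \<longleftrightarrow> summable (\<lambda>n. inverse (\<beta> n))"
        if \<beta>: "\<beta> \<in> continuous_scalings \<phi>" for \<beta>
      proof
        assume "summable (\<lambda>n. inverse (\<beta> n))"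
        moreover have "rkhs (scaled_kernel \<phi> \<beta>) \<in> rkhs_sigma_algebra ?\<RR>"
          using \<beta> by (auto simp: rkhs_sigma_algebra_def)
        ultimately show "f \<in> rkhs (scaled_kernel \<phi> \<beta>)" using S f full[OF \<beta>] by blast
      next
        assume "f \<in> rkhs (scaled_kernel \<phi> \<beta>)"
        then show "summable (\<lambda>n. inverse (\<beta> n))"
          using S f null[OF \<beta>] unfolding rkhs_sigma_algebra_def by blast
      qed
      then show "f \<in> A" by (simp add: A_def)
    qed
  qed
  then show ?thesis using \<open>A \<noteq> {}\<close> A by (simp add: sample_support_def)
qed

end
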